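(* Let $\mathbb K$ be a field of characteristic $0$ and let $n\geq 2$. Let $\Gamma_1\subset\mathbb P^n_{\mathbb K}$ be a generic set of $\alpha$ points in a hyperplane $H$ of $\mathbb P^n_{\mathbb K}$, with $\Gamma_1$ spanning $H$, and let $\Gamma_2\subset\mathbb P^n_{\mathbb K}$ be a set of $\beta\geq 1$ distinct points on a line not contained in $H$, such that no point of $\Gamma_2$ lies in $H$. Suppose that $\alpha\geq\beta+n-2$. Let $\Gamma=\Gamma_1\cup\Gamma_2$, and suppose that $\mathrm{hyp}(\Gamma)=\alpha$. Then: 1. If $\alpha<\binom{\beta+n-3}{n-1}$, then $d(\Gamma)>A_n$. 2. If $\alpha\geq\binom{\beta+n}{n-1}$, then $d(\Gamma)=A_n$.
   Context: All points are $\mathbb K$-rational. For a finite set $\Gamma\subset\mathbb P^n_{\mathbb K}$, $\mathrm{hyp}(\Gamma)$ is the maximum number of points of $\Gamma$ contained in any hyperplane of $\mathbb P^n_{\mathbb K}$, and $d(\Gamma)=|\Gamma|-\mathrm{hyp}(\Gamma)$. Let $R=\mathbb K[x_0,\ldots,x_n]$ with the standard grading and let $I\subset R$ be the homogeneous ideal of all polynomials vanishing on $\Gamma$. If $$0\rightarrow F_n=\bigoplus_i R(-a_i)\rightarrow\cdots\rightarrow F_1\rightarrow R\rightarrow R/I\rightarrow 0$$ is the graded minimal free resolution of $R/I$, then $A_n=\min_i\{a_i-n\}$. A set of $\alpha$ points in a hyperplane $H\cong\mathbb P^{n-1}_{\mathbb K}$ is called generic if its Hilbert function is as large as possible: with $S$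 the standard graded polynomial ring in $n$ variables that is the homogeneous coordinate ring of $H$, and $J\subset S$ the ideal of the points, $\dim_{\mathbb K}(S/J)_i=\min\left\{\binom{i+n-1}{n-1},\alpha\right\}$ for all $i\geq 0$. Binomial coefficients $\binom{p}{q}$ with $0\le p<q$ are $0$. *)

theory Defs
  imports "HOL-Library.Poly_Mapping" "Jordan_Normal_Form.Matrix"
begin

text \<open>
  Finitely supported functions serve two purposes. A vector of coordinates \<open>x\<^sub>0, \<dots>, x\<^sub>n\<close> is a
  \<open>nat \<Rightarrow>\<^sub>0 'a\<close> whose support lies in \<open>{..n}\<close>, and a polynomial is a \<open>(nat \<Rightarrow>\<^sub>0 nat) \<Rightarrow>\<^sub>0 'a\<close>,
  mapping exponent vectors to coefficients, with convolution as multiplication. Both are vector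
  spaces under the same pointwise scaling.
\<close>

definition pm_scale :: "'a::field \<Rightarrow> ('k \<Rightarrow>\<^sub>0 'a) \<Rightarrow> ('k \<Rightarrow>\<^sub>0 'a)" where
  "pm_scale c v = Poly_Mapping.map ((*) c) v"

lemma lookup_pm_scale [simp]:
  "Poly_Mapping.lookup (pm_scale c v) k = c * Poly_Mapping.lookup v k"
  by (simp add: pm_scale_def Poly_Mapping.map.rep_eq when_def)

interpretation pm: vector_space "pm_scale :: 'a::field \<Rightarrow> ('k \<Rightarrow>\<^sub>0 'a) \<Rightarrow> ('k \<Rightarrow>\<^sub>0 'a)"
  by unfold_locales (auto intro!: poly_mapping_eqI simp: lookup_add algebra_simps)


section \<open>Projective space\<close>

definition coord_vecs :: "nat \<Rightarrow> (nat \<Rightarrow>\<^sub>0 'a::field) set" where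
  "coord_vecs n = {v. Poly_Mapping.keys v \<subseteq> {..n}}"

definition proj_rel :: "nat \<Rightarrow> ((nat \<Rightarrow>\<^sub>0 'a::field) \<times> (nat \<Rightarrow>\<^sub>0 'a)) set" where
  "proj_rel n = {(v, w). v \<in> coord_vecs n - {0} \<and> w \<in> coord_vecs n - {0} \<and>
     (\<exists>c. c \<noteq> 0 \<and> w = pm_scale c v)}"

definition proj_space :: "nat \<Rightarrow> (nat \<Rightarrow>\<^sub>0 'a::field) set set" where
  "proj_space n = (coord_vecs n - {0}) // proj_rel n"

definition proj_subspace :: "nat \<Rightarrow> nat \<Rightarrow> (nat \<Rightarrow>\<^sub>0 'a::field) set set \<Rightarrow> bool" where
  "proj_subspace n k L \<longleftrightarrow>
     (\<exists>U. pm.subspace U \<and> U \<subseteq> coord_vecs n \<and> pm.dim U = k + 1 \<and> L = {P \<in> proj_space n. P \<subseteq> U})"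

definition hyperplane :: "nat \<Rightarrow> (nat \<Rightarrow>\<^sub>0 'a::field) set set \<Rightarrow> bool" where
  "hyperplane n H \<longleftrightarrow> proj_subspace n (n - 1) H"

definition line :: "nat \<Rightarrow> (nat \<Rightarrow>\<^sub>0 'a::field) set set \<Rightarrow> bool" where
  "line n L \<longleftrightarrow> proj_subspace n 1 L"

definition proj_span :: "nat \<Rightarrow> (nat \<Rightarrow>\<^sub>0 'a::field) set set \<Rightarrow> (nat \<Rightarrow>\<^sub>0 'a) set set" where
  "proj_span n X = {P \<in> proj_space n. P \<subseteq> pm.span (\<Union>X)}"

definition hyp :: "nat \<Rightarrow> (nat \<Rightarrow>\<^sub>0 'a::field) set set \<Rightarrow> nat" where
  "hyp n X = Max {card (X \<inter> H) | H. hyperplane n H}"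

definition d_inv :: "nat \<Rightarrow> (nat \<Rightarrow>\<^sub>0 'a::field) set set \<Rightarrow> nat" where
  "d_inv n X = card X - hyp n X"


section \<open>The polynomial ring in \<open>x\<^sub>0, \<dots>, x\<^sub>n\<close> and vanishing ideals\<close>

type_synonym 'a mpoly = "(nat \<Rightarrow>\<^sub>0 nat) \<Rightarrow>\<^sub>0 'a"

definition poly_ring :: "nat \<Rightarrow> 'a::field mpoly set" where
  "poly_ring n = {p. \<forall>m \<in> Poly_Mapping.keys p. Poly_Mapping.keys m \<subseteq> {..n}}"

definition total_deg :: "(nat \<Rightarrow>\<^sub>0 nat) \<Rightarrow> nat" where
  "total_deg m = (\<Sum>i \<in> Poly_Mapping.keys m. Poly_Mapping.lookup m i)"

text \<open>Degrees are integers; the zero polynomial is the only homogeneous one of negative degree.\<close>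

definition homogeneous :: "int \<Rightarrow> 'a::field mpoly \<Rightarrow> bool" where
  "homogeneous e p \<longleftrightarrow> (\<forall>m \<in> Poly_Mapping.keys p. int (total_deg m) = e)"

definition poly_eval :: "'a::field mpoly \<Rightarrow> (nat \<Rightarrow>\<^sub>0 'a) \<Rightarrow> 'a" where
  "poly_eval p v = (\<Sum>m \<in> Poly_Mapping.keys p. Poly_Mapping.lookup p m *
     (\<Prod>i \<in> Poly_Mapping.keys m. Poly_Mapping.lookup v i ^ Poly_Mapping.lookup m i))"

text \<open>
  Vanishing is required at every representative of every point. Over an infinite field this set
  is exactly the homogeneous ideal generated by the forms that vanish on the set of points.
\<close>

definition vanishing_ideal :: "nat \<Rightarrow> (nat \<Rightarrow>\<^sub>0 'a::field) set set \<Rightarrow> 'a mpoly set" where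
  "vanishing_ideal n X = {p \<in> poly_ring n. \<forall>P \<in> X. \<forall>v \<in> P. poly_eval p v = 0}"


section \<open>Hilbert functions and generic sets of points in a hyperplane\<close>

text \<open>\<open>B\<close> is a set of representatives for a basis of the quotient space \<open>V / W\<close>.\<close>

definition quotient_basis ::
    "('k \<Rightarrow>\<^sub>0 'a::field) set \<Rightarrow> ('k \<Rightarrow>\<^sub>0 'a) set \<Rightarrow> ('k \<Rightarrow>\<^sub>0 'a) set \<Rightarrow> bool" where
  "quotient_basis V W B \<longleftrightarrow> B \<subseteq> V \<and> pm.independent B \<and> pm.span B \<inter> W = {0} \<and>
     (\<forall>v \<in> V. \<exists>u \<in> pm.span B. v - u \<in> W)"

definition quotient_dim :: "('k \<Rightarrow>\<^sub>0 'a::field) set \<Rightarrow> ('k \<Rightarrow>\<^sub>0 'a) set \<Rightarrow> nat" where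
  "quotient_dim V W = card (SOME B. quotient_basis V W B)"

definition graded_part :: "nat \<Rightarrow> nat \<Rightarrow> 'a::field mpoly set" where
  "graded_part n i = {p \<in> poly_ring n. homogeneous (int i) p}"

definition hilbert_function :: "nat \<Rightarrow> (nat \<Rightarrow>\<^sub>0 'a::field) set set \<Rightarrow> nat \<Rightarrow> nat" where
  "hilbert_function n X i =
     quotient_dim (graded_part n i) (graded_part n i \<inter> vanishing_ideal n X)"

text \<open>
  An identification of the projective space of dimension \<open>n - 1\<close> with the hyperplane \<open>H\<close> of the
  projective space of dimension \<open>n\<close>, induced by an injective linear map on coordinate vectors.
  Such a map sends a point, which is a class of nonzero vectors, to its image as a set.
\<close>

definition hyperplane_chart ::
    "nat \<Rightarrow> (nat \<Rightarrow>\<^sub>0 'a::field) set set \<Rightarrow> ((nat \<Rightarrow>\<^sub>0 'a) \<Rightarrow> (nat \<Rightarrow>\<^sub>0 'a)) \<Rightarrow> bool" where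
  "hyperplane_chart n H \<phi> \<longleftrightarrow> Vector_Spaces.linear pm_scale pm_scale \<phi> \<and>
     inj_on \<phi> (coord_vecs (n - 1)) \<and> (\<lambda>Q. \<phi> ` Q) ` proj_space (n - 1) = H"

text \<open>
  The points are transported to the projective space of dimension \<open>n - 1\<close>, so that the Hilbert
  function is computed in the polynomial ring in \<open>n\<close> variables. It does not depend on the chart.
\<close>

definition generic_in_hyperplane ::
    "nat \<Rightarrow> (nat \<Rightarrow>\<^sub>0 'a::field) set set \<Rightarrow> (nat \<Rightarrow>\<^sub>0 'a) set set \<Rightarrow> bool" where
  "generic_in_hyperplane n H X \<longleftrightarrow> finite X \<and> X \<subseteq> H \<and>
     (\<exists>\<phi>. hyperplane_chart n H \<phi> \<and>
       (\<forall>i. hilbert_function (n - 1) {Q \<in> proj_space (n - 1). \<phi> ` Q \<in> X} i =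
            min ((i + n - 1) choose (n - 1)) (card X)))"


section \<open>Graded minimal free resolutions\<close>

definition free_module :: "nat \<Rightarrow> nat \<Rightarrow> 'a::field mpoly vec set" where
  "free_module n r = {v \<in> carrier_vec r. \<forall>k < r. v $ k \<in> poly_ring n}"

definition map_image :: "nat \<Rightarrow> 'a::field mpoly mat \<Rightarrow> 'a mpoly vec set" where
  "map_image n A = (\<lambda>v. A *\<^sub>v v) ` free_module n (dim_col A)"

definition map_kernel :: "nat \<Rightarrow> 'a::field mpoly mat \<Rightarrow> 'a mpoly vec set" where
  "map_kernel n A = {v \<in> free_module n (dim_col A). A *\<^sub>v v = 0\<^sub>v (dim_row A)}"

text \<open>
  With \<open>a i = [a\<^sub>1, \<dots>, a\<^sub>r]\<close> standing for \<open>F\<^sub>i = R(-a\<^sub>1) \<oplus> \<dots> \<oplus> R(-a\<^sub>r)\<close>, whose basis vectors have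
  degrees \<open>a\<^sub>1, \<dots>, a\<^sub>r\<close>, the matrix \<open>D i\<close> describes a degree-preserving map \<open>F\<^sub>i \<rightarrow> F\<^sub>i\<^sub>-\<^sub>1\<close>.
  The condition on its constant terms is minimality: the image lies in the multiples of
  \<open>F\<^sub>i\<^sub>-\<^sub>1\<close> by the irrelevant ideal. The remaining clauses are exactness of
  \<open>0 \<rightarrow> F\<^sub>n \<rightarrow> \<dots> \<rightarrow> F\<^sub>1 \<rightarrow> F\<^sub>0 = R \<rightarrow> R/I \<rightarrow> 0\<close> at \<open>R\<close>, at \<open>F\<^sub>1, \<dots>, F\<^sub>n\<^sub>-\<^sub>1\<close> and at \<open>F\<^sub>n\<close>.
\<close>

definition minimal_graded_free_resolution ::
    "nat \<Rightarrow> 'a::field mpoly set \<Rightarrow> (nat \<Rightarrow> int list) \<Rightarrow> (nat \<Rightarrow> 'a mpoly mat) \<Rightarrow> bool" where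
  "minimal_graded_free_resolution n I a D \<longleftrightarrow>
     a 0 = [0] \<and>
     (\<forall>i \<in> {1..n}. D i \<in> carrier_mat (length (a (i - 1))) (length (a i)) \<and>
        (\<forall>j < length (a (i - 1)). \<forall>k < length (a i).
           D i $$ (j, k) \<in> poly_ring n \<and>
           homogeneous (a i ! k - a (i - 1) ! j) (D i $$ (j, k)) \<and>
           Poly_Mapping.lookup (D i $$ (j, k)) 0 = 0)) \<and>
     (\<lambda>v. v $ 0) ` map_image n (D 1) = I \<and>
     (\<forall>i \<in> {1..<n}. map_kernel n (D i) = map_image n (D (i + 1))) \<and>
     map_kernel n (D n) = {0\<^sub>v (length (a n))}"

definition A_inv :: "nat \<Rightarrow> (nat \<Rightarrow> int list) \<Rightarrow> int" where
  "A_inv n a = Min ((\<lambda>x. x - int n) ` set (a n))"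

end

theory Submission
  imports Defs "HOL-Library.Function_Algebras" "HOL-Computational_Algebra.Polynomial"
begin

text \<open>
  Write \<open>R\<^sub>t\<close> for the forms of degree \<open>t\<close> and \<open>I\<close> for the vanishing ideal of \<open>\<Gamma>\<close>. Computing \<open>Tor\<^sub>n(R/I, K)\<close>
  both from the resolution and from the Koszul complex of \<open>x\<^sub>0, \<dots>, x\<^sub>n\<close> shows that \<open>a - n\<close>, for \<open>R(-a)\<close>
  a summand of \<open>F\<^sub>n\<close>, ranges over the degrees \<open>t\<close> for which there are \<open>f\<^sub>0, \<dots>, f\<^sub>n \<in> R\<^sub>t\<close> with
  \<open>x\<^sub>i f\<^sub>j \<equiv> x\<^sub>j f\<^sub>i\<close> modulo \<open>I\<close> that are not of the form \<open>f\<^sub>i \<equiv> x\<^sub>i g\<close>. A form that vanishes at all points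
  of \<open>\<Gamma>\<close> but one, of the least degree possible, gives such a tuple. Since \<open>d(\<Gamma>) = \<beta>\<close>, it remains to
  compare these degrees with \<open>\<beta>\<close>.

  If \<open>\<alpha>\<close> is small, the points of \<open>\<Gamma>\<^sub>1\<close> are separated in \<open>H\<close> by forms of degree \<open>\<beta> - 2\<close>, hence by forms of
  degree at most \<open>\<beta> - 1\<close> that vanish also where the line meets \<open>H\<close>; cones over those separate points of
  \<open>\<Gamma>\<^sub>1\<close> from the rest of \<open>\<Gamma>\<close>. If \<open>\<alpha>\<close> is large, a form of degree at most \<open>\<beta>\<close> that vanishes on \<open>\<Gamma>\<^sub>1\<close> vanishes
  on \<open>H\<close>. Then a point of \<open>\<Gamma>\<^sub>2\<close> has minimal separators of degree \<open>\<beta>\<close>, and in lower degrees \<open>g\<close> can be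
  found on \<open>\<Gamma>\<^sub>2\<close> by division by the equation of \<open>H\<close> and on \<open>\<Gamma>\<^sub>1\<close> by division by a variable.
\<close>

section \<open>Alternating cochains\<close>

text \<open>With n + 1 variables, the n-th Koszul homology of R/I is not the socle of R/I, which is
  zero. A tuple with \<open>x_i f_j = x_j f_i\<close> on \<Gamma> amounts to a function s on
  representatives of the points, s = \<open>f_i / x_i\<close> wherever \<open>x_i\<close> is
  nonzero, such that each \<open>x_i s\<close> comes from a form of degree t. The tuple is trivial
  when s itself comes from a form of degree t - 1. Such s modulo the trivial ones form the socle of
  the first local cohomology of R/I in degree t - 1; minimal separators are the elements supported
  at one point. The obstacle for large \<alpha> is that a single form has to produce s on both parts
  of \<Gamma>. A first form is right on the line, and the correction on the hyperplane is a cone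
  that vanishes on the line. The degree \<beta> up to which forms must be determined by their values
  on the hyperplane points comes from the relations \<open>x_i f_j = x_j f_i\<close>: they have
  degree t + 1, and t < \<beta>. Characteristic 0 is used to divide by degrees in the contracting
  homotopy of the Koszul complex, and to have infinitely many points on each line.\<close>

text \<open>Cochains live on words rather than on sets of indices, so that contraction with a basis
  vector is mere prefixing. Vanishing on words with a repeated letter is a separate clause because
  swapping equal letters only yields \<open>c w = - c w\<close>.\<close>

definition alternating :: "('i list \<Rightarrow> 'v::ab_group_add) \<Rightarrow> bool" where
  "alternating c \<longleftrightarrow> (\<forall>u i j v. c (u @ i # j # v) = - c (u @ j # i # v)) \<and>
     (\<forall>w. \<not> distinct w \<longrightarrow> c w = 0)"

lemma alternating_swap: "alternating c \<Longrightarrow> c (u @ i # j # v) = - c (u @ j # i # v)"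
  unfolding alternating_def by blast

lemma alternating_swap_head: "alternating c \<Longrightarrow> c (i # j # v) = - c (j # i # v)"
  using alternating_swap[of c "[]" i j v] by simp

lemma alternating_nondistinct: "alternating c \<Longrightarrow> \<not> distinct w \<Longrightarrow> c w = 0"
  unfolding alternating_def by blast

lemma alternating_Cons:
  assumes "alternating c" shows "alternating (\<lambda>w. c (i # w))"
proof -
  have "c (i # u @ k # j # v) = - c (i # u @ j # k # v)" for u k j v
    using alternating_swap[OF assms, of "i # u" k j v] by simp
  moreover have "c (i # w) = 0" if "\<not> distinct w" for w
    using alternating_nondistinct[OF assms, of "i # w"] that by simp
  ultimately show ?thesis unfolding alternating_def append_Cons by blast
qed

lemma alternating_diff:
  assumes "alternating c" "alternating b" shows "alternating (\<lambda>w. c w - b w)"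
proof -
  have "c (u @ i # j # v) - b (u @ i # j # v) = - (c (u @ j # i # v) - b (u @ j # i # v))" for u i j v
    using alternating_swap[OF assms(1), of u i j v] alternating_swap[OF assms(2), of u i j v] by simp
  moreover have "c w - b w = 0" if "\<not> distinct w" for w
    using alternating_nondistinct[OF assms(1) that] alternating_nondistinct[OF assms(2) that] by simp
  ultimately show ?thesis unfolding alternating_def by blast
qed

lemma alternating_comp:
  assumes "alternating c" and "additive f" shows "alternating (\<lambda>w. f (c w))"
  unfolding alternating_def
proof (intro conjI allI impI)
  fix u i j v
  show "f (c (u @ i # j # v)) = - f (c (u @ j # i # v))"
    using alternating_swap[OF assms(1)] additive.minus[OF assms(2)] by metis
next
  fix w :: "'a list" assume "\<not> distinct w"
  then show "f (c w) = 0"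
    using alternating_nondistinct[OF assms(1)] additive.zero[OF assms(2)] by metis
qed

text \<open>Swaps bring two equal letters side by side; swapping these gives
  \<open>c w = - c w\<close>, which forces 0 in the absence of 2-torsion.\<close>

lemma alternatingI_torsion_free:
  fixes c :: "'i list \<Rightarrow> 'v::ab_group_add"
  assumes swap: "\<And>u i j v. c (u @ i # j # v) = - c (u @ j # i # v)"
    and tf: "\<And>x::'v. x = - x \<Longrightarrow> x = 0"
  shows "alternating c"
proof -
  have "c (xs @ y # ys @ y # zs) = 0" for xs ys zs y
  proof (induction ys arbitrary: xs)
    case Nil
    show ?case using swap[of xs y y zs] tf by simp
  next
    case (Cons z ys)
    have "c (xs @ y # (z # ys) @ y # zs) = - c ((xs @ [z]) @ y # ys @ y # zs)"
      using swap[of xs y z "ys @ y # zs"] by simp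
    then show ?case using Cons.IH[of "xs @ [z]"] by simp
  qed
  then have "c w = 0" if "\<not> distinct w" for w
    using not_distinct_decomp[OF that] by force
  then show ?thesis using swap unfolding alternating_def by blast
qed

section \<open>Signs of words\<close>

fun inversions :: "nat list \<Rightarrow> nat" where
  "inversions [] = 0"
| "inversions (i # w) = length (filter (\<lambda>j. j < i) w) + inversions w"

text \<open>The sign of the permutation that sorts \<open>w\<close>, acting on \<open>x\<close>. The
  values lie in a mere abelian group, so the sign is not a scalar factor.\<close>

definition signed :: "nat list \<Rightarrow> 'v::ab_group_add \<Rightarrow> 'v" where
  "signed w x = (if distinct w then if even (inversions w) then x else - x else 0)"

lemma inversions_swap:
  "i \<noteq> j \<Longrightarrow> even (inversions (u @ i # j # v)) = odd (inversions (u @ j # i # v))"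
  by (induction u) auto

lemma signed_swap: "signed (u @ i # j # v) x = - signed (u @ j # i # v) x"
proof (cases "i = j")
  case True
  then show ?thesis by (simp add: signed_def)
next
  case False
  then show ?thesis using inversions_swap[OF False, of u v] by (auto simp: signed_def)
qed

lemma signed_involution: "distinct w \<Longrightarrow> signed w (signed w x) = x"
  by (simp add: signed_def)

lemma signed_zero [simp]: "signed w 0 = 0"
  by (simp add: signed_def)

lemma signed_additive: "additive f \<Longrightarrow> f (signed w x) = signed w (f x)"
  by (simp add: signed_def additive.minus additive.zero)

lemma signed_diff: "signed w (x - y) = signed w x - signed w y"
  by (simp add: signed_def)

lemma signed_add: "signed w (x + y) = signed w x + signed w y"
  by (simp add: signed_def)

lemma sort_swap: "sort (u @ i # j # v) = sort (u @ j # i # v)"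
  for i j :: "'i::linorder"
  by (rule properties_for_sort) (simp_all add: ac_simps)

text \<open>Arbitrary values on sorted words extend to an alternating function. Cochains are built
  in this way from choices that have no reason to alternate.\<close>

lemma alternating_signed_sort:
  "alternating (\<lambda>w. signed w (g (sort w)))"
  unfolding alternating_def
proof (intro conjI allI impI)
  fix u i j v
  show "signed (u @ i # j # v) (g (sort (u @ i # j # v))) =
      - signed (u @ j # i # v) (g (sort (u @ j # i # v)))"
    using signed_swap sort_swap by metis
qed (simp add: signed_def)

text \<open>Moving an entry to its place in a sorted list costs one sign per smaller entry.\<close>

lemma alternating_insort:
  assumes "alternating c" and "x \<notin> set s" and "sorted s"
  shows "c (u @ x # s) =
    (if even (length (filter (\<lambda>j. j < x) s)) then c (u @ insort x s) else - c (u @ insort x s))"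
  using assms(2,3)
proof (induction s arbitrary: u)
  case Nil
  then show ?case by simp
next
  case (Cons y s)
  show ?case
  proof (cases "x \<le> y")
    case True
    then have e: "filter (\<lambda>j. j < x) (y # s) = []" using Cons.prems by (auto simp: filter_empty_conv)
    show ?thesis unfolding e using True by simp
  next
    case False
    have "c (u @ x # y # s) = - c ((u @ [y]) @ x # s)"
      using alternating_swap[OF assms(1), of u x y s] by simp
    then show ?thesis using Cons.IH[of "u @ [y]"] Cons.prems False by auto
  qed
qed

text \<open>Sort the tail in place, then insert the head; the signs of the two moves multiply to
  that of \<open>w\<close>. The prefix \<open>u\<close> in the induction lets the hypothesis apply
  behind the head.\<close>

lemma alternating_eq_signed_sort:
  assumes "alternating c"
  shows "c w = signed w (c (sort w))"
proof -
  have "distinct w \<Longrightarrow> c (u @ w) = signed w (c (u @ sort w))" for u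
  proof (induction w arbitrary: u)
    case Nil
    then show ?case by (simp add: signed_def)
  next
    case (Cons x w)
    have "length (filter (\<lambda>j. j < x) w) = length (filter (\<lambda>j. j < x) (sort w))"
      by (simp add: filter_sort)
    moreover have "c (u @ x # w) = signed w (c (u @ x # sort w))"
      using Cons.IH[of "u @ [x]"] Cons.prems by simp
    moreover have "x \<notin> set (sort w)" using Cons.prems by simp
    ultimately show ?case
      using alternating_insort[OF assms, of x "sort w" u] Cons.prems by (auto simp: signed_def)
  qed
  from this[of "[]"] show ?thesis
    using alternating_nondistinct[OF assms] by (cases "distinct w") (auto simp: signed_def)
qed

lemma alternating_signed_eq:
  assumes "alternating c" and "distinct v" and "distinct w" and "set v = set w"
  shows "signed v (c v) = signed w (c w)"
proof -
  have "sort v = sort w"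
    using assms by (metis sorted_list_of_set_sort_remdups distinct_remdups_id)
  then show ?thesis
    using alternating_eq_signed_sort[OF assms(1)] assms(2,3) signed_involution by metis
qed

section \<open>Koszul homology along an exact complex\<close>

text \<open>The Koszul differential as contraction in the first slot, where no signs occur. It
  shortens words by one letter and raises degrees by one, so it preserves the total degree.\<close>

definition koszul_bd :: "nat \<Rightarrow> (nat \<Rightarrow> 'v \<Rightarrow> 'v) \<Rightarrow> (nat list \<Rightarrow> 'v) \<Rightarrow> nat list \<Rightarrow> 'v::ab_group_add"
  where "koszul_bd n X c w = (\<Sum>i\<le>n. X i (c (i # w)))"

text \<open>
  An element of \<open>cochains n p M d\<close> is an element of total degree \<open>d\<close> of the \<open>p\<close>-th exterior power
  tensored with the graded module \<open>M\<close>, given by its coefficients at \<open>e\<^sub>w = e\<^bsub>w!0\<^esub> \<and> e\<^bsub>w!1\<^esub> \<and> \<dots>\<close>.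
\<close>

definition cochains :: "nat \<Rightarrow> nat \<Rightarrow> (int \<Rightarrow> 'v::ab_group_add set) \<Rightarrow> int \<Rightarrow> (nat list \<Rightarrow> 'v) set" where
  "cochains n p M d = {c. alternating c \<and> (\<forall>w. length w \<noteq> p \<or> \<not> set w \<subseteq> {..n} \<longrightarrow> c w = 0) \<and>
     (\<forall>w. c w \<in> M (d - int p))}"

lemma cochainsI:
  assumes "alternating c" and "\<And>w. length w \<noteq> p \<or> \<not> set w \<subseteq> {..n} \<Longrightarrow> c w = 0"
    and "\<And>w. c w \<in> M (d - int p)"
  shows "c \<in> cochains n p M d"
  using assms unfolding cochains_def by blast

lemma cochainsD:
  assumes "c \<in> cochains n p M d"
  shows cochains_alternating: "alternating c"
    and cochains_outside: "\<And>w. length w \<noteq> p \<or> \<not> set w \<subseteq> {..n} \<Longrightarrow> c w = 0"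
    and cochains_mem: "\<And>w. c w \<in> M (d - int p)"
  using assms unfolding cochains_def by blast+

lemma cochains_mono:
  assumes "c \<in> cochains n p M d" and "\<And>w. c w \<in> N (d - int p)"
  shows "c \<in> cochains n p N d"
  using assms unfolding cochains_def by blast

text \<open>An abstract graded resolution: \<open>D i\<close> maps \<open>F (Suc i)\<close> to
  \<open>F i\<close>, with exactness at \<open>F 1\<close>, ..., \<open>F (n - 1)\<close> and
  injectivity at \<open>F n\<close>. The resolved module is the quotient of \<open>F 0\<close> by
  the image of \<open>D 0\<close>. All modules sit in one type, so that cochains over a module and
  over its submodules can be compared directly. The Koszul complexes are acyclic in positive
  positions only; at position 0 their homology counts generators.\<close>

locale graded_complex =
  fixes n :: nat
    and X :: "nat \<Rightarrow> 'v::ab_group_add \<Rightarrow> 'v"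
    and F :: "nat \<Rightarrow> int \<Rightarrow> 'v set"
    and D :: "nat \<Rightarrow> 'v \<Rightarrow> 'v"
  assumes n_ge_2: "2 \<le> n"
    and torsion_free: "\<And>x::'v. x = - x \<Longrightarrow> x = 0"
    and F_zero: "0 \<in> F i d"
    and F_diff: "x \<in> F i d \<Longrightarrow> y \<in> F i d \<Longrightarrow> x - y \<in> F i d"
    and X_additive: "additive (X j)"
    and X_commute: "X j (X k x) = X k (X j x)"
    and X_F: "j \<le> n \<Longrightarrow> x \<in> F i d \<Longrightarrow> X j x \<in> F i (d + 1)"
    and D_additive: "additive (D i)"
    and D_X: "D i (X j x) = X j (D i x)"
    and D_F: "i < n \<Longrightarrow> x \<in> F (Suc i) d \<Longrightarrow> D i x \<in> F i d"
    and D_D: "Suc i < n \<Longrightarrow> x \<in> F (Suc (Suc i)) d \<Longrightarrow> D i (D (Suc i) x) = 0"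
    and D_exact: "Suc i < n \<Longrightarrow> x \<in> F (Suc i) d \<Longrightarrow> D i x = 0 \<Longrightarrow>
      \<exists>y\<in>F (Suc (Suc i)) d. D (Suc i) y = x"
    and D_inj: "x \<in> F n d \<Longrightarrow> D (n - 1) x = 0 \<Longrightarrow> x = 0"
    and koszul_acyclic: "i \<le> n \<Longrightarrow> c \<in> cochains n (Suc p) (F i) d \<Longrightarrow> koszul_bd n X c = 0 \<Longrightarrow>
      \<exists>e\<in>cochains n (Suc (Suc p)) (F i) d. koszul_bd n X e = c"
begin

abbreviation "bd \<equiv> koszul_bd n X"
abbreviation "K \<equiv> cochains n"

text \<open>The syzygies in \<open>F i\<close>: the image of \<open>D i\<close>, which for 0 < i < n
  is also the kernel of \<open>D (i - 1)\<close>. \<open>Z 0\<close> plays the role of I.\<close>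

definition Z :: "nat \<Rightarrow> int \<Rightarrow> 'v set" where
  "Z i d = D i ` F (Suc i) d"

lemmas X_simps = additive.zero[OF X_additive] additive.add[OF X_additive]
  additive.diff[OF X_additive] additive.minus[OF X_additive] additive.sum[OF X_additive]
lemmas D_simps = additive.zero[OF D_additive] additive.add[OF D_additive]
  additive.diff[OF D_additive] additive.minus[OF D_additive] additive.sum[OF D_additive]

definition graded_submodule :: "(int \<Rightarrow> 'v set) \<Rightarrow> bool" where
  "graded_submodule M \<longleftrightarrow> (\<forall>d. 0 \<in> M d) \<and> (\<forall>d. \<forall>x\<in>M d. \<forall>y\<in>M d. x - y \<in> M d) \<and>
     (\<forall>j\<le>n. \<forall>d. \<forall>x\<in>M d. X j x \<in> M (d + 1))"

lemma graded_submoduleD: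
  assumes "graded_submodule M"
  shows sub_zero: "0 \<in> M d"
    and sub_diff: "x \<in> M d \<Longrightarrow> y \<in> M d \<Longrightarrow> x - y \<in> M d"
    and sub_X: "j \<le> n \<Longrightarrow> x \<in> M d \<Longrightarrow> X j x \<in> M (d + 1)"
    and sub_minus: "x \<in> M d \<Longrightarrow> - x \<in> M d"
    and sub_add: "x \<in> M d \<Longrightarrow> y \<in> M d \<Longrightarrow> x + y \<in> M d"
proof -
  show z: "0 \<in> M d" for d
    using assms unfolding graded_submodule_def by blast
  show s: "x \<in> M d \<Longrightarrow> y \<in> M d \<Longrightarrow> x - y \<in> M d" for x y d
    using assms unfolding graded_submodule_def by blast
  show "j \<le> n \<Longrightarrow> x \<in> M d \<Longrightarrow> X j x \<in> M (d + 1)"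
    using assms unfolding graded_submodule_def by blast
  show m: "x \<in> M d \<Longrightarrow> - x \<in> M d" for x
    using s[OF z, of x d] by simp
  show "x \<in> M d \<Longrightarrow> y \<in> M d \<Longrightarrow> x + y \<in> M d"
    using s[of x d "- y"] m[of y] by simp
qed

lemma sub_sum:
  assumes "graded_submodule M" and "\<And>i. i \<in> A \<Longrightarrow> f i \<in> M d"
  shows "sum f A \<in> M d"
  using assms(2) by (induction A rule: infinite_finite_induct)
    (auto intro: sub_zero[OF assms(1)] sub_add[OF assms(1)])

lemma sub_signed: "graded_submodule M \<Longrightarrow> x \<in> M d \<Longrightarrow> signed w x \<in> M d"
  by (auto simp: signed_def sub_zero sub_minus)

lemma graded_submodule_F: "graded_submodule (F i)"
  unfolding graded_submodule_def using F_zero F_diff X_F by blast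

lemma graded_submodule_Z: "graded_submodule (Z i)"
  unfolding graded_submodule_def
proof (intro conjI allI ballI impI)
  fix d show "0 \<in> Z i d"
    unfolding Z_def using F_zero D_simps(1) by (metis imageI)
next
  fix d x y assume "x \<in> Z i d" "y \<in> Z i d"
  then obtain u v where "x = D i u" "y = D i v" "u \<in> F (Suc i) d" "v \<in> F (Suc i) d"
    unfolding Z_def by blast
  then show "x - y \<in> Z i d"
    unfolding Z_def by (auto intro!: image_eqI[of _ _ "u - v"] F_diff simp: D_simps)
next
  fix j d x assume "j \<le> n" "x \<in> Z i d"
  then obtain u where "x = D i u" "u \<in> F (Suc i) d"
    unfolding Z_def by blast
  then show "X j x \<in> Z i (d + 1)"
    unfolding Z_def using X_F[OF \<open>j \<le> n\<close>] D_X by (intro image_eqI[of _ _ "X j u"]) simp_all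
qed

lemma Z_subset_F: "i < n \<Longrightarrow> x \<in> Z i d \<Longrightarrow> x \<in> F i d"
  unfolding Z_def using D_F by blast

lemma Z_eq_kernel: "Suc i < n \<Longrightarrow> x \<in> F (Suc i) d \<Longrightarrow> D i x = 0 \<Longrightarrow> x \<in> Z (Suc i) d"
  unfolding Z_def using D_exact by blast

lemma D_Z: "Suc i < n \<Longrightarrow> x \<in> Z (Suc i) d \<Longrightarrow> D i x = 0"
  unfolding Z_def using D_D by blast

section \<open>The Koszul boundary and lifting of cochains\<close>

lemma bd_apply: "bd c w = (\<Sum>i\<le>n. X i (c (i # w)))"
  by (simp add: koszul_bd_def)

lemma bd_diff: "bd (\<lambda>w. c w - b w) w = bd c w - bd b w"
  by (simp add: bd_apply X_simps sum_subtractf)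

lemma D_bd: "D i (bd c w) = bd (\<lambda>w. D i (c w)) w"
  by (simp add: bd_apply D_simps D_X)

text \<open>Exchanging the two summations and then the first two letters turns the double sum into
  its negative.\<close>

lemma bd_bd:
  assumes "alternating c" shows "bd (bd c) w = 0"
proof (rule torsion_free)
  have "bd (bd c) w = (\<Sum>i\<le>n. \<Sum>j\<le>n. X i (X j (c (j # i # w))))"
    by (simp add: bd_apply X_simps)
  also have "\<dots> = (\<Sum>j\<le>n. \<Sum>i\<le>n. X i (X j (c (j # i # w))))"
    by (rule sum.swap)
  also have "\<dots> = (\<Sum>j\<le>n. \<Sum>i\<le>n. - X j (X i (c (i # j # w))))"
  proof (intro sum.cong refl)
    fix i j
    have "X i (X j (c (j # i # w))) = X i (X j (- c (i # j # w)))"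
      using alternating_swap_head[OF assms, of j i w] by (rule arg_cong)
    then show "X i (X j (c (j # i # w))) = - X j (X i (c (i # j # w)))"
      by (simp add: X_simps X_commute[of i j])
  qed
  also have "\<dots> = - bd (bd c) w"
    by (simp add: bd_apply X_simps sum_negf)
  finally show "bd (bd c) w = - bd (bd c) w" .
qed

lemma alternating_bd:
  assumes "alternating c" shows "alternating (bd c)"
proof -
  have *: "alternating (\<lambda>w. X i (c (i # w)))" for i
    by (rule alternating_comp[OF alternating_Cons[OF assms] X_additive])
  have "bd c (u @ k # j # v) = - bd c (u @ j # k # v)" for u k j v
    unfolding bd_apply sum_negf[symmetric]
    by (intro sum.cong refl alternating_swap[OF *])
  moreover have "bd c w = 0" if "\<not> distinct w" for w
    unfolding bd_apply by (intro sum.neutral ballI alternating_nondistinct[OF * that])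
  ultimately show ?thesis unfolding alternating_def by blast
qed

lemma bd_cochains:
  assumes "graded_submodule M" and "c \<in> K (Suc p) M d"
  shows "bd c \<in> K p M d"
proof (rule cochainsI)
  show "alternating (bd c)"
    by (rule alternating_bd[OF cochains_alternating[OF assms(2)]])
  show "bd c w = 0" if "length w \<noteq> p \<or> \<not> set w \<subseteq> {..n}" for w
    unfolding bd_apply using cochains_outside[OF assms(2)] that
    by (intro sum.neutral) (auto simp: X_simps)
  show "bd c w \<in> M (d - int p)" for w
    unfolding bd_apply
    using sub_X[OF assms(1) _ cochains_mem[OF assms(2)]]
    by (intro sub_sum[OF assms(1)]) (auto simp: algebra_simps)
qed

lemma cochains_diff:
  assumes "graded_submodule M" and "c \<in> K p M d" and "b \<in> K p M d"
  shows "(\<lambda>w. c w - b w) \<in> K p M d"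
  by (rule cochainsI) (auto intro!: alternating_diff cochains_alternating[OF assms(2)]
      cochains_alternating[OF assms(3)] sub_diff[OF assms(1)] cochains_mem[OF assms(2)]
      cochains_mem[OF assms(3)] simp: cochains_outside[OF assms(2)] cochains_outside[OF assms(3)])

lemma cochains_zero: "graded_submodule M \<Longrightarrow> (\<lambda>w. 0) \<in> K p M d"
  by (rule cochainsI) (auto simp: alternating_def sub_zero)

lemma D_cochains:
  assumes "c \<in> K p (F (Suc i)) d"
  shows "(\<lambda>w. D i (c w)) \<in> K p (Z i) d"
  by (rule cochainsI) (auto intro: alternating_comp[OF cochains_alternating[OF assms] D_additive]
      simp: cochains_outside[OF assms] D_simps Z_def cochains_mem[OF assms])

text \<open>Preimages chosen word by word need not alternate. Only those at sorted words are kept,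
  and they are spread to the other words with signs.\<close>

lemma cochains_lift:
  assumes "c \<in> K p (Z i) d"
  shows "\<exists>b\<in>K p (F (Suc i)) d. \<forall>w. D i (b w) = c w"
proof -
  have "\<forall>w. \<exists>v\<in>F (Suc i) (d - int p). D i v = c w"
    using cochains_mem[OF assms] unfolding Z_def by (metis imageE)
  then obtain g0 where g0: "\<And>w. g0 w \<in> F (Suc i) (d - int p)" "\<And>w. D i (g0 w) = c w" by metis
  define g where "g w = (if length w \<noteq> p \<or> \<not> set w \<subseteq> {..n} then 0 else g0 w)" for w
  have g: "D i (g w) = c w" "g w \<in> F (Suc i) (d - int p)" for w
    unfolding g_def using cochains_outside[OF assms, of w] g0 by (auto simp: D_simps F_zero)
  define b where "b w = signed w (g (sort w))" for w
  have "b \<in> K p (F (Suc i)) d"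
  proof (rule cochainsI)
    show "alternating b" unfolding b_def by (rule alternating_signed_sort)
    show "b w = 0" if "length w \<noteq> p \<or> \<not> set w \<subseteq> {..n}" for w
      unfolding b_def g_def using that by simp
    show "b w \<in> F (Suc i) (d - int p)" for w
      unfolding b_def by (intro sub_signed[OF graded_submodule_F] g)
  qed
  moreover have "D i (b w) = c w" for w
    unfolding b_def
    using signed_additive[OF D_additive, where w = w and x = "g (sort w)"] g
      alternating_eq_signed_sort[OF cochains_alternating[OF assms], of w] by simp
  ultimately show ?thesis by blast
qed

text \<open>
  The Koszul complex of each \<open>F i\<close> is acyclic, so the sequences \<open>0 \<rightarrow> Z (Suc i) \<rightarrow> F (Suc i) \<rightarrow> Z i \<rightarrow> 0\<close>
  shift Koszul homology: what is asserted here does not depend on \<open>i\<close>, given minimality of the complex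
  for the step to \<open>i = n - 1\<close>. There it concerns the generators of \<open>F n\<close>, and at \<open>i = 0\<close> the \<open>n\<close>-th
  Koszul homology of \<open>F 0\<close> modulo \<open>Z 0\<close>.
\<close>

definition Z_acyclic :: "int \<Rightarrow> nat \<Rightarrow> bool" where
  "Z_acyclic d i \<longleftrightarrow> (\<forall>c\<in>K (n - Suc i) (Z i) d. bd c = 0 \<longrightarrow>
     (\<exists>b\<in>K (Suc (n - Suc i)) (Z i) d. bd b = c))"

definition top_acyclic :: "int \<Rightarrow> bool" where
  "top_acyclic d \<longleftrightarrow> (\<forall>c\<in>K n (F 0) d. bd c \<in> K (n - 1) (Z 0) d \<longrightarrow>
     (\<exists>e\<in>K (Suc n) (F 0) d. (\<lambda>w. c w - bd e w) \<in> K n (Z 0) d))"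

text \<open>In position 0 a cochain is a single element of \<open>Z (n - 1) d\<close>, and this is
  zero together with \<open>F n d\<close>.\<close>

lemma Z_acyclic_top:
  assumes "F n d = {0}" shows "Z_acyclic d (n - 1)"
  unfolding Z_acyclic_def
proof (intro ballI impI)
  fix c assume c: "c \<in> K (n - Suc (n - 1)) (Z (n - 1)) d"
  have "Z (n - 1) d = {0}" using assms n_ge_2 by (simp add: Z_def D_simps)
  moreover have "c w \<in> Z (n - 1) d" for w using cochains_mem[OF c, of w] n_ge_2 by simp
  ultimately have "c = (\<lambda>w. 0)" by auto
  moreover have "bd (\<lambda>w. 0) = (\<lambda>w. 0)" by (auto simp: bd_apply X_simps)
  ultimately show "\<exists>b\<in>K (Suc (n - Suc (n - 1))) (Z (n - 1)) d. bd b = c"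
    using cochains_zero[OF graded_submodule_Z] by auto
qed

text \<open>The connecting map from the homology of \<open>Z i\<close> to that of
  \<open>Z (Suc i)\<close>, one position lower, is injective because \<open>F (Suc i)\<close> has no
  homology in the position of \<open>c\<close>. The chase lifts \<open>c\<close> to \<open>b\<close>
  and corrects it by \<open>e\<close> to a cycle.\<close>

lemma Z_acyclic_step_down:
  assumes i: "Suc i < n" and acyc: "Z_acyclic d (Suc i)"
  shows "Z_acyclic d i"
  unfolding Z_acyclic_def
proof (intro ballI impI)
  define p where "p = n - Suc (Suc i)"
  have np: "n - Suc i = Suc p" using i by (simp add: p_def)
  fix c assume "c \<in> K (n - Suc i) (Z i) d" and bdc: "bd c = 0"
  then have c: "c \<in> K (Suc p) (Z i) d" by (simp add: np)
  obtain b where b: "b \<in> K (Suc p) (F (Suc i)) d" and Db: "\<And>w. D i (b w) = c w"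
    using cochains_lift[OF c] by blast
  have bdb: "bd b \<in> K p (F (Suc i)) d"
    by (rule bd_cochains[OF graded_submodule_F b])
  have "D i (bd b w) = 0" for w
    using fun_cong[OF bdc, of w] by (simp add: D_bd Db)
  then have "bd b \<in> K p (Z (Suc i)) d"
    using cochains_mono[OF bdb] Z_eq_kernel[OF i cochains_mem[OF bdb]] by blast
  moreover have "bd (bd b) = 0"
    using bd_bd[OF cochains_alternating[OF b]] by auto
  ultimately obtain e where e: "e \<in> K (Suc p) (Z (Suc i)) d" and bde: "bd e = bd b"
    using acyc unfolding Z_acyclic_def p_def by blast
  have eF: "e \<in> K (Suc p) (F (Suc i)) d"
    using cochains_mono[OF e] Z_subset_F[OF i cochains_mem[OF e]] by blast
  have "(\<lambda>w. b w - e w) \<in> K (Suc p) (F (Suc i)) d"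
    by (rule cochains_diff[OF graded_submodule_F b eF])
  moreover have "bd (\<lambda>w. b w - e w) = 0"
    by (rule ext) (simp add: bd_diff bde)
  ultimately obtain f where f: "f \<in> K (Suc (Suc p)) (F (Suc i)) d"
    and bdf: "bd f = (\<lambda>w. b w - e w)"
    using koszul_acyclic[of "Suc i"] i by (metis less_imp_le)
  have "bd (\<lambda>w. D i (f w)) w = c w" for w
    using D_Z[OF i cochains_mem[OF e], of w] fun_cong[OF bdf, of w]
    by (simp flip: D_bd add: D_simps Db)
  then show "\<exists>b\<in>K (Suc (n - Suc i)) (Z i) d. bd b = c"
    unfolding np using D_cochains[OF f] by blast
qed

text \<open>Shifting from \<open>Z (n - 1)\<close>, where everything is zero, down to
  \<open>Z 0\<close>. In the last shift the quotient of \<open>F 0\<close> by \<open>Z 0\<close> is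
  never formed; cycles and boundaries are taken modulo \<open>Z 0\<close> instead.\<close>

lemma top_acyclicI:
  assumes "F n d = {0}" shows "top_acyclic d"
proof -
  have "i < n \<Longrightarrow> Z_acyclic d (n - 1 - i)" for i
  proof (induction i)
    case 0
    then show ?case using Z_acyclic_top[OF assms] by simp
  next
    case (Suc i)
    then have "Suc (n - 1 - Suc i) = n - 1 - i" by simp
    then show ?case using Z_acyclic_step_down[of "n - 1 - Suc i" d] Suc by simp
  qed
  from this[of "n - 1"] have acyc: "Z_acyclic d 0" using n_ge_2 by simp
  have n1: "Suc (n - 1) = n" using n_ge_2 by simp
  show ?thesis
    unfolding top_acyclic_def
  proof (intro ballI impI)
    fix c assume c: "c \<in> K n (F 0) d" and bdc: "bd c \<in> K (n - 1) (Z 0) d"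
    have "bd (bd c) = 0" using bd_bd[OF cochains_alternating[OF c]] by auto
    then obtain b where b: "b \<in> K n (Z 0) d" and bdb: "bd b = bd c"
      using acyc bdc unfolding Z_acyclic_def by (auto simp: n1[unfolded One_nat_def])
    have bF: "b \<in> K n (F 0) d"
      using cochains_mono[OF b] Z_subset_F[OF _ cochains_mem[OF b]] n_ge_2 by auto
    have "(\<lambda>w. c w - b w) \<in> K (Suc (n - 1)) (F 0) d"
      using cochains_diff[OF graded_submodule_F c bF] by (simp only: n1)
    moreover have "bd (\<lambda>w. c w - b w) = 0"
      by (rule ext) (simp add: bd_diff bdb)
    ultimately obtain e where e: "e \<in> K (Suc n) (F 0) d" and bde: "bd e = (\<lambda>w. c w - b w)"
      using koszul_acyclic[of 0] by (metis le0 n1)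
    have "(\<lambda>w. c w - bd e w) = b" using bde by auto
    then show "\<exists>e\<in>K (Suc n) (F 0) d. (\<lambda>w. c w - bd e w) \<in> K n (Z 0) d"
      using e b by auto
  qed
qed

text \<open>Exactness at the homology of \<open>Z (Suc i)\<close>: a cycle that bounds in
  \<open>F (Suc i)\<close> comes from the homology of \<open>Z i\<close>, which is zero. The
  primitive \<open>b\<close> is a hypothesis because for \<open>Suc i = n - 1\<close> the cycle has
  position 0, where acyclicity does not provide one.\<close>

lemma Z_acyclic_step_up:
  assumes i: "Suc i < n" and acyc: "Z_acyclic d i"
    and c: "c \<in> K (n - Suc (Suc i)) (Z (Suc i)) d"
    and b: "b \<in> K (n - Suc i) (F (Suc i)) d" and bdb: "bd b = c"
  shows "\<exists>b\<in>K (n - Suc i) (Z (Suc i)) d. bd b = c"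
proof -
  have Db: "(\<lambda>w. D i (b w)) \<in> K (n - Suc i) (Z i) d" by (rule D_cochains[OF b])
  have "bd (\<lambda>w. D i (b w)) = 0"
    using D_Z[OF i cochains_mem[OF c]] by (auto simp: bdb simp flip: D_bd)
  then obtain g where g: "g \<in> K (Suc (n - Suc i)) (Z i) d" and bdg: "bd g = (\<lambda>w. D i (b w))"
    using acyc Db unfolding Z_acyclic_def by blast
  obtain e where e: "e \<in> K (Suc (n - Suc i)) (F (Suc i)) d" and De: "\<And>w. D i (e w) = g w"
    using cochains_lift[OF g] by blast
  have diff: "(\<lambda>w. b w - bd e w) \<in> K (n - Suc i) (F (Suc i)) d"
    by (rule cochains_diff[OF graded_submodule_F b bd_cochains[OF graded_submodule_F e]])
  have "D i (b w - bd e w) = 0" for w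
    using fun_cong[OF bdg, of w] by (simp add: D_simps D_bd De)
  then have "(\<lambda>w. b w - bd e w) \<in> K (n - Suc i) (Z (Suc i)) d"
    using cochains_mono[OF diff] Z_eq_kernel[OF i cochains_mem[OF diff]] by blast
  moreover have "bd (\<lambda>w. b w - bd e w) = c"
    using bd_bd[OF cochains_alternating[OF e]] by (auto simp: bd_diff bdb)
  ultimately show ?thesis by blast
qed

text \<open>The shifts in the opposite direction, from \<open>Z 0\<close> up to
  \<open>Z (n - 2)\<close>. All positions are still positive there, so acyclicity supplies the
  primitives.\<close>

lemma Z_acyclic_of_top_acyclic:
  assumes "top_acyclic d" shows "Suc i < n \<Longrightarrow> Z_acyclic d i"
proof (induction i)
  case 0
  have n1: "Suc (n - 2) = n - 1" "Suc (n - 1) = n" using n_ge_2 by auto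
  show ?case
    unfolding Z_acyclic_def
  proof (intro ballI impI)
    fix c assume "c \<in> K (n - Suc 0) (Z 0) d" and bdc: "bd c = 0"
    then have c: "c \<in> K (n - 1) (Z 0) d" by simp
    have "c \<in> K (Suc (n - 2)) (F 0) d"
      using cochains_mono[OF c] Z_subset_F[OF _ cochains_mem[OF c]] n_ge_2 by (simp add: n1)
    then obtain b where b: "b \<in> K n (F 0) d" and bdb: "bd b = c"
      using koszul_acyclic[of 0] bdc n1 by (metis le0)
    then obtain e where e: "e \<in> K (Suc n) (F 0) d" and be: "(\<lambda>w. b w - bd e w) \<in> K n (Z 0) d"
      using assms c unfolding top_acyclic_def by blast
    have "bd (\<lambda>w. b w - bd e w) = c"
      using bd_bd[OF cochains_alternating[OF e]] by (auto simp: bd_diff bdb)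
    then show "\<exists>b\<in>K (Suc (n - Suc 0)) (Z 0) d. bd b = c"
      using be n1 by auto
  qed
next
  case (Suc i)
  define p where "p = n - Suc (Suc (Suc i))"
  have np: "n - Suc (Suc i) = Suc p" "n - Suc i = Suc (Suc p)" using Suc.prems by (auto simp: p_def)
  show ?case
    unfolding Z_acyclic_def
  proof (intro ballI impI)
    fix c assume c: "c \<in> K (n - Suc (Suc i)) (Z (Suc i)) d" and bdc: "bd c = 0"
    have "c \<in> K (Suc p) (F (Suc i)) d"
      using cochains_mono[OF c] Z_subset_F[OF _ cochains_mem[OF c]] Suc.prems by (simp add: np)
    then obtain b where b: "b \<in> K (Suc (Suc p)) (F (Suc i)) d" and bdb: "bd b = c"
      using koszul_acyclic[of "Suc i"] bdc Suc.prems by (metis Suc_lessD less_imp_le)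
    show "\<exists>b\<in>K (Suc (n - Suc (Suc i))) (Z (Suc i)) d. bd b = c"
      using Z_acyclic_step_up[of i d c b] Suc b bdb c by (simp add: np)
  qed
qed

text \<open>The last shift, to position 0. Minimality makes \<open>D (n - 1) x\<close> the boundary
  of a 1-cochain over \<open>F (n - 1)\<close>; the shift moves this cochain into
  \<open>Z (n - 1)\<close>, and injectivity of \<open>D (n - 1)\<close> pulls the equation back to
  \<open>F n\<close>. Over the polynomial ring the conclusion excludes basis vectors of degree
  \<open>d\<close>.\<close>

lemma top_acyclic_imp_generated:
  assumes "top_acyclic d"
    and minimal: "\<And>x. x \<in> F n d \<Longrightarrow>
      \<exists>b. (\<forall>j\<le>n. b j \<in> F (n - 1) (d - 1)) \<and> D (n - 1) x = (\<Sum>j\<le>n. X j (b j))"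
    and x: "x \<in> F n d"
  shows "\<exists>b. (\<forall>j\<le>n. b j \<in> F n (d - 1)) \<and> x = (\<Sum>j\<le>n. X j (b j))"
proof -
  define i where "i = n - 2"
  have i: "Suc i < n" "Suc i = n - 1" "n - Suc i = Suc 0" "n - Suc (Suc i) = 0" "Suc (Suc i) = n"
    using n_ge_2 by (auto simp: i_def)
  have n1: "Suc (n - Suc 0) = n" and n_minus: "n - (n - 1) = Suc 0" using n_ge_2 by auto
  obtain b where b: "\<And>j. j \<le> n \<Longrightarrow> b j \<in> F (n - 1) (d - 1)"
    and Dx: "D (n - 1) x = (\<Sum>j\<le>n. X j (b j))"
    using minimal[OF x] by blast
  define c where "c w = (if w = [] then D (n - 1) x else 0)" for w :: "nat list"
  define b' where "b' w = (if length w = 1 \<and> hd w \<le> n then b (hd w) else 0)" for w :: "nat list"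
  have "c \<in> K (n - Suc (Suc i)) (Z (Suc i)) d"
  proof (rule cochainsI)
    show "alternating c" by (auto simp: alternating_def c_def)
    show "c w \<in> Z (Suc i) (d - int (n - Suc (Suc i)))" for w
      using x sub_zero[OF graded_submodule_Z, of "n - 1" d] by (auto simp: c_def i n1 Z_def)
  qed (auto simp: c_def i)
  moreover have "b' \<in> K (n - Suc i) (F (Suc i)) d"
  proof (rule cochainsI)
    show "alternating b'" by (auto simp: alternating_def b'_def length_Suc_conv)
    show "b' w \<in> F (Suc i) (d - int (n - Suc i))" for w
      unfolding i(3) using b by (auto simp: b'_def i(2) F_zero)
    show "b' w = 0" if "length w \<noteq> n - Suc i \<or> \<not> set w \<subseteq> {..n}" for w
      using that unfolding i(3) by (auto simp: b'_def length_Suc_conv)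
  qed
  moreover have "bd b' = c"
  proof
    fix w
    show "bd b' w = c w"
    proof (cases "w = []")
      case True
      then show ?thesis using Dx by (simp add: bd_apply b'_def c_def)
    next
      case False
      then show ?thesis by (simp add: bd_apply b'_def c_def X_simps)
    qed
  qed
  ultimately obtain z where z: "z \<in> K (n - Suc i) (Z (Suc i)) d" and bdz: "bd z = c"
    using Z_acyclic_step_up[OF i(1) Z_acyclic_of_top_acyclic[OF assms(1) i(1)]] by blast
  have "\<forall>j. \<exists>y\<in>F n (d - 1). D (n - 1) y = z [j]"
  proof
    fix j
    have "z [j] \<in> Z (n - 1) (d - int (Suc 0))"
      using cochains_mem[OF z, of "[j]"] n_minus unfolding i(2) by simp
    then show "\<exists>y\<in>F n (d - 1). D (n - 1) y = z [j]"
      unfolding Z_def by (auto simp: n1)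
  qed
  then obtain y where y: "\<And>j. y j \<in> F n (d - 1)" "\<And>j. D (n - 1) (y j) = z [j]" by metis
  have "D (n - 1) (x - (\<Sum>j\<le>n. X j (y j))) = 0"
    using fun_cong[OF bdz, of "[]"] by (simp add: D_simps D_X y(2)[unfolded One_nat_def] c_def bd_apply)
  moreover have "X j (y j) \<in> F n d" if "j \<le> n" for j
    using X_F[OF that y(1), of j] by simp
  then have "x - (\<Sum>j\<le>n. X j (y j)) \<in> F n d"
    by (intro F_diff x sub_sum[OF graded_submodule_F]) auto
  ultimately have "x = (\<Sum>j\<le>n. X j (y j))" using D_inj by fastforce
  then show ?thesis using y(1) by (intro exI[of _ y]) simp
qed

text \<open>
  Contracting with the volume form identifies \<open>n\<close>-cochains in \<open>n + 1\<close> variables with tuples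
  \<open>f\<^sub>0, \<dots>, f\<^sub>n\<close>. Under this identification, a cocycle modulo \<open>Z 0\<close> satisfies
  \<open>x\<^sub>i f\<^sub>j = x\<^sub>j f\<^sub>i\<close> and a coboundary is of the form \<open>f\<^sub>i = x\<^sub>i g\<close>.
\<close>

definition volume :: "'v \<Rightarrow> nat list \<Rightarrow> 'v" where
  "volume x w = (if length w = Suc n \<and> set w \<subseteq> {..n} then signed w x else 0)"

lemma alternating_volume: "alternating (volume x)"
  unfolding alternating_def
proof (intro conjI allI impI)
  fix u v :: "nat list" and i j :: nat
  have "insert i (insert j (set u \<union> set v)) = insert j (insert i (set u \<union> set v))" by auto
  then show "volume x (u @ i # j # v) = - volume x (u @ j # i # v)"
    using signed_swap[of u i j v x] by (simp add: volume_def)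
qed (auto simp: volume_def signed_def)

lemma card_missing:
  assumes "distinct w" and "set w \<subseteq> {..n}"
  shows "card ({..n} - set w) = Suc n - length w"
  using assms card_Diff_subset[of "set w" "{..n}"] by (simp add: distinct_card)

lemma missing_one:
  assumes "distinct w" and "set w \<subseteq> {..n}" and "length w = n"
  obtains i where "i \<le> n" "{..n} - set w = {i}"
  using card_missing[OF assms(1,2)] assms(3) by (auto simp: card_1_singleton_iff)

lemma missing_two:
  assumes "distinct w" and "set w \<subseteq> {..n}" and "length w = n - 1"
  obtains i j where "i \<le> n" "j \<le> n" "i \<noteq> j" "{..n} - set w = {i, j}"
proof -
  have "card ({..n} - set w) = 2"
    using card_missing[OF assms(1,2)] assms(3) n_ge_2 by auto
  then obtain i j where *: "{..n} - set w = {i, j}" "i \<noteq> j" by (auto simp: card_2_iff)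
  then have "i \<in> {..n}" "j \<in> {..n}" by blast+
  then show ?thesis using that * by auto
qed

lemma bd_missing:
  assumes "alternating c" shows "bd c w = (\<Sum>i\<in>{..n} - set w. X i (c (i # w)))"
  unfolding bd_apply
  by (rule sum.mono_neutral_right) (auto simp: X_simps alternating_nondistinct[OF assms])

lemma signed_swap_head: "signed (i # j # w) x = - signed (j # i # w) x"
  using signed_swap[of "[]" i j w x] by simp

definition trivial_tuples :: "int \<Rightarrow> bool" where
  "trivial_tuples t \<longleftrightarrow> (\<forall>f. (\<forall>i\<le>n. f i \<in> F 0 t) \<and>
       (\<forall>i\<le>n. \<forall>j\<le>n. X i (f j) - X j (f i) \<in> Z 0 (t + 1)) \<longrightarrow>
     (\<exists>g\<in>F 0 (t - 1). \<forall>i\<le>n. f i - X i g \<in> Z 0 t))"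

text \<open>At a word that omits only i, the cochain \<open>c\<close> is \<open>f i\<close> up to
  sign; at a word that omits i and j, its boundary is \<open>X i (f j) - X j (f i)\<close> up to
  sign. An n-cochain of total degree t + n has values of degree t, whence the shift by n.\<close>

lemma trivial_tuples_of_top_acyclic:
  assumes "top_acyclic (t + int n)"
  shows "trivial_tuples t"
  unfolding trivial_tuples_def
proof (intro allI impI)
  fix f assume f': "(\<forall>i\<le>n. f i \<in> F 0 t) \<and>
     (\<forall>i\<le>n. \<forall>j\<le>n. X i (f j) - X j (f i) \<in> Z 0 (t + 1))"
  then have f: "\<And>i. i \<le> n \<Longrightarrow> f i \<in> F 0 t"
    and ff: "\<And>i j. i \<le> n \<Longrightarrow> j \<le> n \<Longrightarrow> X i (f j) - X j (f i) \<in> Z 0 (t + 1)" by auto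
  define c where "c w = (\<Sum>i\<le>n. volume (f i) (i # w))" for w
  have alt: "alternating c"
  proof -
    have "c (u @ k # j # v) = - c (u @ j # k # v)" for u k j v
      unfolding c_def sum_negf[symmetric]
      by (intro sum.cong refl alternating_swap[OF alternating_Cons[OF alternating_volume]])
    moreover have "c w = 0" if "\<not> distinct w" for w
      unfolding c_def
      by (intro sum.neutral ballI alternating_nondistinct[OF alternating_volume]) (use that in simp)
    ultimately show ?thesis unfolding alternating_def by blast
  qed
  have c_eq: "c w = signed (i # w) (f i)" if "distinct w" "{..n} - set w = {i}" "length w = n" "set w \<subseteq> {..n}" for w i
  proof -
    have i: "i \<le> n" "i \<notin> set w" using that(2) by auto
    have "volume (f k) (k # w) = 0" if "k \<in> {..n} - {i}" for k
    proof (rule alternating_nondistinct[OF alternating_volume])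
      have "k \<in> set w" using that \<open>{..n} - set w = {i}\<close> by blast
      then show "\<not> distinct (k # w)" by simp
    qed
    then have "c w = (\<Sum>k\<in>{i}. volume (f k) (k # w))"
      unfolding c_def using i by (intro sum.mono_neutral_right) auto
    then show ?thesis using i that by (simp add: volume_def)
  qed
  have c: "c \<in> K n (F 0) (t + int n)"
  proof (rule cochainsI)
    show "c w = 0" if "length w \<noteq> n \<or> \<not> set w \<subseteq> {..n}" for w
      unfolding c_def using that by (intro sum.neutral) (auto simp: volume_def)
    show "c w \<in> F 0 (t + int n - int n)" for w
      unfolding c_def volume_def
      by (intro sub_sum[OF graded_submodule_F])
        (auto intro!: sub_signed[OF graded_submodule_F] sub_zero[OF graded_submodule_F] f)
  qed (rule alt)
  have n1: "Suc (n - 1) = n" using n_ge_2 by simp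
  have bdc: "bd c \<in> K (n - 1) (F 0) (t + int n)"
    using bd_cochains[OF graded_submodule_F, of c "n - 1"] c n1 by simp
  have "bd c w \<in> Z 0 (t + 1)" for w
  proof (cases "distinct w \<and> set w \<subseteq> {..n} \<and> length w = n - 1")
    case True
    then obtain i j where ij: "i \<le> n" "j \<le> n" "i \<noteq> j" "{..n} - set w = {i, j}"
      using missing_two by blast
    then have nw: "i \<notin> set w" "j \<notin> set w" by auto
    have m: "{..n} - set (i # w) = {j}" "{..n} - set (j # w) = {i}" using ij by auto
    have "c (i # w) = signed (j # i # w) (f j)"
      by (rule c_eq[OF _ m(1)]) (use True nw ij(1) n1 in simp_all)
    moreover have "c (j # w) = signed (i # j # w) (f i)"
      by (rule c_eq[OF _ m(2)]) (use True nw ij(2) n1 in simp_all)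
    ultimately have "bd c w = X i (signed (j # i # w) (f j)) + X j (signed (i # j # w) (f i))"
      using bd_missing[OF alt, of w] ij by simp
    also have "\<dots> = signed (j # i # w) (X i (f j) - X j (f i))"
      by (simp add: signed_additive[OF X_additive] signed_swap_head[of i j] signed_diff X_simps)
    also have "\<dots> \<in> Z 0 (t + 1)"
      by (intro sub_signed[OF graded_submodule_Z] ff ij)
    finally show ?thesis .
  next
    case False
    then have "bd c w = 0"
      using cochains_outside[OF bdc] alternating_nondistinct[OF cochains_alternating[OF bdc]] by blast
    then show ?thesis by (simp add: sub_zero[OF graded_submodule_Z])
  qed
  then have "bd c \<in> K (n - 1) (Z 0) (t + int n)"
    using cochains_mono[OF bdc] n_ge_2 by (simp add: of_nat_diff)
  then obtain e where e: "e \<in> K (Suc n) (F 0) (t + int n)"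
    and ce: "(\<lambda>w. c w - bd e w) \<in> K n (Z 0) (t + int n)"
    using assms c unfolding top_acyclic_def by blast
  define g where "g = signed [0..<Suc n] (e [0..<Suc n])"
  have g: "g \<in> F 0 (t - 1)"
    unfolding g_def using cochains_mem[OF e, of "[0..<Suc n]"]
    by (intro sub_signed[OF graded_submodule_F]) (simp add: algebra_simps)
  have "f i - X i g \<in> Z 0 t" if i: "i \<le> n" for i
  proof -
    define w where "w = sorted_list_of_set ({..n} - {i})"
    have w: "distinct w" "set w = {..n} - {i}" "length w = n" "set w \<subseteq> {..n}"
      using i by (auto simp: w_def)
    have m: "{..n} - set w = {i}" using w i by auto
    have di: "distinct (i # w)" using w by simp
    have si: "set (i # w) = set [0..<Suc n]"
      unfolding list.set(2) w(2) set_upt using i by auto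
    have "signed (i # w) (e (i # w)) = g"
      unfolding g_def
      by (rule alternating_signed_eq[OF cochains_alternating[OF e] di distinct_upt si])
    moreover have "bd e w = X i (e (i # w))"
      using bd_missing[OF cochains_alternating[OF e], of w] m by simp
    ultimately have "signed (i # w) (bd e w) = X i g"
      by (simp flip: signed_additive[OF X_additive])
    moreover have "signed (i # w) (c w) = f i"
      using c_eq[OF w(1) m w(3,4)] signed_involution[OF di] by metis
    ultimately have "f i - X i g = signed (i # w) (c w - bd e w)"
      by (simp add: signed_diff)
    then show ?thesis
      using sub_signed[OF graded_submodule_Z, of "c w - bd e w" 0 t "i # w"]
        cochains_mem[OF ce, of w] by simp
  qed
  then show "\<exists>g\<in>F 0 (t - 1). \<forall>i\<le>n. f i - X i g \<in> Z 0 t" using g by blast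
qed

text \<open>The change of sign depends only on the set of the remaining letters. Hence a component
  of the tuple can be read off at any enumeration of the other indices.\<close>

lemma signed_Cons:
  assumes "distinct (i # w)"
  shows "signed (i # w) x =
    (if even (card {j \<in> set w. j < i}) then signed w x else - signed w x)"
proof -
  have "length (filter (\<lambda>j. j < i) w) = card {j \<in> set w. j < i}"
    using assms by (metis distinct.simps(2) distinct_card distinct_filter set_filter)
  then show ?thesis using assms by (simp add: signed_def)
qed

lemma top_acyclic_of_trivial_tuples:
  assumes "trivial_tuples t"
  shows "top_acyclic (t + int n)"
  unfolding top_acyclic_def
proof (intro ballI impI)
  fix c assume c: "c \<in> K n (F 0) (t + int n)" and bdc: "bd c \<in> K (n - 1) (Z 0) (t + int n)"
  note alt = cochains_alternating[OF c]
  \<comment> \<open>The inverse of the contraction: the value at a word that lists all indices but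
    i, with the sign of putting i in front.\<close>
  define f where "f i = (let w = sorted_list_of_set ({..n} - {i}) in signed (i # w) (c w))" for i
  have f_eq: "signed (i # w) (c w) = f i" if w: "distinct w" "set w = {..n} - {i}" for w i
  proof -
    define v where "v = sorted_list_of_set ({..n} - {i})"
    have v: "distinct v" "set v = set w" by (auto simp: v_def w)
    have "signed v (c v) = signed w (c w)"
      by (rule alternating_signed_eq[OF alt v(1) w(1) v(2)])
    then have "signed (i # v) (c v) = signed (i # w) (c w)"
      using signed_Cons[of i v "c v"] signed_Cons[of i w "c w"] v w by simp
    then show ?thesis by (simp add: f_def Let_def v_def)
  qed
  have f: "f i \<in> F 0 t" for i
    unfolding f_def Let_def using cochains_mem[OF c]
    by (intro sub_signed[OF graded_submodule_F]) simp
  have "X i (f j) - X j (f i) \<in> Z 0 (t + 1)" if ij: "i \<le> n" "j \<le> n" for i j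
  proof (cases "i = j")
    case True
    then show ?thesis by (simp add: sub_zero[OF graded_submodule_Z])
  next
    case False
    define w where "w = sorted_list_of_set ({..n} - {i, j})"
    have w: "distinct w" "set w = {..n} - {i, j}" by (auto simp: w_def)
    have m: "{..n} - set w = {i, j}" using w ij by auto
    have "signed (j # i # w) (c (i # w)) = f j"
      by (rule f_eq) (use w ij False in auto)
    moreover have "signed (i # j # w) (c (j # w)) = f i"
      by (rule f_eq) (use w ij False in auto)
    moreover have "bd c w = X i (c (i # w)) + X j (c (j # w))"
      using bd_missing[OF alt, of w] m False by simp
    ultimately have "X i (f j) - X j (f i) =
        signed (j # i # w) (X i (c (i # w))) - signed (i # j # w) (X j (c (j # w)))"
      and bdw: "bd c w = X i (c (i # w)) + X j (c (j # w))"
      by (auto simp flip: signed_additive[OF X_additive])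
    then have "X i (f j) - X j (f i) = signed (j # i # w) (bd c w)"
      unfolding bdw signed_swap_head[of i j w] signed_add by simp
    moreover have "bd c w \<in> Z 0 (t + 1)"
      using cochains_mem[OF bdc, of w] n_ge_2 by (simp add: of_nat_diff)
    then have "signed (j # i # w) (bd c w) \<in> Z 0 (t + 1)"
      by (rule sub_signed[OF graded_submodule_Z])
    ultimately show ?thesis by simp
  qed
  then obtain g where g: "g \<in> F 0 (t - 1)" and fg: "\<And>i. i \<le> n \<Longrightarrow> f i - X i g \<in> Z 0 t"
    using assms f unfolding trivial_tuples_def by blast
  have e: "volume g \<in> K (Suc n) (F 0) (t + int n)"
  proof (rule cochainsI)
    show "alternating (volume g)" by (rule alternating_volume)
    show "volume g w \<in> F 0 (t + int n - int (Suc n))" for w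
      unfolding volume_def using g
      by (auto intro!: sub_signed[OF graded_submodule_F] sub_zero[OF graded_submodule_F])
  qed (auto simp: volume_def)
  have diff: "(\<lambda>w. c w - bd (volume g) w) \<in> K n (F 0) (t + int n)"
    by (rule cochains_diff[OF graded_submodule_F c bd_cochains[OF graded_submodule_F e]])
  have "c w - bd (volume g) w \<in> Z 0 t" for w
  proof (cases "distinct w \<and> set w \<subseteq> {..n} \<and> length w = n")
    case True
    then obtain i where i: "i \<le> n" "{..n} - set w = {i}" using missing_one by blast
    have iw: "i \<notin> set w" "set w = {..n} - {i}" using True i by auto
    have di: "distinct (i # w)" using True iw by simp
    have "bd (volume g) w = X i (signed (i # w) g)"
      using bd_missing[OF alternating_volume, of g w] i True by (simp add: volume_def)
    moreover have "signed (i # w) (c w) = f i" using f_eq True iw by blast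
    then have "c w = signed (i # w) (f i)" using signed_involution[OF di, of "c w"] by metis
    ultimately have "c w - bd (volume g) w = signed (i # w) (f i - X i g)"
      by (simp add: signed_diff signed_additive[OF X_additive])
    then show ?thesis using sub_signed[OF graded_submodule_Z] fg[OF i(1)] by metis
  next
    case False
    then have "c w - bd (volume g) w = 0"
      using cochains_outside[OF diff, of w] alternating_nondistinct[OF cochains_alternating[OF diff], of w]
      by blast
    then show ?thesis by (simp add: sub_zero[OF graded_submodule_Z])
  qed
  then have "(\<lambda>w. c w - bd (volume g) w) \<in> K n (Z 0) (t + int n)"
    using cochains_mono[OF diff] by simp
  then show "\<exists>e\<in>K (Suc n) (F 0) (t + int n). (\<lambda>w. c w - bd e w) \<in> K n (Z 0) (t + int n)"
    using e by blast
qed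

end

section \<open>Forms\<close>

abbreviation lookup :: "('k \<Rightarrow>\<^sub>0 'b::zero) \<Rightarrow> 'k \<Rightarrow> 'b" where "lookup \<equiv> Poly_Mapping.lookup"
abbreviation keys :: "('k \<Rightarrow>\<^sub>0 'b::zero) \<Rightarrow> 'k set" where "keys \<equiv> Poly_Mapping.keys"
abbreviation single :: "'k \<Rightarrow> 'b \<Rightarrow> 'k \<Rightarrow>\<^sub>0 'b::zero" where "single \<equiv> Poly_Mapping.single"

definition var :: "nat \<Rightarrow> 'a::field mpoly" where
  "var j = single (single j 1) 1"

text \<open>Degrees are integers so that shifts such as \<open>e - 1\<close> or
  \<open>d - a i ! k\<close> need no case distinction; negative degrees contain only 0.\<close>

definition forms :: "nat \<Rightarrow> int \<Rightarrow> 'a::field mpoly set" where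
  "forms n e = {p \<in> poly_ring n. homogeneous e p}"

lemma total_deg_eq_sum: "finite S \<Longrightarrow> keys m \<subseteq> S \<Longrightarrow> total_deg m = (\<Sum>i\<in>S. lookup m i)"
  unfolding total_deg_def by (intro sum.mono_neutral_left) (auto simp: in_keys_iff)

lemma total_deg_add [simp]: "total_deg (m + k) = total_deg m + total_deg k"
proof -
  have "keys (m + k) \<subseteq> keys m \<union> keys k" by (rule Poly_Mapping.keys_add)
  then show ?thesis
    using total_deg_eq_sum[of "keys m \<union> keys k"] by (simp add: lookup_add sum.distrib)
qed

lemma total_deg_zero [simp]: "total_deg 0 = 0"
  by (simp add: total_deg_def)

lemma total_deg_single [simp]: "total_deg (single i k) = k"
  by (cases "k = 0") (simp_all add: total_deg_def)

lemma keys_add_nat: "keys (m + k) = keys m \<union> keys (k :: 'k \<Rightarrow>\<^sub>0 nat)"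
  by (auto simp: in_keys_iff lookup_add)

lemma forms_iff:
  "p \<in> forms n e \<longleftrightarrow> (\<forall>m\<in>keys p. keys m \<subseteq> {..n} \<and> int (total_deg m) = e)"
  by (auto simp: forms_def poly_ring_def homogeneous_def)

lemma formsI:
  assumes "\<And>m. lookup p m \<noteq> 0 \<Longrightarrow> keys m \<subseteq> {..n} \<and> int (total_deg m) = e"
  shows "p \<in> forms n e"
  using assms by (simp add: forms_iff in_keys_iff)

lemma formsD:
  assumes "p \<in> forms n e" "lookup p m \<noteq> 0"
  shows "keys m \<subseteq> {..n}" "int (total_deg m) = e"
  using assms by (auto simp: forms_iff in_keys_iff)

lemma forms_zero [simp]: "0 \<in> forms n e"
  by (simp add: forms_iff)

lemma forms_add: "p \<in> forms n e \<Longrightarrow> q \<in> forms n e \<Longrightarrow> p + q \<in> forms n e"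
  using Poly_Mapping.keys_add[of p q] by (auto simp: forms_iff)

lemma forms_uminus: "p \<in> forms n e \<Longrightarrow> - p \<in> forms n e"
  by (simp add: forms_iff)

lemma forms_diff: "p \<in> forms n e \<Longrightarrow> q \<in> forms n e \<Longrightarrow> p - q \<in> forms n e"
  using forms_add[of p n e "- q"] forms_uminus[of q n e] by simp

lemma forms_sum: "(\<And>i. i \<in> A \<Longrightarrow> f i \<in> forms n e) \<Longrightarrow> sum f A \<in> forms n e"
  by (induction A rule: infinite_finite_induct) (auto intro: forms_add)

lemma forms_scale: "p \<in> forms n e \<Longrightarrow> pm_scale c p \<in> forms n e"
  by (auto simp: forms_iff in_keys_iff)

lemma forms_mult:
  assumes "p \<in> forms n d" and "q \<in> forms n e" shows "p * q \<in> forms n (d + e)"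
  unfolding forms_iff
proof
  fix m assume "m \<in> keys (p * q)"
  then obtain k l where "m = k + l" "k \<in> keys p" "l \<in> keys q"
    using keys_mult[of p q] by blast
  then show "keys m \<subseteq> {..n} \<and> int (total_deg m) = d + e"
    using assms by (auto simp: forms_iff keys_add_nat)
qed

lemma forms_var: "j \<le> n \<Longrightarrow> var j \<in> forms n 1"
  by (auto simp: forms_iff var_def)

lemma forms_var_mult:
  assumes "j \<le> n" and "p \<in> forms n e" shows "var j * p \<in> forms n (e + 1)"
  using forms_mult[OF forms_var[OF assms(1)] assms(2)] by (simp add: add.commute)

lemma forms_const: "single 0 c \<in> forms n 0"
  by (auto simp: forms_iff)

lemma forms_neg: "e < 0 \<Longrightarrow> p \<in> forms n e \<Longrightarrow> p = 0"
  by (force simp: forms_iff)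

lemma pm_scale_eq_mult: "pm_scale c p = single 0 c * (p :: 'a::field mpoly)"
  unfolding pm_scale_def by (rule mult_map_scale_conv_mult)

lemma lookup_var_mult_add: "lookup (var j * p) (single j 1 + m) = lookup p m"
proof -
  have "lookup (var j * p) (single j 1 + m) =
      (\<Sum>l. lookup (var j) l * (\<Sum>q. lookup p q when single j 1 + m = l + q))"
    by (rule lookup_mult)
  also have "\<dots> = (\<Sum>l. (\<Sum>q. lookup p q when single j 1 + m = l + q) when l = single j 1)"
    by (intro arg_cong[of _ _ Sum_any] ext)
      (simp add: var_def lookup_single when_def)
  also have "\<dots> = (\<Sum>q. lookup p q when m = q)" by simp
  also have "\<dots> = lookup p m" by simp
  finally show ?thesis .
qed

lemma single_add_minus:
  "lookup m j \<noteq> 0 \<Longrightarrow> single j 1 + (m - single j 1) = (m :: nat \<Rightarrow>\<^sub>0 nat)"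
  by (rule poly_mapping_eqI) (auto simp: lookup_add lookup_minus lookup_single when_def)

lemma lookup_var_mult:
  "lookup (var j * p) m = (if lookup m j = 0 then 0 else lookup p (m - single j 1))"
proof (cases "lookup m j = 0")
  case True
  have "m \<notin> keys (var j * p)"
  proof
    assume "m \<in> keys (var j * p)"
    then obtain l where "m = single j 1 + l"
      using keys_mult[of "var j" p] by (auto simp: var_def)
    then show False using True by (simp add: lookup_add)
  qed
  then show ?thesis using True by (simp add: in_keys_iff)
next
  case False
  then show ?thesis
    using lookup_var_mult_add[of j p "m - single j 1"] single_add_minus[OF False] by simp
qed

lemma divisible_by_var:
  assumes "\<And>m. lookup p m \<noteq> 0 \<Longrightarrow> lookup m j \<noteq> 0" and "p \<in> forms n e"
  shows "\<exists>q\<in>forms n (e - 1). p = var j * q"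
proof -
  define q where "q = Abs_poly_mapping (\<lambda>m. lookup p (single j 1 + m))"
  have "finite {m. lookup p (single j 1 + m) \<noteq> 0}"
    by (rule finite_subset[OF _ finite_imageI[OF finite_keys[of p], of "\<lambda>m. m - single j 1"]])
      (force simp: in_keys_iff image_iff)
  then have q: "lookup q m = lookup p (single j 1 + m)" for m
    by (simp add: q_def)
  have "q \<in> forms n (e - 1)"
  proof (rule formsI)
    fix m assume "lookup q m \<noteq> 0"
    then have "keys (single j 1 + m) \<subseteq> {..n}" "int (total_deg (single j 1 + m)) = e"
      using formsD[OF assms(2)] by (auto simp only: q)
    then show "keys m \<subseteq> {..n} \<and> int (total_deg m) = e - 1"
      by (auto simp: keys_add_nat)
  qed
  moreover have "p = var j * q"
  proof (rule poly_mapping_eqI)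
    fix m
    show "lookup p m = lookup (var j * q) m"
      using assms(1)[of m] single_add_minus[of m j]
      by (cases "lookup m j = 0") (auto simp: lookup_var_mult q simp del: One_nat_def)
  qed
  ultimately show ?thesis by blast
qed

lemma var_neq_zero: "var j \<noteq> (0 :: 'a::field mpoly)"
proof
  assume "var j = (0 :: 'a mpoly)"
  then have "lookup (var j :: 'a mpoly) (single j 1) = 0" by simp
  then show False by (simp add: var_def)
qed

text \<open>Coefficients of \<open>x_1 G_0 = x_0 G_1\<close> show that \<open>x_0\<close> divides
  \<open>G_0\<close>, and cancelling \<open>x_0\<close> makes the quotient serve every
  \<open>G_k\<close>. So over the polynomial ring itself, in at least two variables, tuples of this
  kind are trivial.\<close>

lemma common_factor:
  fixes G :: "nat \<Rightarrow> 'a::field mpoly"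
  assumes "1 \<le> n" and G: "\<And>k. k \<le> n \<Longrightarrow> G k \<in> forms n e"
    and eq: "\<And>k l. k \<le> n \<Longrightarrow> l \<le> n \<Longrightarrow> var k * G l = var l * G k"
  shows "\<exists>g\<in>forms n (e - 1). \<forall>k\<le>n. G k = var k * g"
proof -
  have "lookup m 0 \<noteq> 0" if "lookup (G 0) m \<noteq> 0" for m
  proof -
    have "lookup (var 1 * G 0) (single 1 1 + m) \<noteq> 0"
      using that by (simp only: lookup_var_mult_add not_False_eq_True)
    then have "lookup (var 0 * G 1) (single 1 1 + m) \<noteq> 0"
      using eq[of 0 1] assms(1) by simp
    then show ?thesis
      by (auto simp: lookup_var_mult lookup_add lookup_single split: if_splits)
  qed
  then obtain g where g: "g \<in> forms n (e - 1)" "G 0 = var 0 * g"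
    using divisible_by_var[of "G 0" 0] G[of 0] by blast
  have "G k = var k * g" if "k \<le> n" for k
  proof -
    have "var 0 * G k = var 0 * (var k * g)"
      using eq[of 0 k] that g(2) by (simp add: ac_simps)
    then show ?thesis using var_neq_zero[of 0] mult_left_cancel by blast
  qed
  then show ?thesis using g by blast
qed

subsection \<open>Acyclicity of the Koszul complex of the polynomial ring\<close>

text \<open>The formal partial derivative with respect to \<open>x_j\<close>.\<close>

definition pd :: "nat \<Rightarrow> 'a::field mpoly \<Rightarrow> 'a mpoly" where
  "pd j p = Abs_poly_mapping (\<lambda>m. of_nat (Suc (lookup m j)) * lookup p (single j 1 + m))"

lemma lookup_pd: "lookup (pd j p) m = of_nat (Suc (lookup m j)) * lookup p (single j 1 + m)"
proof -
  have "finite {m. of_nat (Suc (lookup m j)) * lookup p (single j 1 + m) \<noteq> 0}"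
    by (rule finite_subset[OF _ finite_imageI[OF finite_keys[of p], of "\<lambda>m. m - single j 1"]])
      (force simp: in_keys_iff image_iff)
  then show ?thesis by (simp add: pd_def)
qed

lemma pd_add: "pd j (p + q) = pd j p + pd j q"
  by (rule poly_mapping_eqI) (simp add: lookup_pd lookup_add algebra_simps)

lemma pd_additive: "additive (pd j)"
  by (simp add: additive_def pd_add)

lemma pd_var_mult: "pd i (var j * p) = (if i = j then p else 0) + var j * pd i p"
proof (rule poly_mapping_eqI)
  fix m
  show "lookup (pd i (var j * p)) m = lookup ((if i = j then p else 0) + var j * pd i p) m"
  proof (cases "i = j")
    case True
    have L: "lookup (pd i (var i * p)) m = of_nat (Suc (lookup m i)) * lookup p m"
      by (simp only: lookup_pd lookup_var_mult_add)
    show ?thesis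
    proof (cases "lookup m i")
      case 0
      then show ?thesis using True L by (simp add: lookup_add lookup_var_mult)
    next
      case (Suc k)
      then have "lookup (var i * pd i p) m = of_nat (Suc k) * lookup p m"
        using single_add_minus[of m i]
        by (simp add: lookup_var_mult lookup_pd lookup_minus del: One_nat_def of_nat_Suc)
      then show ?thesis using True L Suc by (simp add: lookup_add algebra_simps)
    qed
  next
    case False
    have "lookup m j \<noteq> 0 \<Longrightarrow> single i 1 + m - single j 1 = single i 1 + (m - single j 1)"
      using False by (intro poly_mapping_eqI) (auto simp: lookup_add lookup_minus lookup_single when_def)
    then show ?thesis
      using False by (simp add: lookup_pd lookup_var_mult lookup_add lookup_minus lookup_single)
  qed
qed

lemma forms_pd: assumes "p \<in> forms n e" shows "pd j p \<in> forms n (e - 1)"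
proof (rule formsI)
  fix m assume "lookup (pd j p) m \<noteq> 0"
  then have "lookup p (single j 1 + m) \<noteq> 0" by (simp add: lookup_pd)
  then have "keys (single j 1 + m) \<subseteq> {..n}" "int (total_deg (single j 1 + m)) = e"
    using formsD[OF assms] by blast+
  then show "keys m \<subseteq> {..n} \<and> int (total_deg m) = e - 1"
    by (auto simp: keys_add_nat)
qed

lemma euler_identity:
  assumes "p \<in> forms n e"
  shows "(\<Sum>i\<le>n. var i * pd i p) = pm_scale (of_int e) p"
proof (rule poly_mapping_eqI)
  fix m
  have "lookup (\<Sum>i\<le>n. var i * pd i p) m = (\<Sum>i\<le>n. of_nat (lookup m i) * lookup p m)"
    unfolding lookup_sum
  proof (intro sum.cong refl)
    fix i
    show "lookup (var i * pd i p) m = of_nat (lookup m i) * lookup p m"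
      using single_add_minus[of m i]
      by (simp add: lookup_var_mult lookup_pd lookup_minus flip: of_nat_Suc)
  qed
  also have "\<dots> = of_nat (\<Sum>i\<le>n. lookup m i) * lookup p m"
    by (simp add: sum_distrib_right)
  also have "\<dots> = of_int e * lookup p m"
  proof (cases "lookup p m = 0")
    case False
    have "e = int (\<Sum>i\<le>n. lookup m i)"
      using formsD[OF assms False] total_deg_eq_sum[of "{..n}" m] by simp
    then show ?thesis by simp
  qed simp
  finally show "lookup (\<Sum>i\<le>n. var i * pd i p) m = lookup (pm_scale (of_int e) p) m" by simp
qed

lemma pd_outside:
  assumes "p \<in> forms n e" and "n < j" shows "pd j p = 0"
proof (rule poly_mapping_eqI)
  fix m
  have "lookup p (single j 1 + m) = 0"
    using formsD(1)[OF assms(1), of "single j 1 + m"] assms(2) by (force simp: keys_add_nat)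
  then show "lookup (pd j p) m = lookup 0 m" by (simp add: lookup_pd)
qed

text \<open>The exterior derivative of the differential form with coefficients \<open>c\<close>. The
  recursion differentiates along each letter of the word in turn; the minus sign is the cost of
  passing the letter \<open>j\<close>.\<close>

fun exterior_derivative :: "(nat list \<Rightarrow> 'a::field mpoly) \<Rightarrow> nat list \<Rightarrow> 'a mpoly" where
  "exterior_derivative c [] = 0"
| "exterior_derivative c (j # w) = pd j (c w) - exterior_derivative (\<lambda>v. c (j # v)) w"

text \<open>The coefficients of the wedge product of \<open>dx_i\<close> with \<open>c\<close>, the
  extra term in the product rule for the derivative of \<open>x_i c\<close>.\<close>

fun leibniz_defect :: "nat \<Rightarrow> (nat list \<Rightarrow> 'a::field mpoly) \<Rightarrow> nat list \<Rightarrow> 'a mpoly" where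
  "leibniz_defect i c [] = 0"
| "leibniz_defect i c (j # w) = (if i = j then c w else 0) - leibniz_defect i (\<lambda>v. c (j # v)) w"

lemma exterior_derivative_minus:
  "exterior_derivative (\<lambda>v. - c v) w = - exterior_derivative c w"
  by (induction w arbitrary: c) (simp_all add: additive.minus[OF pd_additive])

lemma exterior_derivative_add:
  "exterior_derivative (\<lambda>v. b v + c v) w = exterior_derivative b w + exterior_derivative c w"
  by (induction w arbitrary: b c) (simp_all add: pd_add)

lemma exterior_derivative_zero [simp]: "exterior_derivative (\<lambda>v. 0) w = 0"
  by (induction w) (simp_all add: additive.zero[OF pd_additive])

lemma exterior_derivative_sum:
  "exterior_derivative (\<lambda>v. \<Sum>i\<in>A. c i v) w = (\<Sum>i\<in>A. exterior_derivative (c i) w)"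
  by (induction A rule: infinite_finite_induct) (simp_all add: exterior_derivative_add)

lemma exterior_derivative_var_mult:
  "exterior_derivative (\<lambda>v. var i * c v) w = var i * exterior_derivative c w + leibniz_defect i c w"
proof (induction w arbitrary: c)
  case (Cons j w)
  then show ?case
    using Cons.IH[of "\<lambda>v. c (j # v)"] by (simp add: pd_var_mult right_diff_distrib)
qed simp

lemma leibniz_defect_minus: "leibniz_defect i (\<lambda>v. - c v) w = - leibniz_defect i c w"
  by (induction w arbitrary: c) simp_all

text \<open>Contracting with the i-th coordinate vector and wedging with \<open>dx_i\<close> again
  counts the slots occupied by i; summed over i this is the number of slots.\<close>

lemma sum_leibniz_defect:
  assumes "alternating c" and "set w \<subseteq> {..n}"
  shows "(\<Sum>i\<le>n. leibniz_defect i (\<lambda>v. c (i # v)) w) = of_nat (length w) * c w"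
  using assms
proof (induction w arbitrary: c)
  case (Cons j w)
  have "leibniz_defect i (\<lambda>v. c (i # j # v)) w = - leibniz_defect i (\<lambda>v. c (j # i # v)) w" for i
  proof -
    have "(\<lambda>v. c (i # j # v)) = (\<lambda>v. - c (j # i # v))"
      by (intro ext alternating_swap_head[OF Cons.prems(1)])
    then show ?thesis by (simp only: leibniz_defect_minus)
  qed
  then have "(\<Sum>i\<le>n. leibniz_defect i (\<lambda>v. c (i # v)) (j # w)) =
      (\<Sum>i\<le>n. if i = j then c (i # w) else 0) + (\<Sum>i\<le>n. leibniz_defect i (\<lambda>v. c (j # i # v)) w)"
    by (simp add: sum.distrib)
  also have "(\<Sum>i\<le>n. if i = j then c (i # w) else 0) = c (j # w)"
    using Cons.prems by simp
  also have "(\<Sum>i\<le>n. leibniz_defect i (\<lambda>v. c (j # i # v)) w) = of_nat (length w) * c (j # w)"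
    using Cons.IH[OF alternating_Cons[OF Cons.prems(1), of j]] Cons.prems by simp
  finally show ?case by (simp add: algebra_simps)
qed simp

text \<open>
  The Koszul differential is contraction with the Euler vector field, so this makes the exterior
  derivative a contracting homotopy up to nonzero integers.
\<close>

lemma cartan_formula:
  assumes "alternating c" and "set w \<subseteq> {..n}" and "c w \<in> forms n e"
  shows "(\<Sum>i\<le>n. var i * exterior_derivative c (i # w)) +
      exterior_derivative (\<lambda>v. \<Sum>i\<le>n. var i * c (i # v)) w =
    pm_scale (of_int (e + int (length w))) (c w)"
proof -
  have "(\<Sum>i\<le>n. var i * exterior_derivative c (i # w)) +
      exterior_derivative (\<lambda>v. \<Sum>i\<le>n. var i * c (i # v)) w =
    (\<Sum>i\<le>n. var i * pd i (c w)) + (\<Sum>i\<le>n. leibniz_defect i (\<lambda>v. c (i # v)) w)"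
    by (simp add: exterior_derivative_sum exterior_derivative_var_mult algebra_simps
        sum.distrib sum_subtractf)
  also have "\<dots> = pm_scale (of_int e) (c w) + of_nat (length w) * c w"
    by (simp add: euler_identity[OF assms(3)] sum_leibniz_defect[OF assms(1,2)])
  also have "of_nat (length w) * c w = pm_scale (of_nat (length w)) (c w)"
    by (simp add: pm_scale_eq_mult single_of_nat)
  finally show ?thesis by (simp add: pm.scale_left_distrib)
qed

lemma mpoly_torsion_free:
  fixes x :: "'a::field_char_0 mpoly" assumes "x = - x" shows "x = 0"
proof (rule poly_mapping_eqI)
  fix m
  have "x + x = 0" using assms by (metis add.right_inverse)
  then have "2 * lookup x m = 0" by (metis lookup_add lookup_zero mult_2)
  then show "lookup x m = lookup 0 m" by simp
qed

lemma alternating_exterior_derivative: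
  fixes c :: "nat list \<Rightarrow> 'a::field_char_0 mpoly"
  assumes "alternating c" shows "alternating (exterior_derivative c)"
proof (rule alternatingI_torsion_free)
  fix u v and i j :: nat
  show "exterior_derivative c (u @ i # j # v) = - exterior_derivative c (u @ j # i # v)"
    using assms
  proof (induction u arbitrary: c)
    case Nil
    have "(\<lambda>w. c (i # j # w)) = (\<lambda>w. - c (j # i # w))"
      by (intro ext alternating_swap_head[OF Nil])
    then have "exterior_derivative (\<lambda>w. c (i # j # w)) v = - exterior_derivative (\<lambda>w. c (j # i # w)) v"
      by (simp only: exterior_derivative_minus)
    then show ?case by simp
  next
    case (Cons k u)
    have "c (u @ i # j # v) = - c (u @ j # i # v)"
      by (rule alternating_swap[OF Cons.prems])
    then have "pd k (c (u @ i # j # v)) = - pd k (c (u @ j # i # v))"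
      by (simp only: additive.minus[OF pd_additive])
    moreover have "exterior_derivative (\<lambda>w. c (k # w)) (u @ i # j # v) =
        - exterior_derivative (\<lambda>w. c (k # w)) (u @ j # i # v)"
      by (rule Cons.IH[OF alternating_Cons[OF Cons.prems]])
    ultimately show ?case by (simp only: exterior_derivative.simps append_Cons) simp
  qed
qed (rule mpoly_torsion_free)

lemma exterior_derivative_outside:
  assumes "\<And>w. length w \<noteq> p \<or> \<not> set w \<subseteq> {..n} \<Longrightarrow> c w = 0"
    and "\<And>w. c w \<in> forms n e"
    and "length w \<noteq> Suc p \<or> \<not> set w \<subseteq> {..n}"
  shows "exterior_derivative c w = 0"
  using assms
proof (induction w arbitrary: c p)
  case (Cons j w)
  show ?case
  proof (cases "j \<le> n")
    case False
    then have "(\<lambda>v. c (j # v)) = (\<lambda>v. 0)" using Cons.prems(1) by auto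
    moreover have "pd j (c w) = 0"
      using pd_outside[OF Cons.prems(2)] False by simp
    ultimately show ?thesis by simp
  next
    case True
    then have "c w = 0" using Cons.prems by auto
    moreover have "exterior_derivative (\<lambda>v. c (j # v)) w = 0"
    proof (cases p)
      case 0
      then have "(\<lambda>v. c (j # v)) = (\<lambda>v. 0)" using Cons.prems(1) by auto
      then show ?thesis by simp
    next
      case (Suc q)
      show ?thesis
        by (rule Cons.IH[of q]) (use Cons.prems True Suc in auto)
    qed
    ultimately show ?thesis by (simp add: additive.zero[OF pd_additive])
  qed
qed simp

lemma forms_exterior_derivative:
  assumes "\<And>w. c w \<in> forms n e" shows "exterior_derivative c w \<in> forms n (e - 1)"
  using assms
proof (induction w arbitrary: c)
  case (Cons j w)
  have "exterior_derivative (\<lambda>v. c (j # v)) w \<in> forms n (e - 1)"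
    by (rule Cons.IH) (rule Cons.prems)
  then show ?case by (simp add: forms_diff forms_pd Cons.prems)
qed simp

text \<open>On a cycle one of the two terms of Cartan's formula drops out, and the total degree
  \<open>d\<close> is the remaining factor. Characteristic 0 makes it invertible unless it is
  0.\<close>

lemma koszul_acyclic_forms:
  fixes c :: "nat list \<Rightarrow> 'a::field_char_0 mpoly"
  assumes c: "c \<in> cochains n (Suc p) (forms n) d"
    and cycle: "\<And>w. (\<Sum>i\<le>n. var i * c (i # w)) = 0"
  shows "\<exists>e\<in>cochains n (Suc (Suc p)) (forms n) d. \<forall>w. (\<Sum>i\<le>n. var i * e (i # w)) = c w"
proof (cases "d = 0")
  case True
  \<comment> \<open>In total degree 0 the values of \<open>c\<close> have degree
    \<open>- Suc p\<close>, which is negative.\<close>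
  then have "c w = 0" for w
    using cochains_mem[OF c, of w] by (intro forms_neg[of "d - int (Suc p)" "c w" n]) auto
  then show ?thesis
    by (intro bexI[of _ "\<lambda>w. 0"] cochainsI) (auto simp: alternating_def)
next
  case False
  note alt = cochains_alternating[OF c]
  define k where "k = inverse (of_int d :: 'a)"
  define e where "e w = pm_scale k (exterior_derivative c w)" for w
  have additive: "additive (pm_scale k :: 'a mpoly \<Rightarrow> 'a mpoly)"
    by (simp add: additive_def pm.scale_right_distrib)
  have out: "exterior_derivative c w = 0" if "length w \<noteq> Suc (Suc p) \<or> \<not> set w \<subseteq> {..n}" for w
    by (rule exterior_derivative_outside[OF cochains_outside[OF c] cochains_mem[OF c] that])
  have e: "e \<in> cochains n (Suc (Suc p)) (forms n) d"
  proof (rule cochainsI)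
    show "alternating e"
      unfolding e_def by (intro alternating_comp[OF _ additive] alternating_exterior_derivative alt)
    show "e w \<in> forms n (d - int (Suc (Suc p)))" for w
      unfolding e_def
      using forms_scale[OF forms_exterior_derivative[OF cochains_mem[OF c]]] by (simp add: algebra_simps)
  qed (simp add: e_def out)
  have "(\<Sum>i\<le>n. var i * e (i # w)) = c w" for w
  proof (cases "length w = Suc p \<and> set w \<subseteq> {..n}")
    case True
    have "(\<Sum>i\<le>n. var i * e (i # w)) = pm_scale k (\<Sum>i\<le>n. var i * exterior_derivative c (i # w))"
      by (simp add: e_def pm_scale_eq_mult sum_distrib_left ac_simps del: exterior_derivative.simps)
    also have "(\<Sum>i\<le>n. var i * exterior_derivative c (i # w)) = pm_scale (of_int d) (c w)"
      using cartan_formula[OF alt _ cochains_mem[OF c], of w] True cycle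
      by (simp add: cycle del: exterior_derivative.simps)
    also have "pm_scale k (pm_scale (of_int d) (c w)) = c w"
      using False by (simp add: k_def)
    finally show ?thesis .
  next
    case False
    then have "e (i # w) = 0" if "i \<le> n" for i
      unfolding e_def using out[of "i # w"] by auto
    then show ?thesis using cochains_outside[OF c] False by (auto intro!: sum.neutral)
  qed
  then show ?thesis using e by blast
qed

section \<open>Socle degrees and the end of the resolution\<close>

definition hom_component :: "int \<Rightarrow> 'a::field mpoly \<Rightarrow> 'a mpoly" where
  "hom_component e p = Abs_poly_mapping (\<lambda>m. if int (total_deg m) = e then lookup p m else 0)"

lemma lookup_hom_component:
  "lookup (hom_component e p) m = (if int (total_deg m) = e then lookup p m else 0)"
proof -
  have "finite {m. (if int (total_deg m) = e then lookup p m else 0) \<noteq> 0}"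
    by (rule finite_subset[OF _ finite_keys[of p]]) (auto simp: in_keys_iff)
  then show ?thesis by (simp add: hom_component_def)
qed

lemma hom_component_forms: "p \<in> poly_ring n \<Longrightarrow> hom_component e p \<in> forms n e"
  by (rule formsI) (auto simp: lookup_hom_component poly_ring_def in_keys_iff split: if_splits)

lemma hom_component_id: "p \<in> forms n e \<Longrightarrow> hom_component e p = p"
  by (rule poly_mapping_eqI) (auto simp: lookup_hom_component dest: formsD(2))

lemma hom_component_add: "hom_component e (p + q) = hom_component e p + hom_component e q"
  by (rule poly_mapping_eqI) (simp add: lookup_hom_component lookup_add)

lemma hom_component_sum: "hom_component e (sum f A) = (\<Sum>i\<in>A. hom_component e (f i))"
proof -
  have "hom_component e 0 = 0"
    by (rule poly_mapping_eqI) (simp add: lookup_hom_component)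
  then show ?thesis
    by (induction A rule: infinite_finite_induct) (simp_all add: hom_component_add)
qed

lemma hom_component_mult:
  assumes "homogeneous d p"
  shows "hom_component e (p * q) = p * hom_component (e - d) q"
proof -
  define r where "r = q - hom_component (e - d) q"
  have deg: "\<exists>k l. m = k + l \<and> int (total_deg k) = d \<and> lookup s l \<noteq> 0"
    if "lookup (p * s) m \<noteq> 0" for s m
  proof -
    have "m \<in> keys (p * s)" using that by (simp add: in_keys_iff)
    then obtain k l where "m = k + l" "k \<in> keys p" "l \<in> keys s"
      using keys_mult[of p s] by blast
    moreover from this have "int (total_deg k) = d" using assms unfolding homogeneous_def by blast
    ultimately show ?thesis unfolding in_keys_iff by blast
  qed
  have "hom_component e (p * r) = 0"
  proof (rule poly_mapping_eqI)
    fix m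
    have "int (total_deg m) \<noteq> e" if "lookup (p * r) m \<noteq> 0"
      using deg[OF that] by (auto simp: r_def lookup_minus lookup_hom_component split: if_splits)
    then show "lookup (hom_component e (p * r)) m = lookup 0 m"
      by (auto simp: lookup_hom_component)
  qed
  moreover have "hom_component e (p * hom_component (e - d) q) = p * hom_component (e - d) q"
  proof (rule poly_mapping_eqI)
    fix m
    have "int (total_deg m) = e" if "lookup (p * hom_component (e - d) q) m \<noteq> 0"
      using deg[OF that] by (auto simp: lookup_hom_component split: if_splits)
    then show "lookup (hom_component e (p * hom_component (e - d) q)) m =
        lookup (p * hom_component (e - d) q) m"
      by (auto simp: lookup_hom_component)
  qed
  moreover have "p * q = p * hom_component (e - d) q + p * r"
    by (simp add: r_def algebra_simps)
  ultimately show ?thesis by (simp add: hom_component_add)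
qed

lemma lookup_mult_zero: "lookup p 0 = 0 \<Longrightarrow> lookup (p * q :: 'a::field mpoly) 0 = 0"
proof (rule ccontr)
  assume p: "lookup p 0 = 0" and "lookup (p * q) 0 \<noteq> 0"
  then have "0 \<in> keys (p * q)" by (simp add: in_keys_iff)
  then obtain k l where kl: "0 = k + l" "k \<in> keys p"
    using keys_mult[of p q] by blast
  then have "keys k = {}" using keys_add_nat[of k l] by simp
  then show False using kl p by (simp add: in_keys_iff)
qed

text \<open>Euler's identity expresses a form of nonzero degree through the variables; a form of
  degree 0 is its constant term. The minimality of the resolution is applied in this shape.\<close>

lemma irrelevant_ideal:
  fixes p :: "'a::field_char_0 mpoly"
  assumes p: "p \<in> forms n e" and p0: "lookup p 0 = 0"
  shows "\<exists>b. (\<forall>i\<le>n. b i \<in> forms n (e - 1)) \<and> p = (\<Sum>i\<le>n. var i * b i)"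
proof (cases "e = 0")
  case True
  have "lookup p m = 0" for m
  proof (rule ccontr)
    assume *: "lookup p m \<noteq> 0"
    have "total_deg m = 0" using formsD(2)[OF p *] True by simp
    then have "m = 0" by (auto simp: total_deg_def in_keys_iff poly_mapping_eq_iff fun_eq_iff)
    then show False using * p0 by simp
  qed
  then have "p = 0" by (intro poly_mapping_eqI) simp
  then show ?thesis by (intro exI[of _ "\<lambda>i. 0"]) simp
next
  case False
  define b where "b i = pm_scale (inverse (of_int e)) (pd i p)" for i
  have "(\<Sum>i\<le>n. var i * b i) = pm_scale (inverse (of_int e)) (\<Sum>i\<le>n. var i * pd i p)"
    by (simp add: b_def pm_scale_eq_mult sum_distrib_left ac_simps)
  also have "\<dots> = p" using False by (simp add: euler_identity[OF p])
  finally show ?thesis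
    using forms_scale[OF forms_pd[OF p]] by (intro exI[of _ b]) (simp add: b_def)
qed

lemma sum_fun_apply: "(\<Sum>i\<in>A. f i) k = (\<Sum>i\<in>A. f i k)"
  by (induction A rule: infinite_finite_induct) simp_all

section \<open>The resolution as a graded complex\<close>

locale resolution =
  fixes n :: nat and I :: "'a::field_char_0 mpoly set"
    and a :: "nat \<Rightarrow> int list" and D :: "nat \<Rightarrow> 'a mpoly mat"
  assumes n_ge_2: "2 \<le> n" and res: "minimal_graded_free_resolution n I a D"
begin

abbreviation rk :: "nat \<Rightarrow> nat" where "rk i \<equiv> length (a i)"

definition X :: "nat \<Rightarrow> (nat \<Rightarrow> 'a mpoly) \<Rightarrow> nat \<Rightarrow> 'a mpoly" where
  "X j v = (\<lambda>k. var j * v k)"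

text \<open>Elements are functions that vanish beyond the rank rather than vectors, because
  functions form one additive group whatever the rank.\<close>

definition F :: "nat \<Rightarrow> int \<Rightarrow> (nat \<Rightarrow> 'a mpoly) set" where
  "F i d = {v. \<forall>k. if k < rk i then v k \<in> forms n (d - a i ! k) else v k = 0}"

definition Dop :: "nat \<Rightarrow> (nat \<Rightarrow> 'a mpoly) \<Rightarrow> nat \<Rightarrow> 'a mpoly" where
  "Dop i v = (\<lambda>j. if j < rk i then \<Sum>k<rk (Suc i). D (Suc i) $$ (j, k) * v k else 0)"

lemma FI: "(\<And>k. k < rk i \<Longrightarrow> v k \<in> forms n (d - a i ! k)) \<Longrightarrow> (\<And>k. rk i \<le> k \<Longrightarrow> v k = 0) \<Longrightarrow>
    v \<in> F i d"
  by (simp add: F_def)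

lemma FD:
  assumes "v \<in> F i d"
  shows "k < rk i \<Longrightarrow> v k \<in> forms n (d - a i ! k)" "rk i \<le> k \<Longrightarrow> v k = 0"
  using assms by (auto simp: F_def dest: spec[of _ k])

lemma a_0: "a 0 = [0]"
  using res by (simp add: minimal_graded_free_resolution_def)

lemma D_carrier: "i < n \<Longrightarrow> D (Suc i) \<in> carrier_mat (rk i) (rk (Suc i))"
proof -
  assume "i < n"
  then have "Suc i \<in> {1..n}" by auto
  then have "D (Suc i) \<in> carrier_mat (rk (Suc i - 1)) (rk (Suc i))"
    using res unfolding minimal_graded_free_resolution_def by blast
  then show ?thesis by simp
qed

lemma D_entry:
  assumes "i < n" "j < rk i" "k < rk (Suc i)"
  shows "D (Suc i) $$ (j, k) \<in> forms n (a (Suc i) ! k - a i ! j)"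
    and "lookup (D (Suc i) $$ (j, k)) 0 = 0"
proof -
  have "Suc i \<in> {1..n}" using assms(1) by auto
  then have "\<forall>j<rk (Suc i - 1). \<forall>k<rk (Suc i). D (Suc i) $$ (j, k) \<in> poly_ring n \<and>
      homogeneous (a (Suc i) ! k - a (Suc i - 1) ! j) (D (Suc i) $$ (j, k)) \<and>
      lookup (D (Suc i) $$ (j, k)) 0 = 0"
    using res unfolding minimal_graded_free_resolution_def by blast
  then show "D (Suc i) $$ (j, k) \<in> forms n (a (Suc i) ! k - a i ! j)"
    "lookup (D (Suc i) $$ (j, k)) 0 = 0"
    using assms by (auto simp: forms_def)
qed

lemma D_mult_vec_index:
  assumes "i < n" "j < rk i" "dim_vec w = rk (Suc i)"
  shows "(D (Suc i) *\<^sub>v w) $ j = (\<Sum>k<rk (Suc i). D (Suc i) $$ (j, k) * w $ k)"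
  using D_carrier[OF assms(1)] assms(2,3)
  by (auto simp: scalar_prod_def atLeast0LessThan intro!: sum.cong)

lemma D_mult_vec:
  assumes "i < n"
  shows "D (Suc i) *\<^sub>v vec (rk (Suc i)) v = vec (rk i) (Dop i v)"
proof (rule eq_vecI)
  show "(D (Suc i) *\<^sub>v vec (rk (Suc i)) v) $ j = vec (rk i) (Dop i v) $ j"
    if "j < dim_vec (vec (rk i) (Dop i v))" for j
    using that D_mult_vec_index[OF assms, of j "vec (rk (Suc i)) v"] by (simp add: Dop_def)
qed (use D_carrier[OF assms] in auto)

lemma F_free_module: "v \<in> F i d \<Longrightarrow> vec (rk i) v \<in> free_module n (rk i)"
  using FD(1) by (force simp: free_module_def forms_def)

text \<open>Exactness is known for vectors of arbitrary polynomials, whereas the complex asks for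
  preimages of degree \<open>d\<close>. As the matrix entries are homogeneous, passing to the
  components of \<open>w\<close> in the right degrees preserves the equation.\<close>

lemma hom_lift:
  assumes i: "i < n" and w: "w \<in> free_module n (rk (Suc i))" and x: "x \<in> F i d"
    and eq: "\<And>j. j < rk i \<Longrightarrow> (D (Suc i) *\<^sub>v w) $ j = x j"
  shows "\<exists>y\<in>F (Suc i) d. Dop i y = x"
proof -
  define y where "y k = (if k < rk (Suc i) then hom_component (d - a (Suc i) ! k) (w $ k) else 0)" for k
  have "y \<in> F (Suc i) d"
    using w by (intro FI) (auto simp: y_def free_module_def intro: hom_component_forms)
  moreover have "Dop i y = x"
  proof
    fix j
    show "Dop i y j = x j"
    proof (cases "j < rk i")
      case True
      have "D (Suc i) $$ (j, k) * y k = hom_component (d - a i ! j) (D (Suc i) $$ (j, k) * w $ k)"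
        if "k < rk (Suc i)" for k
      proof -
        have "homogeneous (a (Suc i) ! k - a i ! j) (D (Suc i) $$ (j, k))"
          using D_entry(1)[OF i True that] by (simp add: forms_def)
        from hom_component_mult[OF this] show ?thesis using that by (simp add: y_def)
      qed
      then have "Dop i y j = hom_component (d - a i ! j) (x j)"
        using True w by (simp add: Dop_def hom_component_sum D_mult_vec_index[OF i True] free_module_def
            flip: eq)
      then show ?thesis using hom_component_id FD(1)[OF x True] by metis
    next
      case False
      then show ?thesis using FD(2)[OF x, of j] by (simp add: Dop_def)
    qed
  qed
  ultimately show ?thesis by blast
qed

lemma kernel_eq_image:
  assumes "Suc i < n" shows "map_kernel n (D (Suc i)) = map_image n (D (Suc (Suc i)))"
proof -
  have "Suc i \<in> {1..<n}" using assms by simp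
  then show ?thesis using res unfolding minimal_graded_free_resolution_def by (metis Suc_eq_plus1)
qed

lemma dim_D: "i < n \<Longrightarrow> dim_col (D (Suc i)) = rk (Suc i) \<and> dim_row (D (Suc i)) = rk i"
  using D_carrier by auto

lemma Dop_eq_zero_kernel:
  assumes "i < n" "x \<in> F (Suc i) d" "Dop i x = 0"
  shows "vec (rk (Suc i)) x \<in> map_kernel n (D (Suc i))"
  using assms F_free_module[OF assms(2)]
  by (auto simp: map_kernel_def dim_D D_mult_vec zero_vec_def)

lemma Dop_F:
  assumes i: "i < n" and x: "x \<in> F (Suc i) d" shows "Dop i x \<in> F i d"
proof (rule FI)
  fix j assume j: "j < rk i"
  have "D (Suc i) $$ (j, k) * x k \<in> forms n (d - a i ! j)" if "k < rk (Suc i)" for k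
    using forms_mult[OF D_entry(1)[OF i j that] FD(1)[OF x that]] by simp
  then show "Dop i x j \<in> forms n (d - a i ! j)"
    using j by (auto simp: Dop_def intro: forms_sum)
qed (simp add: Dop_def)

text \<open>The Koszul complex of \<open>F i\<close> splits into copies of that of the polynomial
  ring, one per basis vector, with the total degree lowered by the degree of that vector.\<close>

lemma koszul_acyclic_F:
  assumes c: "c \<in> cochains n (Suc p) (F i) d" and cycle: "koszul_bd n X c = 0"
  shows "\<exists>e\<in>cochains n (Suc (Suc p)) (F i) d. koszul_bd n X e = c"
proof -
  have bd: "koszul_bd n X b w k = (\<Sum>i\<le>n. var i * b (i # w) k)" for b w k
    by (simp add: koszul_bd_def sum_fun_apply X_def)
  have additive: "additive (\<lambda>v :: nat \<Rightarrow> 'a mpoly. v k)" for k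
    by (simp add: additive_def)
  have "\<exists>e\<in>cochains n (Suc (Suc p)) (forms n) (d - a i ! k).
      \<forall>w. (\<Sum>i\<le>n. var i * e (i # w)) = c w k" if k: "k < rk i" for k
  proof (rule koszul_acyclic_forms)
    show "(\<lambda>w. c w k) \<in> cochains n (Suc p) (forms n) (d - a i ! k)"
    proof (rule cochainsI)
      show "alternating (\<lambda>w. c w k)"
        by (rule alternating_comp[OF cochains_alternating[OF c] additive])
      show "c w k \<in> forms n (d - a i ! k - int (Suc p))" for w
        using FD(1)[OF cochains_mem[OF c] k] by (simp add: algebra_simps)
    qed (simp add: cochains_outside[OF c])
    show "(\<Sum>i\<le>n. var i * c (i # w) k) = 0" for w
      using fun_cong[OF fun_cong[OF cycle, of w], of k] by (simp add: bd)
  qed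
  then have "\<forall>k. \<exists>e. k < rk i \<longrightarrow> e \<in> cochains n (Suc (Suc p)) (forms n) (d - a i ! k) \<and>
      (\<forall>w. (\<Sum>i\<le>n. var i * e (i # w)) = c w k)" by blast
  from choice[OF this] obtain e0
    where e0: "\<And>k. k < rk i \<Longrightarrow> e0 k \<in> cochains n (Suc (Suc p)) (forms n) (d - a i ! k)"
      "\<And>k w. k < rk i \<Longrightarrow> (\<Sum>i\<le>n. var i * e0 k (i # w)) = c w k" by blast
  define e where "e w k = (if k < rk i then e0 k w else 0)" for w k
  have "e \<in> cochains n (Suc (Suc p)) (F i) d"
  proof (rule cochainsI)
    have "e (u @ r # j # v) = - e (u @ j # r # v)" for u r j v
    proof
      fix k
      show "e (u @ r # j # v) k = (- e (u @ j # r # v)) k"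
        unfolding e_def uminus_apply
        using alternating_swap[OF cochains_alternating[OF e0(1)], of k u r j v]
        by (cases "k < rk i") (simp_all only: if_True if_False minus_zero)
    qed
    moreover have "e w = 0" if "\<not> distinct w" for w
      using alternating_nondistinct[OF cochains_alternating[OF e0(1)] that]
      by (auto simp: fun_eq_iff e_def)
    ultimately show "alternating e" unfolding alternating_def by blast
    show "e w = 0" if "length w \<noteq> Suc (Suc p) \<or> \<not> set w \<subseteq> {..n}" for w
      using cochains_outside[OF e0(1) that] by (auto simp: e_def fun_eq_iff)
    show "e w \<in> F i (d - int (Suc (Suc p)))" for w
      using cochains_mem[OF e0(1)] by (intro FI) (auto simp: e_def algebra_simps)
  qed
  moreover have "koszul_bd n X e w k = c w k" for w k
    using e0(2)[of k w] FD(2)[OF cochains_mem[OF c], of k w]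
    by (cases "k < rk i") (simp_all add: bd e_def)
  ultimately show ?thesis by blast
qed

sublocale graded_complex n X F Dop
proof (rule graded_complex.intro)
  show "2 \<le> n" by (rule n_ge_2)
  show "x = 0" if "x = - x" for x :: "nat \<Rightarrow> 'a mpoly"
  proof
    fix k
    have "x k = - x k" using fun_cong[OF that, of k] by (simp only: uminus_apply)
    then show "x k = 0 k" unfolding zero_fun_apply by (rule mpoly_torsion_free)
  qed
  show "0 \<in> F i d" for i d by (simp add: F_def)
  show "x - y \<in> F i d" if "x \<in> F i d" "y \<in> F i d" for x y i d
    using FD[OF that(1)] FD[OF that(2)] by (intro FI) (auto intro: forms_diff)
  show "additive (X j)" for j by (auto simp: additive_def X_def algebra_simps)
  show "X j (X k x) = X k (X j x)" for j k x by (auto simp: X_def ac_simps)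
  show "X j x \<in> F i (d + 1)" if "j \<le> n" "x \<in> F i d" for j x i d
    unfolding X_def
  proof (rule FI)
    fix k assume "k < rk i"
    then show "var j * x k \<in> forms n (d + 1 - a i ! k)"
      using forms_var_mult[OF that(1) FD(1)[OF that(2)]] by (simp add: algebra_simps)
  qed (simp add: FD(2)[OF that(2)])
  show "additive (Dop i)" for i
    by (auto simp: additive_def Dop_def algebra_simps sum.distrib)
  show "Dop i (X j x) = X j (Dop i x)" for i j x
    by (auto simp: Dop_def X_def sum_distrib_left ac_simps)
  show "Dop i x \<in> F i d" if "i < n" "x \<in> F (Suc i) d" for i x d
    by (rule Dop_F[OF that])
  show "Dop i (Dop (Suc i) x) = 0" if i: "Suc i < n" and x: "x \<in> F (Suc (Suc i)) d" for i x d
  proof -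
    have "D (Suc (Suc i)) *\<^sub>v vec (rk (Suc (Suc i))) x \<in> map_kernel n (D (Suc i))"
      unfolding kernel_eq_image[OF i] map_image_def using F_free_module[OF x] i by (simp add: dim_D)
    then have "D (Suc i) *\<^sub>v vec (rk (Suc i)) (Dop (Suc i) x) = 0\<^sub>v (rk i)"
      using i by (simp add: D_mult_vec map_kernel_def dim_D)
    then have "vec (rk i) (Dop i (Dop (Suc i) x)) = 0\<^sub>v (rk i)"
      using i by (simp add: D_mult_vec)
    then have "Dop i (Dop (Suc i) x) j = 0" if "j < rk i" for j
      using that by (metis index_vec index_zero_vec(1))
    moreover have "Dop i (Dop (Suc i) x) j = 0" if "\<not> j < rk i" for j
      using that by (simp add: Dop_def)
    ultimately show ?thesis by (auto simp: fun_eq_iff)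
  qed
  show "\<exists>y\<in>F (Suc (Suc i)) d. Dop (Suc i) y = x"
    if i: "Suc i < n" and x: "x \<in> F (Suc i) d" "Dop i x = 0" for i x d
  proof -
    have "vec (rk (Suc i)) x \<in> map_image n (D (Suc (Suc i)))"
      using Dop_eq_zero_kernel[OF _ x] i kernel_eq_image[OF i] by simp
    then obtain w where "w \<in> free_module n (rk (Suc (Suc i)))"
      "vec (rk (Suc i)) x = D (Suc (Suc i)) *\<^sub>v w"
      using i by (auto simp: map_image_def dim_D)
    then show ?thesis
      using hom_lift[OF i _ x(1), of w] by (metis index_vec)
  qed
  show "x = 0" if x: "x \<in> F n d" "Dop (n - 1) x = 0" for x d
  proof -
    have n: "Suc (n - 1) = n" using n_ge_2 by simp
    have "vec (rk n) x \<in> map_kernel n (D n)"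
      using Dop_eq_zero_kernel[of "n - 1" x d] x n_ge_2 unfolding n by simp
    then have "vec (rk n) x = 0\<^sub>v (rk n)"
      using res by (simp add: minimal_graded_free_resolution_def)
    then have "x j = 0" if "j < rk n" for j
      using that by (metis index_vec index_zero_vec(1))
    then show ?thesis using FD(2)[OF x(1)] by (metis ext linorder_not_less zero_fun_apply)
  qed
  show "\<exists>e\<in>cochains n (Suc (Suc p)) (F i) d. koszul_bd n X e = c"
    if "i \<le> n" "c \<in> cochains n (Suc p) (F i) d" "koszul_bd n X c = 0" for i c p d
    by (rule koszul_acyclic_F[OF that(2,3)])
qed

lemma F_0_iff: "v \<in> F 0 d \<longleftrightarrow> v 0 \<in> forms n d \<and> (\<forall>k>0. v k = 0)"
  by (auto simp: F_def a_0)

lemma Z_0_iff: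
  assumes "v \<in> F 0 d" shows "v \<in> Z 0 d \<longleftrightarrow> v 0 \<in> I"
proof
  have I: "(\<lambda>v. v $ 0) ` map_image n (D (Suc 0)) = I"
    using res by (simp add: minimal_graded_free_resolution_def)
  have n0: "0 < n" using n_ge_2 by simp
  have rk0: "rk 0 = 1" by (simp add: a_0)
  {
    assume "v \<in> Z 0 d"
    then obtain y where y: "y \<in> F (Suc 0) d" "v = Dop 0 y" by (auto simp: Z_def)
    have "D (Suc 0) *\<^sub>v vec (rk (Suc 0)) y \<in> map_image n (D (Suc 0))"
      unfolding map_image_def using F_free_module[OF y(1)] n0 by (simp add: dim_D)
    then have "vec 1 v \<in> map_image n (D (Suc 0))"
      using D_mult_vec[OF n0, of y] y(2) by (simp add: rk0)
    then show "v 0 \<in> I" unfolding I[symmetric] by (force simp: image_iff)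
  }
  {
    assume "v 0 \<in> I"
    then obtain w where w: "w \<in> free_module n (rk (Suc 0))" "v 0 = (D (Suc 0) *\<^sub>v w) $ 0"
      unfolding I[symmetric] using n0 by (auto simp: map_image_def dim_D)
    have "\<exists>y\<in>F (Suc 0) d. Dop 0 y = v"
      by (rule hom_lift[OF n0 w(1) assms]) (use w(2) in \<open>simp add: rk0\<close>)
    then show "v \<in> Z 0 d" by (auto simp: Z_def)
  }
qed

section \<open>Tuples and the generators of the last module\<close>

definition socle_tuple :: "int \<Rightarrow> (nat \<Rightarrow> 'a mpoly) \<Rightarrow> bool" where
  "socle_tuple t f \<longleftrightarrow> (\<forall>i\<le>n. f i \<in> forms n t) \<and>
     (\<forall>i\<le>n. \<forall>j\<le>n. var i * f j - var j * f i \<in> I)"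

lemma trivial_tuples_iff:
  "trivial_tuples t \<longleftrightarrow>
    (\<forall>f. socle_tuple t f \<longrightarrow> (\<exists>g\<in>forms n (t - 1). \<forall>i\<le>n. f i - var i * g \<in> I))"
proof
  define emb :: "'a mpoly \<Rightarrow> nat \<Rightarrow> 'a mpoly" where "emb p k = (if k = 0 then p else 0)" for p k
  {
    assume triv: "trivial_tuples t"
    show "\<forall>f. socle_tuple t f \<longrightarrow> (\<exists>g\<in>forms n (t - 1). \<forall>i\<le>n. f i - var i * g \<in> I)"
    proof (intro allI impI)
      fix f assume f: "socle_tuple t f"
      have "X i (emb (f j)) - X j (emb (f i)) \<in> Z 0 (t + 1)" if "i \<le> n" "j \<le> n" for i j
      proof -
        have "X i (emb (f j)) - X j (emb (f i)) \<in> F 0 (t + 1)"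
          using f that by (auto simp: F_0_iff X_def emb_def socle_tuple_def
              intro!: forms_diff forms_var_mult)
        then show ?thesis
          using f that by (simp add: Z_0_iff X_def emb_def socle_tuple_def)
      qed
      moreover have "emb (f i) \<in> F 0 t" if "i \<le> n" for i
        using f that by (auto simp: F_0_iff emb_def socle_tuple_def)
      ultimately obtain g where g: "g \<in> F 0 (t - 1)" "\<And>i. i \<le> n \<Longrightarrow> emb (f i) - X i g \<in> Z 0 t"
        using triv[unfolded trivial_tuples_def, rule_format, of "\<lambda>i. emb (f i)"] by blast
      have "f i - var i * g 0 \<in> I" if "i \<le> n" for i
        using g(2)[OF that] Z_0_iff[OF Z_subset_F[OF _ g(2)[OF that]]] n_ge_2
        by (simp add: emb_def X_def)
      then show "\<exists>g\<in>forms n (t - 1). \<forall>i\<le>n. f i - var i * g \<in> I"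
        using g(1) by (auto simp: F_0_iff)
    qed
  }
  {
    assume triv: "\<forall>f. socle_tuple t f \<longrightarrow> (\<exists>g\<in>forms n (t - 1). \<forall>i\<le>n. f i - var i * g \<in> I)"
    show "trivial_tuples t"
      unfolding trivial_tuples_def
    proof (intro allI impI)
      fix f assume f: "(\<forall>i\<le>n. f i \<in> F 0 t) \<and> (\<forall>i\<le>n. \<forall>j\<le>n. X i (f j) - X j (f i) \<in> Z 0 (t + 1))"
      have "var i * f j 0 - var j * f i 0 \<in> I" if "i \<le> n" "j \<le> n" for i j
      proof -
        have *: "X i (f j) - X j (f i) \<in> Z 0 (t + 1)" using f that by blast
        then show ?thesis using Z_0_iff[OF Z_subset_F[OF _ *]] n_ge_2 by (simp add: X_def)
      qed
      then have "socle_tuple t (\<lambda>i. f i 0)"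
        using f by (auto simp: socle_tuple_def F_0_iff)
      then obtain g where g: "g \<in> forms n (t - 1)" "\<And>i. i \<le> n \<Longrightarrow> f i 0 - var i * g \<in> I"
        using triv by blast
      have "f i - X i (emb g) \<in> Z 0 t" if "i \<le> n" for i
      proof -
        have "f i - X i (emb g) \<in> F 0 t"
          using f that g(1) forms_var_mult[OF that g(1)] by (auto simp: F_0_iff X_def emb_def intro!: forms_diff)
        then show ?thesis using g(2)[OF that] by (simp add: Z_0_iff X_def emb_def)
      qed
      moreover have "emb g \<in> F 0 (t - 1)" using g(1) by (simp add: F_0_iff emb_def)
      ultimately show "\<exists>g\<in>F 0 (t - 1). \<forall>i\<le>n. f i - X i g \<in> Z 0 t" by blast
    qed
  }
qed

text \<open>If all generators of \<open>F n\<close> had degree above t + n, then \<open>F n\<close>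
  would be zero in degree t + n and every tuple of degree t trivial. An inequality is enough to
  bound the least degree of a generator from above.\<close>

lemma degree_le_of_socle_tuple:
  assumes "socle_tuple t f" and "\<not> (\<exists>g\<in>forms n (t - 1). \<forall>i\<le>n. f i - var i * g \<in> I)"
  shows "\<exists>x\<in>set (a n). x \<le> t + int n"
proof (rule ccontr)
  assume "\<not> (\<exists>x\<in>set (a n). x \<le> t + int n)"
  then have "t + int n - a n ! k < 0" if "k < rk n" for k
    using nth_mem[OF that] by force
  then have "v = 0" if "v \<in> F n (t + int n)" for v
    using FD[OF that] forms_neg by (metis ext linorder_not_less zero_fun_apply)
  then have "F n (t + int n) = {0}" using F_zero by blast
  then have "trivial_tuples t" by (rule trivial_tuples_of_top_acyclic[OF top_acyclicI])
  then show False using assms by (auto simp: trivial_tuples_iff)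
qed

text \<open>Otherwise the basis vector of degree \<open>x\<close> would be a combination of
  multiples of the variables, although one of its entries is the constant 1. The vanishing constant
  terms of the last matrix enter here.\<close>

lemma socle_tuple_of_degree:
  assumes "x \<in> set (a n)"
  shows "\<exists>f. socle_tuple (x - int n) f \<and>
    \<not> (\<exists>g\<in>forms n (x - int n - 1). \<forall>i\<le>n. f i - var i * g \<in> I)"
proof (rule ccontr)
  assume "\<not> ?thesis"
  then have "trivial_tuples (x - int n)" by (auto simp: trivial_tuples_iff)
  then have top: "top_acyclic x" using top_acyclic_of_trivial_tuples by force
  obtain k where k: "k < rk n" "a n ! k = x" using assms by (auto simp: in_set_conv_nth)
  define v where "v i = (if i = k then 1 else 0 :: 'a mpoly)" for i
  have "(1 :: 'a mpoly) \<in> forms n 0" using forms_const[of 1 n] by simp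
  then have v: "v \<in> F n x" using k by (intro FI) (auto simp: v_def)
  have n: "Suc (n - 1) = n" using n_ge_2 by simp
  have "\<exists>b. (\<forall>j\<le>n. b j \<in> F (n - 1) (x - 1)) \<and> Dop (n - 1) y = (\<Sum>j\<le>n. X j (b j))"
    if y: "y \<in> F n x" for y
  proof -
    have Dy: "Dop (n - 1) y \<in> F (n - 1) x" using Dop_F[of "n - 1" y x] y n_ge_2 by (simp add: n)
    have "\<exists>b. (\<forall>i\<le>n. b i \<in> forms n (x - a (n - 1) ! j - 1)) \<and>
        Dop (n - 1) y j = (\<Sum>i\<le>n. var i * b i)" if j: "j < rk (n - 1)" for j
    proof (rule irrelevant_ideal)
      show "Dop (n - 1) y j \<in> forms n (x - a (n - 1) ! j)" by (rule FD(1)[OF Dy j])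
      have "lookup (D n $$ (j, k) * y k) 0 = 0" if "k < rk n" for k
        using D_entry(2)[of "n - 1" j k] that j n_ge_2 by (intro lookup_mult_zero) (simp add: n)
      then show "lookup (Dop (n - 1) y j) 0 = 0"
        using j unfolding Dop_def n by (simp add: lookup_sum)
    qed
    then have "\<forall>j. \<exists>b. j < rk (n - 1) \<longrightarrow> (\<forall>i\<le>n. b i \<in> forms n (x - a (n - 1) ! j - 1)) \<and>
        Dop (n - 1) y j = (\<Sum>i\<le>n. var i * b i)" by blast
    from choice[OF this] obtain b
      where b: "\<And>i j. j < rk (n - 1) \<Longrightarrow> i \<le> n \<Longrightarrow> b j i \<in> forms n (x - a (n - 1) ! j - 1)"
        "\<And>j. j < rk (n - 1) \<Longrightarrow> Dop (n - 1) y j = (\<Sum>i\<le>n. var i * b j i)" by blast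
    define b' where "b' i j = (if j < rk (n - 1) then b j i else 0)" for i j
    have "b' i \<in> F (n - 1) (x - 1)" if "i \<le> n" for i
      using b(1)[OF _ that] by (intro FI) (auto simp: b'_def algebra_simps)
    moreover have "Dop (n - 1) y = (\<Sum>i\<le>n. X i (b' i))"
    proof
      fix j
      show "Dop (n - 1) y j = (\<Sum>i\<le>n. X i (b' i)) j"
        using b(2)[of j] FD(2)[OF Dy, of j]
        by (cases "j < rk (n - 1)") (simp_all add: sum_fun_apply X_def b'_def)
    qed
    ultimately show ?thesis by blast
  qed
  then obtain b where "v = (\<Sum>j\<le>n. X j (b j))"
    using top_acyclic_imp_generated[OF top _ v] by blast
  then have "v k = (\<Sum>j\<le>n. var j * b j k)" by (simp add: sum_fun_apply X_def)
  then have "lookup (v k) 0 = (\<Sum>j\<le>n. lookup (var j * b j k) 0)" by (simp add: lookup_sum)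
  also have "\<dots> = 0" by (simp add: lookup_var_mult)
  finally show False by (simp add: v_def lookup_one)
qed

end

section \<open>Evaluation of forms\<close>

definition mon_eval :: "(nat \<Rightarrow>\<^sub>0 nat) \<Rightarrow> (nat \<Rightarrow>\<^sub>0 'a::field) \<Rightarrow> 'a" where
  "mon_eval m v = (\<Prod>i\<in>keys m. lookup v i ^ lookup m i)"

lemma poly_eval_eq: "poly_eval p v = (\<Sum>m\<in>keys p. lookup p m * mon_eval m v)"
  by (simp add: poly_eval_def mon_eval_def)

lemma mon_eval_eq_prod: "finite S \<Longrightarrow> keys m \<subseteq> S \<Longrightarrow> mon_eval m v = (\<Prod>i\<in>S. lookup v i ^ lookup m i)"
  unfolding mon_eval_def by (intro prod.mono_neutral_left) (auto simp: in_keys_iff)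

lemma mon_eval_add: "mon_eval (m + k) v = mon_eval m v * mon_eval k v"
proof -
  have *: "mon_eval l v = (\<Prod>i\<in>keys m \<union> keys k. lookup v i ^ lookup l i)"
    if "keys l \<subseteq> keys m \<union> keys k" for l
    by (rule mon_eval_eq_prod) (use that in auto)
  show ?thesis
    using *[of m] *[of k] *[of "m + k"]
    by (simp add: keys_add_nat lookup_add power_add prod.distrib)
qed

lemma mon_eval_zero [simp]: "mon_eval 0 v = 1"
  by (simp add: mon_eval_def)

lemma mon_eval_single [simp]: "mon_eval (single j 1) v = lookup v j"
  by (simp add: mon_eval_def)

lemma poly_eval_eq_sum:
  "finite S \<Longrightarrow> keys p \<subseteq> S \<Longrightarrow> poly_eval p v = (\<Sum>m\<in>S. lookup p m * mon_eval m v)"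
  unfolding poly_eval_eq by (intro sum.mono_neutral_left) (auto simp: in_keys_iff)

lemma poly_eval_add [simp]: "poly_eval (p + q) v = poly_eval p v + poly_eval q v"
proof -
  have *: "poly_eval r v = (\<Sum>m\<in>keys p \<union> keys q. lookup r m * mon_eval m v)"
    if "keys r \<subseteq> keys p \<union> keys q" for r
    by (rule poly_eval_eq_sum) (use that in auto)
  show ?thesis
    using *[of p] *[of q] *[OF Poly_Mapping.keys_add]
    by (simp add: lookup_add distrib_right sum.distrib)
qed

lemma poly_eval_zero [simp]: "poly_eval 0 v = 0"
  by (simp add: poly_eval_def)

lemma poly_eval_sum [simp]: "poly_eval (sum f S) v = (\<Sum>i\<in>S. poly_eval (f i) v)"
  by (induction S rule: infinite_finite_induct) simp_all

lemma poly_eval_single: "poly_eval (single m c) v = c * mon_eval m v"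
  by (cases "c = 0") (simp_all add: poly_eval_eq)

lemma poly_eval_one [simp]: "poly_eval 1 v = 1"
  using poly_eval_single[of 0 1 v] by simp

lemma poly_mapping_sum_single: "p = (\<Sum>m\<in>keys p. single m (lookup p m))"
proof (rule poly_mapping_eqI)
  fix k
  show "lookup p k = lookup (\<Sum>m\<in>keys p. single m (lookup p m)) k"
    by (simp add: lookup_sum lookup_single when_def in_keys_iff)
qed

lemma poly_eval_mult [simp]: "poly_eval (p * q) v = poly_eval p v * poly_eval q v"
proof -
  have "p * q = (\<Sum>m\<in>keys p. single m (lookup p m)) * (\<Sum>k\<in>keys q. single k (lookup q k))"
    by (simp flip: poly_mapping_sum_single)
  also have "\<dots> = (\<Sum>m\<in>keys p. \<Sum>k\<in>keys q. single (m + k) (lookup p m * lookup q k))"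
    by (simp add: sum_product mult_single)
  finally have "poly_eval (p * q) v =
      (\<Sum>m\<in>keys p. \<Sum>k\<in>keys q. lookup p m * lookup q k * mon_eval (m + k) v)"
    by (simp only: poly_eval_sum poly_eval_single)
  then show ?thesis
    by (simp add: mon_eval_add poly_eval_eq[of p] poly_eval_eq[of q] sum_product ac_simps)
qed

lemma poly_eval_scale [simp]: "poly_eval (pm_scale c p) v = c * poly_eval p v"
  by (simp add: pm_scale_eq_mult poly_eval_single)

lemma poly_eval_uminus [simp]: "poly_eval (- p) v = - poly_eval p v"
  by (simp add: poly_eval_eq sum_negf)

lemma poly_eval_diff [simp]: "poly_eval (p - q) v = poly_eval p v - poly_eval q v"
  using poly_eval_add[of p "- q" v] by simp

lemma poly_eval_var [simp]: "poly_eval (var j) v = lookup v j"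
  by (simp add: var_def poly_eval_single del: One_nat_def)

section \<open>Substitution, division and restriction of forms\<close>

text \<open>Constants, sums within one degree and products with variables reach every form, so
  identities between values can be proved without handling monomials. The zero form has its own case
  because it lies in every degree.\<close>

lemma forms_induct [consumes 1, case_names zero const add var]:
  assumes p: "p \<in> forms n e"
    and zero: "\<And>e. Q e 0"
    and const: "\<And>c. Q 0 (single 0 c)"
    and add: "\<And>e p q. p \<in> forms n e \<Longrightarrow> q \<in> forms n e \<Longrightarrow> Q e p \<Longrightarrow> Q e q \<Longrightarrow> Q e (p + q)"
    and var: "\<And>e j p. j \<le> n \<Longrightarrow> p \<in> forms n e \<Longrightarrow> Q e p \<Longrightarrow> Q (e + 1) (var j * p)"
  shows "Q e p"
proof -
  have mon: "Q (int (total_deg m)) (single m c)" if "keys m \<subseteq> {..n}" for m c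
    using that
  proof (induction "total_deg m" arbitrary: m)
    case 0
    then have "m = 0" by (auto simp: total_deg_def in_keys_iff poly_mapping_eq_iff fun_eq_iff)
    then show ?case using const by simp
  next
    case (Suc k)
    then have "m \<noteq> 0" by auto
    then obtain j where j: "lookup m j \<noteq> 0" by (auto simp: poly_mapping_eq_iff fun_eq_iff)
    define m' where "m' = m - single j 1"
    have m: "m = single j 1 + m'" using single_add_minus[OF j] by (simp add: m'_def)
    have m': "k = total_deg m'" "keys m' \<subseteq> {..n}" "j \<le> n"
      using Suc.hyps(2) Suc.prems by (simp_all add: m keys_add_nat)
    have "single m' c \<in> forms n (int (total_deg m'))"
      using m' by (auto simp: forms_iff)
    from var[OF m'(3) this Suc.hyps(1)[OF m'(1,2)]]
    have "Q (int (total_deg m') + 1) (var j * single m' c)" .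
    then show ?case by (simp add: m var_def mult_single ac_simps del: One_nat_def)
  qed
  have "S \<subseteq> keys p \<Longrightarrow> (\<Sum>m\<in>S. single m (lookup p m)) \<in> forms n e \<and>
      Q e (\<Sum>m\<in>S. single m (lookup p m))" if "finite S" for S
    using that
  proof (induction S)
    case empty
    then show ?case using zero by simp
  next
    case (insert m S)
    have "keys m \<subseteq> {..n}" "int (total_deg m) = e" using insert.prems p by (auto simp: forms_iff)
    then have "single m (lookup p m) \<in> forms n e" "Q e (single m (lookup p m))"
      using mon[of m "lookup p m"] by (auto simp: forms_iff)
    then show ?case using insert by (simp add: add forms_add)
  qed
  from this[of "keys p"] show ?thesis by (simp flip: poly_mapping_sum_single)
qed

definition linear_form :: "nat \<Rightarrow> (nat \<Rightarrow> 'a::field) \<Rightarrow> 'a mpoly" where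
  "linear_form n c = (\<Sum>i\<le>n. pm_scale (c i) (var i))"

lemma linear_form_forms: "linear_form n c \<in> forms n 1"
  unfolding linear_form_def by (intro forms_sum forms_scale forms_var) simp

lemma poly_eval_linear_form [simp]: "poly_eval (linear_form n c) v = (\<Sum>i\<le>n. c i * lookup v i)"
  by (simp add: linear_form_def)

text \<open>Substitution of linear forms for the variables. The result is described through its
  values, which is how it is used at points.\<close>

lemma forms_substitute:
  assumes "p \<in> forms n e"
    and T: "\<And>i v. i \<le> n \<Longrightarrow> lookup (T v) i = (\<Sum>k\<le>m. c i k * lookup v k)"
  shows "\<exists>q\<in>forms m e. \<forall>v. poly_eval q v = poly_eval p (T v)"
  using assms(1)
proof (induction rule: forms_induct)
  case (zero e)
  then show ?case by (intro bexI[of _ 0]) auto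
next
  case (const c)
  then show ?case
    by (intro bexI[of _ "single 0 c"]) (auto simp: poly_eval_single forms_const)
next
  case (add e p q)
  then obtain p' q' where "p' \<in> forms m e" "\<And>v. poly_eval p' v = poly_eval p (T v)"
    "q' \<in> forms m e" "\<And>v. poly_eval q' v = poly_eval q (T v)" by blast
  then show ?case by (intro bexI[of _ "p' + q'"]) (auto intro: forms_add)
next
  case (var e j p)
  then obtain p' where "p' \<in> forms m e" "\<And>v. poly_eval p' v = poly_eval p (T v)" by blast
  then show ?case
    using T[OF var(1)] forms_mult[OF linear_form_forms[of m "c j"], of p' e]
    by (intro bexI[of _ "linear_form m (c j) * p'"]) (auto simp: add.commute)
qed

lemma forms_homogeneous:
  assumes "p \<in> forms n e"
  shows "poly_eval p (pm_scale c v) = c ^ nat e * poly_eval p v"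
  using assms
proof (induction rule: forms_induct)
  case (var e j p)
  show ?case
  proof (cases "e < 0")
    case True
    then have "p = 0" using forms_neg var by blast
    then show ?thesis by simp
  next
    case False
    then have "nat (e + 1) = Suc (nat e)" by simp
    then show ?thesis using var by simp
  qed
qed (auto simp: poly_eval_single algebra_simps)

text \<open>The remainder \<open>p \<circ> T\<close> is the cone over the restriction of \<open>p\<close> to the hyperplane \<open>h = 0\<close>.\<close>

lemma forms_divide:
  assumes "p \<in> forms n e"
    and T: "\<And>i v. i \<le> n \<Longrightarrow> lookup (T v) i = (\<Sum>k\<le>n. c i k * lookup v k)"
    and Th: "\<And>v i. i \<le> n \<Longrightarrow> v \<in> coord_vecs n \<Longrightarrow> lookup v i = lookup (T v) i + h v * lookup u i"
  shows "\<exists>g\<in>forms n (e - 1). \<forall>v\<in>coord_vecs n. poly_eval p v = poly_eval p (T v) + h v * poly_eval g v"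
  using assms(1)
proof (induction rule: forms_induct)
  case (zero e)
  then show ?case by (intro bexI[of _ 0]) auto
next
  case (const c)
  then show ?case by (intro bexI[of _ 0]) (auto simp: poly_eval_single)
next
  case (add e p q)
  then obtain p' q' where "p' \<in> forms n (e - 1)" "q' \<in> forms n (e - 1)"
    "\<And>v. v \<in> coord_vecs n \<Longrightarrow> poly_eval p v = poly_eval p (T v) + h v * poly_eval p' v"
    "\<And>v. v \<in> coord_vecs n \<Longrightarrow> poly_eval q v = poly_eval q (T v) + h v * poly_eval q' v" by blast
  then show ?case by (intro bexI[of _ "p' + q'"]) (auto intro: forms_add simp: algebra_simps)
next
  case (var e j p)
  then obtain g where g: "g \<in> forms n (e - 1)"
    "\<And>v. v \<in> coord_vecs n \<Longrightarrow> poly_eval p v = poly_eval p (T v) + h v * poly_eval g v" by blast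
  obtain q where q: "q \<in> forms n e" "\<And>v. poly_eval q v = poly_eval p (T v)"
    using forms_substitute[OF var(2) T] by blast
  \<comment> \<open>Product rule: \<open>x_j p\<close> minus its value at \<open>T v\<close> is
    \<open>x_j\<close> times the corresponding difference for \<open>p\<close>, plus
    \<open>p (T v)\<close> times the difference of the two j-th coordinates, which is
    \<open>h v * lookup u j\<close>.\<close>
  have "var j * g + pm_scale (lookup u j) q \<in> forms n (e + 1 - 1)"
    using forms_var_mult[OF var(1) g(1)] forms_scale[OF q(1)] by (simp add: forms_add)
  moreover have "poly_eval (var j * p) v =
      poly_eval (var j * p) (T v) + h v * poly_eval (var j * g + pm_scale (lookup u j) q) v"
    if "v \<in> coord_vecs n" for v
    using Th[OF var(1) that] g(2)[OF that] q(2)[of v] by (simp add: algebra_simps)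
  ultimately show ?case by blast
qed

lemma forms_restrict_line:
  assumes "p \<in> forms n e"
  shows "\<exists>r. Polynomial.degree r \<le> nat e \<and> (\<forall>a. poly r a = poly_eval p (pm_scale a q + u))"
  using assms
proof (induction rule: forms_induct)
  case (zero e)
  then show ?case by (intro exI[of _ 0]) auto
next
  case (const c)
  then show ?case by (intro exI[of _ "[:c:]"]) (auto simp: poly_eval_single)
next
  case (add e p p')
  then obtain r r' where "Polynomial.degree r \<le> nat e" "Polynomial.degree r' \<le> nat e"
    "\<And>a. poly r a = poly_eval p (pm_scale a q + u)"
    "\<And>a. poly r' a = poly_eval p' (pm_scale a q + u)" by blast
  then show ?case by (intro exI[of _ "r + r'"]) (auto intro: degree_add_le)
next
  case (var e j p)
  show ?case
  proof (cases "e < 0")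
    case True
    then have "p = 0" using forms_neg var by blast
    then show ?thesis by (intro exI[of _ 0]) auto
  next
    case False
    obtain r where r: "Polynomial.degree r \<le> nat e"
      "\<And>a. poly r a = poly_eval p (pm_scale a q + u)" using var by blast
    have "Polynomial.degree ([:lookup u j, lookup q j:] * r) \<le> 1 + nat e"
      by (rule order.trans[OF degree_mult_le]) (use r(1) in \<open>simp add: add_mono\<close>)
    then have "Polynomial.degree ([:lookup u j, lookup q j:] * r) \<le> nat (e + 1)"
      using False by simp
    moreover have "poly ([:lookup u j, lookup q j:] * r) a = poly_eval (var j * p) (pm_scale a q + u)" for a
      by (simp add: r(2) lookup_add algebra_simps)
    ultimately show ?thesis by blast
  qed
qed

text \<open>More zeros than the degree permits make the restriction to the affine line zero, and
  homogeneity extends this to all nonzero \<open>b\<close>. At b = 0 the form, as a polynomial in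
  \<open>b\<close>, already has every nonzero scalar as a root, and the field is infinite.\<close>

lemma forms_vanish_on_line:
  fixes q u :: "nat \<Rightarrow>\<^sub>0 'a::field_char_0"
  assumes p: "p \<in> forms n e" and A: "finite A" "e < int (card A)"
    and van: "\<And>a. a \<in> A \<Longrightarrow> poly_eval p (pm_scale a q + u) = 0"
  shows "poly_eval p (pm_scale a q + pm_scale b u) = 0"
proof (cases "e < 0")
  case True
  then show ?thesis using forms_neg p by fastforce
next
  case False
  obtain r where r: "Polynomial.degree r \<le> nat e" "\<And>a. poly r a = poly_eval p (pm_scale a q + u)"
    using forms_restrict_line[OF p] by blast
  have "r = 0"
  proof (rule ccontr)
    assume "r \<noteq> 0"
    then have roots: "card {a. poly r a = 0} \<le> Polynomial.degree r" "finite {a. poly r a = 0}"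
      by (rule card_poly_roots_bound, rule poly_roots_finite)
    have "A \<subseteq> {a. poly r a = 0}" using van r(2) by auto
    then have "card A \<le> card {a. poly r a = 0}" by (rule card_mono[OF roots(2)])
    then have "card A \<le> nat e" using roots(1) r(1) by linarith
    then show False using A(2) False by linarith
  qed
  then have 1: "poly_eval p (pm_scale a q + u) = 0" for a using r(2)[of a] by simp
  have 2: "poly_eval p (pm_scale a q + pm_scale b u) = 0" if "b \<noteq> 0" for a b
  proof -
    have "pm_scale a q + pm_scale b u = pm_scale b (pm_scale (a / b) q + u)"
      using that by (simp add: pm.scale_right_distrib)
    then show ?thesis using forms_homogeneous[OF p] 1 by simp
  qed
  obtain s where s: "\<And>b. poly s b = poly_eval p (pm_scale b u + pm_scale a q)"
    using forms_restrict_line[OF p] by blast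
  have "s = 0"
  proof (rule ccontr)
    assume "s \<noteq> 0"
    then have "finite {b. poly s b = 0}" by (rule poly_roots_finite)
    moreover have "- {0} \<subseteq> {b. poly s b = 0}" using s 2[of _ a] by (auto simp: add.commute)
    ultimately have "finite (- {0 :: 'a})" using finite_subset by blast
    then show False using infinite_UNIV_char_0[where 'a = 'a]
      by (metis Compl_eq_Diff_UNIV finite.emptyI finite_Diff2 finite_insert)
  qed
  then show ?thesis using s[of b] by (simp add: add.commute)
qed

section \<open>Points in a hyperplane and on a line\<close>

lemma coord_vecs_iff: "v \<in> coord_vecs n \<longleftrightarrow> (\<forall>i>n. lookup v i = 0)"
  by (auto simp: coord_vecs_def in_keys_iff subset_iff) (metis not_le)+

lemma coord_vecs_nonzero:
  assumes "v \<in> coord_vecs n" "v \<noteq> 0" obtains i where "i \<le> n" "lookup v i \<noteq> 0"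
  using assms by (metis coord_vecs_iff lookup_zero not_le poly_mapping_eqI)

lemma coord_vecs_add: "v \<in> coord_vecs n \<Longrightarrow> w \<in> coord_vecs n \<Longrightarrow> v + w \<in> coord_vecs n"
  by (simp add: coord_vecs_iff lookup_add)

lemma coord_vecs_scale: "v \<in> coord_vecs n \<Longrightarrow> pm_scale c v \<in> coord_vecs n"
  by (simp add: coord_vecs_iff)

lemma coord_vecs_sum: "(\<And>i. i \<in> S \<Longrightarrow> f i \<in> coord_vecs n) \<Longrightarrow> sum f S \<in> coord_vecs n"
  by (simp add: coord_vecs_iff lookup_sum)

text \<open>
  The map \<open>\<phi>\<close> parametrises the hyperplane, whose equation is \<open>h\<close>, and \<open>\<pi>\<close> is the projection to it
  from the point \<open>u\<close>. The line through \<open>u\<close> meets the hyperplane in \<open>\<phi> q\<close>. Its other points are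
  represented by \<open>a \<cdot> \<phi> q + u\<close>, with \<open>a \<in> A\<close> for those of the set of interest.
\<close>

locale points_in_hyperplane_and_line =
  fixes N :: nat
    and \<phi> \<pi> :: "(nat \<Rightarrow>\<^sub>0 'a::field_char_0) \<Rightarrow> (nat \<Rightarrow>\<^sub>0 'a)" and h :: "(nat \<Rightarrow>\<^sub>0 'a) \<Rightarrow> 'a"
    and c p :: "nat \<Rightarrow> (nat \<Rightarrow>\<^sub>0 'a)" and H :: "nat \<Rightarrow> 'a" and u q :: "nat \<Rightarrow>\<^sub>0 'a"
    and Y :: "(nat \<Rightarrow>\<^sub>0 'a) set" and A :: "'a set"
  assumes N_pos: "1 \<le> N"
    and \<phi>_eq: "\<And>y. \<phi> y = (\<Sum>k\<le>N. pm_scale (lookup y k) (c k))"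
    and \<pi>_eq: "\<And>x. \<pi> x = (\<Sum>i\<le>Suc N. pm_scale (lookup x i) (p i))"
    and h_eq: "\<And>x. h x = (\<Sum>i\<le>Suc N. H i * lookup x i)"
    and c_coord: "\<And>k. k \<le> N \<Longrightarrow> c k \<in> coord_vecs (Suc N)"
    and p_coord: "\<And>i. i \<le> Suc N \<Longrightarrow> p i \<in> coord_vecs N"
    and u_coord: "u \<in> coord_vecs (Suc N)"
    and q_coord: "q \<in> coord_vecs N" and q_nonzero: "q \<noteq> 0"
    and decomposition: "\<And>x. x \<in> coord_vecs (Suc N) \<Longrightarrow> x = \<phi> (\<pi> x) + pm_scale (h x) u"
    and \<pi>_\<phi>: "\<And>y. y \<in> coord_vecs N \<Longrightarrow> \<pi> (\<phi> y) = y"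
    and h_\<phi>: "\<And>y. y \<in> coord_vecs N \<Longrightarrow> h (\<phi> y) = 0"
    and \<pi>_u: "\<pi> u = 0" and h_u: "h u = 1"
    and Y_coord: "Y \<subseteq> coord_vecs N" and Y_nonzero: "0 \<notin> Y"
    and finite_A: "finite A" and A_nonempty: "A \<noteq> {}"
begin

abbreviation "n \<equiv> Suc N"

lemma \<pi>_add: "\<pi> (x + y) = \<pi> x + \<pi> y"
  by (simp add: \<pi>_eq lookup_add pm.scale_left_distrib sum.distrib)

lemma \<pi>_scale: "\<pi> (pm_scale a x) = pm_scale a (\<pi> x)"
  by (simp add: \<pi>_eq pm.scale_sum_right pm.scale_right_distrib)

lemma h_add: "h (x + y) = h x + h y"
  by (simp add: h_eq lookup_add algebra_simps sum.distrib)

lemma h_scale: "h (pm_scale a x) = a * h x"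
  by (simp add: h_eq algebra_simps sum_distrib_left)

lemma lookup_\<phi>: "lookup (\<phi> y) i = (\<Sum>k\<le>N. lookup (c k) i * lookup y k)"
  by (simp add: \<phi>_eq lookup_sum mult.commute)

lemma lookup_\<pi>: "lookup (\<pi> x) k = (\<Sum>i\<le>n. lookup (p i) k * lookup x i)"
  unfolding \<pi>_eq lookup_sum lookup_pm_scale by (intro sum.cong refl mult.commute)

lemma \<phi>_coord: "\<phi> y \<in> coord_vecs n"
  unfolding \<phi>_eq by (intro coord_vecs_sum coord_vecs_scale c_coord) simp

lemma \<pi>_coord: "\<pi> x \<in> coord_vecs N"
  unfolding \<pi>_eq by (intro coord_vecs_sum coord_vecs_scale p_coord) simp

lemma \<phi>_inj: "x \<in> coord_vecs N \<Longrightarrow> y \<in> coord_vecs N \<Longrightarrow> \<phi> x = \<phi> y \<Longrightarrow> x = y"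
  using \<pi>_\<phi> by metis

definition line_point :: "'a \<Rightarrow> (nat \<Rightarrow>\<^sub>0 'a)" where
  "line_point a = pm_scale a (\<phi> q) + u"

lemma \<pi>_line_point: "\<pi> (line_point a) = pm_scale a q"
  by (simp add: line_point_def \<pi>_add \<pi>_scale \<pi>_\<phi> q_coord \<pi>_u)

lemma h_line_point: "h (line_point a) = 1"
  by (simp add: line_point_def h_add h_scale h_\<phi> q_coord h_u)

lemma line_point_coord: "line_point a \<in> coord_vecs n"
  unfolding line_point_def by (intro coord_vecs_add coord_vecs_scale \<phi>_coord u_coord)

lemma line_point_inj: "line_point a = line_point b \<longleftrightarrow> a = b"
proof
  assume "line_point a = line_point b"
  then have "pm_scale a q = pm_scale b q" by (metis \<pi>_line_point)
  then show "a = b" using q_nonzero by simp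
qed simp

lemma line_point_neq_\<phi>: "y \<in> coord_vecs N \<Longrightarrow> line_point a \<noteq> \<phi> y"
  using h_line_point h_\<phi> by (metis zero_neq_one)

definition W :: "(nat \<Rightarrow>\<^sub>0 'a) set" where
  "W = \<phi> ` Y \<union> line_point ` A"

definition vanishes :: "'a mpoly \<Rightarrow> bool" where
  "vanishes f \<longleftrightarrow> (\<forall>w\<in>W. poly_eval f w = 0)"

lemma W_coord: "w \<in> W \<Longrightarrow> w \<in> coord_vecs n"
  unfolding W_def using \<phi>_coord line_point_coord by blast

lemma W_nonzero: "w \<in> W \<Longrightarrow> w \<noteq> 0"
proof
  assume "w \<in> W" "w = 0"
  moreover have "\<phi> y \<noteq> 0" if "y \<in> Y" for y
  proof
    assume "\<phi> y = 0"
    moreover have "\<phi> 0 = 0" by (simp add: \<phi>_eq)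
    moreover have "0 \<in> coord_vecs N" by (simp add: coord_vecs_iff)
    ultimately have "y = 0" using \<phi>_inj that Y_coord by (metis subsetD)
    then show False using that Y_nonzero by blast
  qed
  moreover have "line_point a \<noteq> 0" for a
    using h_line_point[of a] by (auto simp: h_eq)
  ultimately show False unfolding W_def by auto
qed

definition nontrivial_tuple :: "int \<Rightarrow> (nat \<Rightarrow> 'a mpoly) \<Rightarrow> bool" where
  "nontrivial_tuple t f \<longleftrightarrow> (\<forall>i\<le>n. f i \<in> forms n t) \<and>
     (\<forall>i\<le>n. \<forall>j\<le>n. vanishes (var i * f j - var j * f i)) \<and>
     \<not> (\<exists>g\<in>forms n (t - 1). \<forall>i\<le>n. vanishes (f i - var i * g))"

text \<open>A separator of \<open>v\<close> of minimal degree, multiplied by the coordinates of \<open>v\<close>.\<close>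

lemma separator_nontrivial_tuple:
  assumes v: "v \<in> W" and G: "G \<in> forms n t" "poly_eval G v \<noteq> 0"
    and van: "\<And>w. w \<in> W \<Longrightarrow> w \<noteq> v \<Longrightarrow> poly_eval G w = 0"
    and min: "\<And>g. g \<in> forms n (t - 1) \<Longrightarrow> (\<And>w. w \<in> W \<Longrightarrow> w \<noteq> v \<Longrightarrow> poly_eval g w = 0) \<Longrightarrow>
      poly_eval g v = 0"
  shows "\<exists>f. nontrivial_tuple t f"
proof -
  define f where "f i = pm_scale (lookup v i) G" for i
  have "vanishes (var i * f j - var j * f i)" for i j
    unfolding vanishes_def
  proof
    fix w assume "w \<in> W"
    then show "poly_eval (var i * f j - var j * f i) w = 0"
      using van[of w] by (cases "w = v") (simp_all add: f_def)
  qed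
  moreover have "\<not> (\<exists>g\<in>forms n (t - 1). \<forall>i\<le>n. vanishes (f i - var i * g))"
  proof
    assume "\<exists>g\<in>forms n (t - 1). \<forall>i\<le>n. vanishes (f i - var i * g)"
    then obtain g where g: "g \<in> forms n (t - 1)"
      and fg: "\<And>i w. i \<le> n \<Longrightarrow> w \<in> W \<Longrightarrow> lookup v i * poly_eval G w = lookup w i * poly_eval g w"
      by (auto simp: vanishes_def f_def)
    \<comment> \<open>At a point other than \<open>v\<close> the left side of \<open>fg\<close> is
      zero while some coordinate of \<open>w\<close> is not. So \<open>g\<close> vanishes there, and
      minimality applies to it.\<close>
    have "poly_eval g w = 0" if w: "w \<in> W" "w \<noteq> v" for w
    proof -
      obtain i where "i \<le> n" "lookup w i \<noteq> 0"
        using coord_vecs_nonzero[OF W_coord W_nonzero] w(1) by blast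
      then show ?thesis using fg[of i w] van[OF w] w(1) by simp
    qed
    then have "poly_eval g v = 0" by (rule min[OF g])
    moreover obtain i where "i \<le> n" "lookup v i \<noteq> 0"
      using coord_vecs_nonzero[OF W_coord W_nonzero] v by blast
    ultimately show False using fg[of i v] v G(2) by simp
  qed
  ultimately show ?thesis
    using forms_scale[OF G(1)] by (auto simp: nontrivial_tuple_def f_def intro!: exI[of _ f])
qed

lemma vanish_on_line:
  assumes "g \<in> forms n e" "B \<subseteq> A" "e < int (card B)" "\<And>a. a \<in> B \<Longrightarrow> poly_eval g (line_point a) = 0"
  shows "poly_eval g (\<phi> q) = 0" and "poly_eval g (line_point a) = 0"
proof -
  have *: "poly_eval g (pm_scale a (\<phi> q) + pm_scale b u) = 0" for a b
    by (rule forms_vanish_on_line[OF assms(1) finite_subset[OF assms(2) finite_A] assms(3)])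
      (use assms(4) in \<open>simp add: line_point_def\<close>)
  show "poly_eval g (\<phi> q) = 0" using *[of 1 0] by simp
  show "poly_eval g (line_point a) = 0" using *[of a 1] by (simp add: line_point_def)
qed

lemma pullback: "g \<in> forms n e \<Longrightarrow> \<exists>g'\<in>forms N e. \<forall>y. poly_eval g' y = poly_eval g (\<phi> y)"
  by (rule forms_substitute) (auto simp: lookup_\<phi>)

lemma extend: "g \<in> forms N e \<Longrightarrow> \<exists>g'\<in>forms n e. \<forall>x. poly_eval g' x = poly_eval g (\<pi> x)"
  by (rule forms_substitute, assumption, rule lookup_\<pi>)

text \<open>Division with respect to the projection leaves as remainder the cone over the
  restriction to the hyperplane, here zero.\<close>

lemma divide_by_h:
  assumes "g \<in> forms n e" and "\<And>y. y \<in> coord_vecs N \<Longrightarrow> poly_eval g (\<phi> y) = 0"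
  shows "\<exists>g'\<in>forms n (e - 1). \<forall>x\<in>coord_vecs n. poly_eval g x = h x * poly_eval g' x"
proof -
  have "lookup (\<phi> (\<pi> x)) i = (\<Sum>j\<le>n. (\<Sum>k\<le>N. lookup (c k) i * lookup (p j) k) * lookup x j)" for i x
    unfolding lookup_\<phi> lookup_\<pi> sum_distrib_left sum_distrib_right
    by (subst sum.swap) (simp add: mult.assoc)
  moreover have "lookup x i = lookup (\<phi> (\<pi> x)) i + h x * lookup u i" if "x \<in> coord_vecs n" for x i
    using arg_cong[OF decomposition[OF that], of "\<lambda>v. lookup v i"] by (simp add: lookup_add)
  ultimately have "\<exists>g'\<in>forms n (e - 1). \<forall>x\<in>coord_vecs n.
      poly_eval g x = poly_eval g (\<phi> (\<pi> x)) + h x * poly_eval g' x"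
    by (intro forms_divide[OF assms(1)])
  then show ?thesis using assms(2)[OF \<pi>_coord] by simp
qed

text \<open>If \<open>y\<close> and \<open>q\<close> are not proportional, some 2 by 2 minor of
  their coordinates is nonzero; with variables in place of the entries of \<open>y\<close> it is the
  linear form.\<close>

lemma separating_linear_form:
  assumes y: "y \<in> coord_vecs N" and "\<nexists>b. y = pm_scale b q"
  shows "\<exists>l\<in>forms N 1. poly_eval l q = 0 \<and> poly_eval l y \<noteq> 0"
proof -
  obtain j where j: "j \<le> N" "lookup q j \<noteq> 0"
    using coord_vecs_nonzero[OF q_coord q_nonzero] by blast
  have "y \<noteq> pm_scale (lookup y j / lookup q j) q" using assms(2) by blast
  then obtain i where i: "lookup y i \<noteq> lookup y j / lookup q j * lookup q i"
    by (metis lookup_pm_scale poly_mapping_eqI)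
  then have "i \<le> N" using y q_coord by (force simp: coord_vecs_iff not_le[symmetric])
  define l where "l = pm_scale (lookup q j) (var i) - pm_scale (lookup q i) (var j)"
  have "l \<in> forms N 1"
    unfolding l_def by (intro forms_diff forms_scale forms_var \<open>i \<le> N\<close> j(1))
  then show ?thesis using i j(2) by (intro bexI[of _ l]) (auto simp: l_def field_simps)
qed

text \<open>Let \<open>t\<close> be the least degree in which all points of \<open>Y\<close> other
  than the point of \<open>q\<close> have separators that also vanish at \<open>q\<close>. The cone
  with vertex \<open>u\<close> over such a separator vanishes on the line. Some \<open>y\<close> has
  none in degree t - 1, and \<open>\<phi> y\<close> inherits this: a separator of degree t - 1 that
  vanishes at the \<open>card A\<close> points of the line vanishes at \<open>\<phi> q\<close> too,
  so its restriction to the hyperplane would be one for \<open>y\<close>.\<close>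

lemma small_separators_nontrivial_tuple:
  assumes sep: "\<And>y. y \<in> Y \<Longrightarrow> \<exists>E\<in>forms N (int (card A) - 2). poly_eval E y \<noteq> 0 \<and>
      (\<forall>z\<in>Y - {y}. poly_eval E z = 0)"
    and y0: "y0 \<in> Y" "\<nexists>b. y0 = pm_scale b q"
  shows "\<exists>t f. t < int (card A) \<and> nontrivial_tuple t f"
proof -
  define Y' where "Y' = {y \<in> Y. \<nexists>b. y = pm_scale b q}"
  define sep_at where "sep_at y t \<longleftrightarrow> (\<exists>E\<in>forms N (int t). poly_eval E y \<noteq> 0 \<and> poly_eval E q = 0 \<and>
      (\<forall>z\<in>Y - {y}. poly_eval E z = 0))" for y t
  define good where "good t \<longleftrightarrow> (\<forall>y\<in>Y'. sep_at y t)" for t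
  \<comment> \<open>With fewer than two points on the line the separators would be forms of negative
    degree, hence zero.\<close>
  have card2: "2 \<le> card A"
  proof (rule ccontr)
    assume "\<not> 2 \<le> card A"
    then have "int (card A) - 2 < 0" by simp
    then show False using sep[OF y0(1)] forms_neg by fastforce
  qed
  have "good (card A - 1)"
    unfolding good_def
  proof
    fix y assume "y \<in> Y'"
    then have y: "y \<in> Y" "\<nexists>b. y = pm_scale b q" by (auto simp: Y'_def)
    obtain E where E: "E \<in> forms N (int (card A) - 2)" "poly_eval E y \<noteq> 0"
      "\<And>z. z \<in> Y - {y} \<Longrightarrow> poly_eval E z = 0" using sep[OF y(1)] by blast
    \<comment> \<open>The factor \<open>l\<close> enforces the zero at \<open>q\<close> at the price
      of one degree.\<close>
    obtain l where l: "l \<in> forms N 1" "poly_eval l q = 0" "poly_eval l y \<noteq> 0"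
      using separating_linear_form[OF _ y(2)] y(1) Y_coord by blast
    have "l * E \<in> forms N (int (card A - 1))"
      using forms_mult[OF l(1) E(1)] card2 by (simp add: of_nat_diff)
    then show "sep_at y (card A - 1)"
      unfolding sep_at_def using E l by (intro bexI[of _ "l * E"]) auto
  qed
  define t where "t = (LEAST t. good t)"
  have t: "good t" and t_le: "t \<le> card A - 1"
    unfolding t_def using \<open>good (card A - 1)\<close> by (auto intro: LeastI Least_le)
  \<comment> \<open>A form of degree 0 is constant, so it cannot vanish at \<open>q\<close> and not
    at \<open>y0\<close>.\<close>
  have "\<not> good 0"
  proof
    assume "good 0"
    then have "sep_at y0 0" using y0 by (simp add: good_def Y'_def)
    then obtain E where E: "E \<in> forms N 0" "poly_eval E y0 \<noteq> 0" "poly_eval E q = 0"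
      by (auto simp: sep_at_def)
    have "poly_eval E (pm_scale 0 y0) = poly_eval E y0" "poly_eval E (pm_scale 0 q) = poly_eval E q"
      using forms_homogeneous[OF E(1), of 0] by simp_all
    then show False using E(2,3) by simp
  qed
  then have t_pos: "0 < t" using t by (cases t) auto
  then have "\<not> good (t - 1)" using not_less_Least[of "t - 1" good] by (simp add: t_def)
  then obtain y where y: "y \<in> Y" "\<not> sep_at y (t - 1)" and "sep_at y t"
    using t by (auto simp: good_def Y'_def)
  then obtain E where E: "E \<in> forms N (int t)" "poly_eval E y \<noteq> 0" "poly_eval E q = 0"
    "\<And>z. z \<in> Y - {y} \<Longrightarrow> poly_eval E z = 0" by (auto simp: sep_at_def)
  obtain G where G: "G \<in> forms n (int t)" "\<And>x. poly_eval G x = poly_eval E (\<pi> x)"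
    using extend[OF E(1)] by blast
  have yc: "y \<in> coord_vecs N" using y(1) Y_coord by blast
  have "\<exists>f. nontrivial_tuple (int t) f"
  proof (rule separator_nontrivial_tuple[OF _ G(1)])
    show "\<phi> y \<in> W" using y by (simp add: W_def)
    show "poly_eval G (\<phi> y) \<noteq> 0" using E(2) by (simp add: G(2) \<pi>_\<phi> yc)
    show "poly_eval G w = 0" if "w \<in> W" "w \<noteq> \<phi> y" for w
    proof -
      from that(1) consider z where "z \<in> Y" "w = \<phi> z" | a where "w = line_point a"
        by (auto simp: W_def)
      then show ?thesis
      proof cases
        case 1
        then have "z \<in> Y - {y}" using that(2) by auto
        then show ?thesis using E(4) 1 Y_coord by (simp add: G(2) \<pi>_\<phi> subset_iff)
      next
        case 2
        then show ?thesis by (simp add: G(2) \<pi>_line_point forms_homogeneous[OF E(1)] E(3))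
      qed
    qed
    show "poly_eval g (\<phi> y) = 0"
      if g: "g \<in> forms n (int t - 1)" and van: "\<And>w. w \<in> W \<Longrightarrow> w \<noteq> \<phi> y \<Longrightarrow> poly_eval g w = 0" for g
    proof (rule ccontr)
      assume nz: "poly_eval g (\<phi> y) \<noteq> 0"
      have "poly_eval g (\<phi> q) = 0"
      proof (rule vanish_on_line(1)[OF g order_refl])
        show "int t - 1 < int (card A)" using t_le by linarith
        show "poly_eval g (line_point a) = 0" if "a \<in> A" for a
          using van that line_point_neq_\<phi>[OF yc] by (simp add: W_def)
      qed
      moreover obtain E' where E': "E' \<in> forms N (int t - 1)" "\<And>z. poly_eval E' z = poly_eval g (\<phi> z)"
        using pullback[OF g] by blast
      moreover have "poly_eval g (\<phi> z) = 0" if "z \<in> Y - {y}" for z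
        using that \<phi>_inj[of z y] yc Y_coord by (intro van) (auto simp: W_def)
      ultimately have "sep_at y (t - 1)"
        unfolding sep_at_def using nz t_pos by (intro bexI[of _ E']) (auto simp: of_nat_diff)
      then show False using y(2) by blast
    qed
  qed
  moreover have "int t < int (card A)" using t_le card2 by linarith
  ultimately show ?thesis by blast
qed

text \<open>One linear factor for each \<open>b\<close>: a coordinate of
  \<open>\<pi> x - b h(x) q\<close> in which \<open>q\<close> is nonzero. At the point with
  parameter \<open>a\<close> it is \<open>a - b\<close> up to a nonzero constant.\<close>

lemma line_separator:
  assumes "a0 \<in> A"
  shows "B \<subseteq> A - {a0} \<Longrightarrow> \<exists>E\<in>forms n (int (card B)). poly_eval E (line_point a0) \<noteq> 0 \<and>
    (\<forall>a\<in>B. poly_eval E (line_point a) = 0)"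
proof -
  obtain j where j: "j \<le> N" "lookup q j \<noteq> 0"
    using coord_vecs_nonzero[OF q_coord q_nonzero] by blast
  define l where "l b = linear_form n (\<lambda>i. lookup (p i) j - b * lookup q j * H i)" for b
  have l: "poly_eval (l b) (line_point a) = (a - b) * lookup q j" for a b
  proof -
    have "poly_eval (l b) x = lookup (\<pi> x) j - b * lookup q j * h x" for x
      unfolding l_def poly_eval_linear_form lookup_\<pi> h_eq
      by (simp add: algebra_simps sum_subtractf sum_distrib_left del: sum.atMost_Suc)
    from this[of "line_point a"] show ?thesis
      by (simp only: \<pi>_line_point h_line_point) (simp add: algebra_simps)
  qed
  assume B: "B \<subseteq> A - {a0}"
  then have "finite B" using finite_A finite_subset by blast
  then show ?thesis using B
  proof (induction B)
    case empty
    show ?case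
      by (intro bexI[of _ "single 0 1"]) (auto simp: poly_eval_single forms_const[of 1 n, simplified])
  next
    case (insert b B)
    then obtain E where E: "E \<in> forms n (int (card B))" "poly_eval E (line_point a0) \<noteq> 0"
      "\<And>a. a \<in> B \<Longrightarrow> poly_eval E (line_point a) = 0" by blast
    have "l b * E \<in> forms n (int (card (insert b B)))"
      using forms_mult[OF linear_form_forms[of n] E(1)] insert.hyps by (simp add: l_def)
    moreover have "a0 \<noteq> b" using insert.prems by auto
    ultimately show ?case
      using E j(2) by (intro bexI[of _ "l b * E"]) (auto simp: l)
  qed
qed

text \<open>The separator is \<open>h\<close> times \<open>card A - 1\<close> linear factors. One of
  smaller degree vanishes on \<open>Y\<close>, hence on the whole hyperplane; dividing it by
  \<open>h\<close> leaves a form of degree \<open>card A - 2\<close> with \<open>card A - 1\<close>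
  zeros on the line, which therefore vanishes at \<open>a0\<close> as well.\<close>

lemma line_nontrivial_tuple:
  assumes "\<And>E. E \<in> forms N (int (card A) - 1) \<Longrightarrow> \<forall>y\<in>Y. poly_eval E y = 0 \<Longrightarrow> E = 0"
  shows "\<exists>f. nontrivial_tuple (int (card A)) f"
proof -
  obtain a0 where a0: "a0 \<in> A" using A_nonempty by blast
  have cardA: "card A = Suc (card (A - {a0}))"
    using a0 finite_A by (metis card.remove)
  obtain E where E: "E \<in> forms n (int (card (A - {a0})))" "poly_eval E (line_point a0) \<noteq> 0"
    "\<And>a. a \<in> A - {a0} \<Longrightarrow> poly_eval E (line_point a) = 0"
    using line_separator[OF a0 order_refl] by blast
  define G where "G = linear_form n H * E"
  have G: "poly_eval G x = h x * poly_eval E x" for x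
    unfolding G_def h_eq poly_eval_mult poly_eval_linear_form ..
  show ?thesis
  proof (rule separator_nontrivial_tuple)
    show "line_point a0 \<in> W" using a0 by (simp add: W_def)
    show "G \<in> forms n (int (card A))"
      unfolding G_def using forms_mult[OF linear_form_forms[of n] E(1)] cardA by simp
    show "poly_eval G (line_point a0) \<noteq> 0" using E(2) by (simp add: G h_line_point)
    show "poly_eval G w = 0" if "w \<in> W" "w \<noteq> line_point a0" for w
      using that E(3) h_\<phi> Y_coord unfolding G W_def by auto
    show "poly_eval g (line_point a0) = 0"
      if g: "g \<in> forms n (int (card A) - 1)"
        and van: "\<And>w. w \<in> W \<Longrightarrow> w \<noteq> line_point a0 \<Longrightarrow> poly_eval g w = 0" for g
    proof -
      obtain g' where g': "g' \<in> forms N (int (card A) - 1)" "\<And>y. poly_eval g' y = poly_eval g (\<phi> y)"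
        using pullback[OF g] by blast
      have "poly_eval g (\<phi> y) = 0" if "y \<in> Y" for y
        using that line_point_neq_\<phi>[of y a0, THEN not_sym] Y_coord
        by (intro van) (auto simp: W_def)
      then have "g' = 0" using assms[OF g'(1)] g'(2) by auto
      then have "poly_eval g (\<phi> y) = 0" for y using g'(2)[of y] by simp
      then obtain r where r: "r \<in> forms n (int (card A) - 1 - 1)"
        "\<And>x. x \<in> coord_vecs n \<Longrightarrow> poly_eval g x = h x * poly_eval r x"
        using divide_by_h[OF g] by blast
      then have gr: "poly_eval g (line_point a) = poly_eval r (line_point a)" for a
        by (simp add: line_point_coord h_line_point)
      have "poly_eval r (line_point a0) = 0"
      proof (rule vanish_on_line(2)[OF r(1)])
        show "A - {a0} \<subseteq> A" by blast
        show "int (card A) - 1 - 1 < int (card (A - {a0}))" using cardA by simp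
        show "poly_eval r (line_point a) = 0" if "a \<in> A - {a0}" for a
          using that van[of "line_point a"] by (simp add: W_def line_point_inj flip: gr)
      qed
      then show ?thesis by (simp add: gr)
    qed
  qed
qed

text \<open>The common quotient has two summands. \<open>g1\<close> is right on the line, and
  subtracting it leaves a tuple that vanishes at the line points; \<open>g3\<close> is right on the
  hyperplane for this remainder, and as a cone over a form that vanishes at \<open>q\<close> it is
  zero on the line.\<close>

lemma no_nontrivial_tuple:
  assumes Y: "\<And>E e. e \<le> int (card A) \<Longrightarrow> E \<in> forms N e \<Longrightarrow> \<forall>y\<in>Y. poly_eval E y = 0 \<Longrightarrow> E = 0"
    and t: "t < int (card A)"
  shows "\<not> nontrivial_tuple t f"
proof
  assume "nontrivial_tuple t f"
  then have f: "\<And>i. i \<le> n \<Longrightarrow> f i \<in> forms n t"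
    and ff: "\<And>i j w. i \<le> n \<Longrightarrow> j \<le> n \<Longrightarrow> w \<in> W \<Longrightarrow>
      lookup w i * poly_eval (f j) w = lookup w j * poly_eval (f i) w"
    and nontriv: "\<not> (\<exists>g\<in>forms n (t - 1). \<forall>i\<le>n. vanishes (f i - var i * g))"
    by (auto simp: nontrivial_tuple_def vanishes_def)
  \<comment> \<open>If s is the common quotient of the tuple at the points, this form has the values
    h s: zero at the hyperplane points, and s itself at the line points, where \<open>h\<close> is
    1.\<close>
  define fh where "fh = (\<Sum>i\<le>n. pm_scale (H i) (f i))"
  have fh: "fh \<in> forms n t" unfolding fh_def by (intro forms_sum forms_scale f) simp
  have fh_W: "lookup w j * poly_eval fh w = h w * poly_eval (f j) w" if "w \<in> W" "j \<le> n" for w j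
  proof -
    have "lookup w j * poly_eval fh w = (\<Sum>i\<le>n. H i * (lookup w j * poly_eval (f i) w))"
      by (simp add: fh_def sum_distrib_left algebra_simps del: sum.atMost_Suc)
    also have "\<dots> = (\<Sum>i\<le>n. H i * (lookup w i * poly_eval (f j) w))"
      using ff[OF that(2) _ that(1)] by (intro sum.cong refl) simp
    also have "\<dots> = h w * poly_eval (f j) w"
      unfolding h_eq sum_distrib_right by (intro sum.cong refl) (simp add: mult.assoc)
    finally show ?thesis .
  qed
  have "poly_eval fh (\<phi> y) = 0" if y: "y \<in> Y" for y
  proof -
    have w: "\<phi> y \<in> W" using y by (simp add: W_def)
    obtain j where "j \<le> n" "lookup (\<phi> y) j \<noteq> 0"
      using coord_vecs_nonzero[OF W_coord[OF w] W_nonzero[OF w]] by blast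
    then show ?thesis using fh_W[OF w, of j] h_\<phi>[of y] y Y_coord by auto
  qed
  moreover obtain fh' where fh': "fh' \<in> forms N t" "\<And>y. poly_eval fh' y = poly_eval fh (\<phi> y)"
    using pullback[OF fh] by blast
  ultimately have "fh' = 0" using Y[of t fh'] t by simp
  then have "poly_eval fh (\<phi> y) = 0" for y using fh'(2)[of y] by simp
  then obtain g1 where g1: "g1 \<in> forms n (t - 1)"
    "\<And>x. x \<in> coord_vecs n \<Longrightarrow> poly_eval fh x = h x * poly_eval g1 x"
    using divide_by_h[OF fh] by blast
  define f' where "f' i = f i - var i * g1" for i
  have f': "f' i \<in> forms n t" if "i \<le> n" for i
    unfolding f'_def using forms_var_mult[OF that g1(1)] by (intro forms_diff f that) simp
  have f'_A: "poly_eval (f' i) (line_point a) = 0" if "a \<in> A" "i \<le> n" for a i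
  proof -
    have "line_point a \<in> W" using that(1) by (simp add: W_def)
    from fh_W[OF this that(2)] show ?thesis
      by (simp add: f'_def g1(2) line_point_coord h_line_point)
  qed
  \<comment> \<open>The degree is less than the number of line points, so the zeros spread to the
    point where the line meets the hyperplane. This is what makes \<open>g2\<close> vanish at
    \<open>q\<close>.\<close>
  have f'_q: "poly_eval (f' i) (\<phi> q) = 0" if "i \<le> n" for i
    by (rule vanish_on_line(1)[OF f'[OF that] order_refl t]) (rule f'_A[OF _ that])
  have f'_W: "lookup w i * poly_eval (f' j) w = lookup w j * poly_eval (f' i) w"
    if "i \<le> n" "j \<le> n" "w \<in> W" for i j w
    using ff[OF that] by (simp add: f'_def algebra_simps)
  have "\<exists>F'\<in>forms N t. \<forall>y. poly_eval F' y = poly_eval (f' i) (\<phi> y)" if "i \<le> n" for i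
    by (rule pullback[OF f'[OF that]])
  then have "\<forall>i. \<exists>F'. i \<le> n \<longrightarrow> F' \<in> forms N t \<and> (\<forall>y. poly_eval F' y = poly_eval (f' i) (\<phi> y))"
    by blast
  from choice[OF this] obtain F'
    where F': "\<And>i. i \<le> n \<Longrightarrow> F' i \<in> forms N t"
      "\<And>i y. i \<le> n \<Longrightarrow> poly_eval (F' i) y = poly_eval (f' i) (\<phi> y)" by blast
  \<comment> \<open>The tuple is indexed by the N + 2 ambient coordinates. Contracting it with the
    matrix of \<open>\<pi>\<close> gives one indexed by the N + 1 coordinates of the hyperplane,
    with the same quotients at the points of \<open>Y\<close>.\<close>
  define G where "G k = (\<Sum>i\<le>n. pm_scale (lookup (p i) k) (F' i))" for k
  have G: "G k \<in> forms N t" for k unfolding G_def by (intro forms_sum forms_scale F') simp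
  have G_Y: "lookup (\<phi> y) j * poly_eval (G k) y = lookup y k * poly_eval (f' j) (\<phi> y)"
    if y: "y \<in> Y" and j: "j \<le> n" for y j k
  proof -
    have w: "\<phi> y \<in> W" using y by (simp add: W_def)
    have "lookup (\<phi> y) j * poly_eval (G k) y =
        (\<Sum>i\<le>n. lookup (p i) k * (lookup (\<phi> y) j * poly_eval (f' i) (\<phi> y)))"
      by (simp add: G_def F'(2) sum_distrib_left algebra_simps del: sum.atMost_Suc)
    also have "\<dots> = (\<Sum>i\<le>n. lookup (p i) k * (lookup (\<phi> y) i * poly_eval (f' j) (\<phi> y)))"
      using f'_W[OF j _ w] by (intro sum.cong refl) simp
    also have "\<dots> = lookup (\<pi> (\<phi> y)) k * poly_eval (f' j) (\<phi> y)"
      unfolding lookup_\<pi>[of "\<phi> y"] sum_distrib_right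
      by (intro sum.cong refl) (simp add: mult.assoc)
    also have "\<pi> (\<phi> y) = y" using y Y_coord \<pi>_\<phi> by blast
    finally show ?thesis .
  qed
  \<comment> \<open>The relations are known at \<open>Y\<close> only, but their degree t + 1 is at
    most \<open>card A\<close>, so they hold identically.\<close>
  have "var k * G l = var l * G k" if kl: "k \<le> N" "l \<le> N" for k l
  proof -
    have "var k * G l - var l * G k \<in> forms N (t + 1)"
      by (intro forms_diff forms_var_mult G kl)
    moreover have "poly_eval (var k * G l - var l * G k) y = 0" if y: "y \<in> Y" for y
    proof -
      have w: "\<phi> y \<in> W" using y by (simp add: W_def)
      obtain j where j: "j \<le> n" "lookup (\<phi> y) j \<noteq> 0"
        using coord_vecs_nonzero[OF W_coord[OF w] W_nonzero[OF w]] by blast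
      have "lookup (\<phi> y) j * poly_eval (var k * G l - var l * G k) y =
          lookup y k * (lookup (\<phi> y) j * poly_eval (G l) y) -
          lookup y l * (lookup (\<phi> y) j * poly_eval (G k) y)"
        by (simp add: algebra_simps)
      also have "\<dots> = 0" by (simp add: G_Y[OF y j(1)])
      finally show ?thesis using j(2) by simp
    qed
    ultimately have "var k * G l - var l * G k = 0"
      using Y[of "t + 1" "var k * G l - var l * G k"] t by simp
    then show ?thesis by simp
  qed
  then obtain g2 where g2: "g2 \<in> forms N (t - 1)" "\<And>k. k \<le> N \<Longrightarrow> G k = var k * g2"
    using common_factor[OF N_pos, of G t] G by blast
  have g2_q: "poly_eval g2 q = 0"
  proof -
    obtain k where k: "k \<le> N" "lookup q k \<noteq> 0"
      using coord_vecs_nonzero[OF q_coord q_nonzero] by blast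
    have "poly_eval (G k) q = 0" by (simp add: G_def F'(2) f'_q del: sum.atMost_Suc)
    then show ?thesis using k g2(2)[OF k(1)] by simp
  qed
  obtain g3 where g3: "g3 \<in> forms n (t - 1)" "\<And>x. poly_eval g3 x = poly_eval g2 (\<pi> x)"
    using extend[OF g2(1)] by blast
  have "vanishes (f i - var i * (g1 + g3))" if i: "i \<le> n" for i
    unfolding vanishes_def
  proof
    fix w assume "w \<in> W"
    then consider y where "y \<in> Y" "w = \<phi> y" | a where "a \<in> A" "w = line_point a"
      by (auto simp: W_def)
    then have "poly_eval (f' i) w = lookup w i * poly_eval g3 w"
    proof cases
      case 1
      then have yc: "y \<in> coord_vecs N" "y \<noteq> 0" using Y_coord Y_nonzero by auto
      obtain k where k: "k \<le> N" "lookup y k \<noteq> 0"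
        using coord_vecs_nonzero[OF yc] by blast
      have "lookup y k * (lookup (\<phi> y) i * poly_eval g2 y) = lookup y k * poly_eval (f' i) (\<phi> y)"
        using G_Y[OF 1(1) i, of k] g2(2)[OF k(1)] by (simp add: algebra_simps)
      then show ?thesis using k(2) 1(2) yc(1) by (simp add: g3(2) \<pi>_\<phi>)
    next
      case 2
      then show ?thesis
        using f'_A[OF 2(1) i] by (simp add: g3(2) \<pi>_line_point forms_homogeneous[OF g2(1)] g2_q)
    qed
    then show "poly_eval (f i - var i * (g1 + g3)) w = 0"
      by (simp add: f'_def algebra_simps)
  qed
  then show False using nontriv forms_add[OF g1(1) g3(1)] by blast
qed

end

section \<open>Hilbert functions\<close>

definition pt :: "('k \<Rightarrow>\<^sub>0 'a::field) \<Rightarrow> ('k \<Rightarrow>\<^sub>0 'a) set" where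
  "pt v = {pm_scale c v | c. c \<noteq> 0}"

lemma pt_self: "v \<in> pt v"
  unfolding pt_def by (rule CollectI, rule exI[of _ 1]) simp

lemma pt_scale: assumes "c \<noteq> 0" shows "pt (pm_scale c v) = pt v"
proof -
  have "\<exists>e. pm_scale d v = pm_scale e (pm_scale c v) \<and> e \<noteq> 0" if "d \<noteq> 0" for d
    using assms that by (intro exI[of _ "d / c"]) simp
  then show ?thesis using assms by (auto simp: pt_def)
qed

lemma proj_space_eq: "proj_space n = pt ` (coord_vecs n - {0})"
proof -
  have "proj_rel n `` {v} = pt v" if v: "v \<in> coord_vecs n - {0}" for v
  proof (rule equalityI; rule subsetI)
    fix w assume "w \<in> proj_rel n `` {v}"
    then show "w \<in> pt v" unfolding proj_rel_def pt_def by blast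
  next
    fix w assume "w \<in> pt v"
    then obtain c where c: "w = pm_scale c v" "c \<noteq> 0" unfolding pt_def by blast
    then have "w \<in> coord_vecs n - {0}" using v coord_vecs_scale[of v n c] by simp
    then show "w \<in> proj_rel n `` {v}" unfolding proj_rel_def using v c by blast
  qed
  moreover have "proj_space n = (\<lambda>v. proj_rel n `` {v}) ` (coord_vecs n - {0})"
    unfolding proj_space_def quotient_def by blast
  ultimately show ?thesis using image_cong[OF refl, of "coord_vecs n - {0}"] by metis
qed

lemma linear_pt:
  assumes "Vector_Spaces.linear pm_scale pm_scale f" shows "f ` pt v = pt (f v)"
proof -
  have "f (pm_scale c v) = pm_scale c (f v)" for c
    using module_hom.scale[of pm_scale pm_scale f] assms by (simp add: module_hom_iff_linear)
  then show ?thesis by (auto simp: pt_def image_def)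
qed

lemma vanishing_ideal_forms:
  assumes "p \<in> forms n e"
  shows "p \<in> vanishing_ideal n (pt ` S) \<longleftrightarrow> (\<forall>v\<in>S. poly_eval p v = 0)"
proof -
  have "(\<forall>w\<in>pt v. poly_eval p w = 0) \<longleftrightarrow> poly_eval p v = 0" for v
    using pt_self[of v] forms_homogeneous[OF assms] by (auto simp: pt_def)
  moreover have "p \<in> poly_ring n" using assms by (simp add: forms_def)
  ultimately show ?thesis by (simp add: vanishing_ideal_def)
qed

text \<open>Extend a basis of \<open>W\<close> to one of \<open>V\<close> and drop the former.
  Existence gives meaning to the choice in \<open>quotient_dim\<close>.\<close>

lemma quotient_basis_exists:
  assumes V: "pm.subspace V" and W: "pm.subspace W" "W \<subseteq> V"
  shows "\<exists>B. quotient_basis V W B"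
proof -
  obtain A where A: "A \<subseteq> W" "pm.independent A" "W \<subseteq> pm.span A"
    using pm.maximal_independent_subset by blast
  obtain C where C: "A \<subseteq> C" "C \<subseteq> V" "pm.independent C" "V \<subseteq> pm.span C"
    using pm.maximal_independent_subset_extend[OF order.trans[OF A(1) W(2)] A(2)] by blast
  have AW: "pm.span A \<subseteq> W" by (rule pm.span_minimal[OF A(1) W(1)])
  have "quotient_basis V W (C - A)"
    unfolding quotient_basis_def
  proof (intro conjI ballI)
    show "C - A \<subseteq> V" using C by blast
    show ind: "pm.independent (C - A)" by (rule pm.independent_mono[OF C(3)]) blast
    show "pm.span (C - A) \<inter> W = {0}"
    proof (intro equalityI subsetI)
      fix x assume "x \<in> pm.span (C - A) \<inter> W"
      then have x: "x \<in> pm.span (C - A)" "x \<in> pm.span A" using A by auto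
      have "pm.representation (C - A) x = pm.representation A x"
        using pm.representation_extend[OF C(3) x(1)] pm.representation_extend[OF C(3) x(2) C(1)]
        by auto
      then have "pm.representation (C - A) x b = 0" for b
        using pm.representation_ne_zero[of A x b] pm.representation_ne_zero[of "C - A" x b] by auto
      then have "(\<Sum>b | pm.representation (C - A) x b \<noteq> 0. pm_scale (pm.representation (C - A) x b) b) = 0"
        by simp
      then show "x \<in> {0}" using pm.sum_nonzero_representation_eq[OF ind x(1)] by simp
    qed (use W(1) in \<open>auto simp: pm.span_zero pm.subspace_0\<close>)
    fix v assume "v \<in> V"
    then have "v \<in> pm.span ((C - A) \<union> A)" using C(1,4) by (simp add: Un_absorb2 subsetD)
    then obtain x y where "v = x + y" "x \<in> pm.span (C - A)" "y \<in> pm.span A"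
      unfolding pm.span_Un by blast
    then show "\<exists>u\<in>pm.span (C - A). v - u \<in> W" using AW by force
  qed
  then show ?thesis by blast
qed

lemma graded_part_eq: "graded_part n i = forms n (int i)"
  by (simp add: graded_part_def forms_def)

lemma hilbert_function_basis:
  obtains B where "quotient_basis (forms n (int i)) (forms n (int i) \<inter> vanishing_ideal n (pt ` S)) B"
    and "hilbert_function n (pt ` S) i = card B"
proof -
  let ?V = "forms n (int i)" and ?W = "forms n (int i) \<inter> vanishing_ideal n (pt ` S)"
  have V: "pm.subspace ?V"
    by (auto simp: pm.subspace_def intro: forms_add forms_scale)
  have W: "pm.subspace ?W"
    unfolding pm.subspace_def
    by (auto simp: vanishing_ideal_forms[of _ n "int i"] forms_add forms_scale)
  have "quotient_basis ?V ?W (SOME B. quotient_basis ?V ?W B)"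
    by (rule someI_ex[OF quotient_basis_exists[OF V W]]) simp
  then show ?thesis
    using that by (simp add: hilbert_function_def quotient_dim_def graded_part_eq)
qed

text \<open>The exponents of a monomial form a list of N + 1 naturals with sum \<open>i\<close>;
  such lists are counted by stars and bars.\<close>

lemma forms_spanning_set:
  obtains M where "finite M" "card M \<le> (i + N) choose N"
    and "forms N (int i) \<subseteq> pm.span (M :: 'a::field mpoly set)"
proof -
  define Mon where "Mon = {m :: nat \<Rightarrow>\<^sub>0 nat. keys m \<subseteq> {..N} \<and> total_deg m = i}"
  define L where "L = {l :: nat list. length l = Suc N \<and> sum_list l = i}"
  have "L \<subseteq> {l. set l \<subseteq> {..i} \<and> length l = Suc N}"
    unfolding L_def by (auto simp: member_le_sum_list)
  then have fin: "finite L"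
    using finite_lists_length_eq[of "{..i}" "Suc N"] finite_subset by blast
  define g where "g m = map (lookup m) [0..<Suc N]" for m :: "nat \<Rightarrow>\<^sub>0 nat"
  have inj: "inj_on g Mon"
  proof (rule inj_onI, rule poly_mapping_eqI)
    fix m k j assume mk: "m \<in> Mon" "k \<in> Mon" "g m = g k"
    show "lookup m j = lookup k j"
    proof (cases "j \<le> N")
      case True
      then have "j \<in> set [0..<Suc N]" by auto
      then show ?thesis using mk(3) unfolding g_def by (metis map_eq_conv)
    next
      case False
      then have "j \<notin> keys m" "j \<notin> keys k" using mk by (auto simp: Mon_def)
      then show ?thesis by (simp add: in_keys_iff)
    qed
  qed
  have img: "g ` Mon \<subseteq> L"
  proof (clarsimp simp: L_def, intro conjI)
    fix m assume m: "m \<in> Mon"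
    show "length (g m) = Suc N" by (simp add: g_def)
    have "sum_list (g m) = (\<Sum>j\<le>N. lookup m j)"
      unfolding g_def by (subst interv_sum_list_conv_sum_set_nat)
        (simp add: atLeast0LessThan add.commute flip: lessThan_Suc_atMost)
    also have "\<dots> = i" using m total_deg_eq_sum[of "{..N}" m] by (simp add: Mon_def)
    finally show "sum_list (g m) = i" .
  qed
  have "card Mon \<le> card L" by (rule card_inj_on_le[OF inj img fin])
  also have "card L = (i + N) choose N"
    unfolding L_def card_length_sum_list by (simp add: binomial_symmetric[of i "i + N"])
  finally have cardMon: "card Mon \<le> (i + N) choose N" .
  have finMon: "finite Mon" by (rule inj_on_finite[OF inj img fin])
  define M :: "'a mpoly set" where "M = (\<lambda>m. single m 1) ` Mon"
  have "p \<in> pm.span M" if "p \<in> forms N (int i)" for p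
  proof -
    have "(\<Sum>m\<in>keys p. pm_scale (lookup p m) (single m 1)) \<in> pm.span M"
    proof (intro pm.span_sum pm.span_scale pm.span_base)
      fix m assume "m \<in> keys p"
      then show "single m 1 \<in> M" using that by (auto simp: M_def Mon_def forms_iff)
    qed
    moreover have "pm_scale (lookup p m) (single m 1) = single m (lookup p m)" for m
      by (simp add: pm_scale_eq_mult mult_single)
    ultimately show ?thesis by (simp flip: poly_mapping_sum_single)
  qed
  moreover have "finite M" using finMon by (simp add: M_def)
  moreover have "card M \<le> (i + N) choose N"
    using card_image_le[OF finMon] cardMon by (auto simp: M_def intro: order.trans)
  ultimately show ?thesis using that by blast
qed

text \<open>The quotient basis already has as many elements as there are monomials, which leaves no
  room for a further independent form in the ideal.\<close>

lemma no_form_vanishes: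
  fixes E :: "'a::field mpoly"
  assumes hf: "hilbert_function N (pt ` S) i = (i + N) choose N"
    and E: "E \<in> forms N (int i)" "\<forall>y\<in>S. poly_eval E y = 0"
  shows "E = 0"
proof (rule ccontr)
  assume "E \<noteq> 0"
  let ?W = "forms N (int i) \<inter> vanishing_ideal N (pt ` S)"
  obtain B where B: "quotient_basis (forms N (int i)) ?W B" and cardB: "card B = (i + N) choose N"
    using hilbert_function_basis[of N i S] hf by metis
  \<comment> \<open>Infinite sets have \<open>card\<close> 0, so positivity yields
    finiteness.\<close>
  have "0 < card B" by (simp add: cardB)
  then have finB: "finite B" using card_gt_0_iff by blast
  have "E \<in> ?W" using E vanishing_ideal_forms by blast
  then have EB: "E \<notin> pm.span B" using B \<open>E \<noteq> 0\<close> by (auto simp: quotient_basis_def)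
  then have ind: "pm.independent (insert E B)"
    using B pm.independent_insertI[OF EB] by (simp add: quotient_basis_def)
  obtain M :: "'a mpoly set" where M: "finite M" "card M \<le> (i + N) choose N" "forms N (int i) \<subseteq> pm.span M"
    using forms_spanning_set by blast
  have "insert E B \<subseteq> pm.span M" using M(3) E(1) B by (auto simp: quotient_basis_def)
  then have "card (insert E B) \<le> card M" using pm.independent_span_bound[OF M(1) ind] by blast
  moreover have "E \<notin> B" using EB pm.span_base by blast
  ultimately show False using M(2) cardB finB by simp
qed

text \<open>Gaussian elimination: an equation with a nonzero coefficient at \<open>k\<close> removes
  this unknown from the others, and \<open>s\<close> is the value that it then dictates.\<close>

lemma homogeneous_linear_system:
  fixes M :: "'i \<Rightarrow> 'j \<Rightarrow> 'a::field"
  assumes "finite J" "finite I" "card J < card I"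
  shows "\<exists>c. (\<exists>i\<in>I. c i \<noteq> 0) \<and> (\<forall>j\<in>J. (\<Sum>i\<in>I. c i * M i j) = 0)"
  using assms
proof (induction J arbitrary: I M rule: finite_induct)
  case empty
  then have "I \<noteq> {}" by auto
  then show ?case by (intro exI[of _ "\<lambda>i. 1"]) auto
next
  case (insert j J)
  show ?case
  proof (cases "\<forall>i\<in>I. M i j = 0")
    case True
    have "card J < card I" using insert by simp
    then obtain c where "\<exists>i\<in>I. c i \<noteq> 0" "\<forall>j\<in>J. (\<Sum>i\<in>I. c i * M i j) = 0"
      using insert.IH[OF insert.prems(1), of M] by blast
    then show ?thesis using True by (intro exI[of _ c]) simp
  next
    case False
    then obtain k where k: "k \<in> I" "M k j \<noteq> 0" by blast
    define M' where "M' i l = M i l - M i j / M k j * M k l" for i l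
    have "card J < card (I - {k})" using insert k by simp
    then obtain c' where c': "\<exists>i\<in>I - {k}. c' i \<noteq> 0"
      "\<forall>l\<in>J. (\<Sum>i\<in>I - {k}. c' i * M' i l) = 0"
      using insert.IH[of "I - {k}" M'] insert.prems(1) by auto
    define s where "s = - (\<Sum>i\<in>I - {k}. c' i * M i j) / M k j"
    define c where "c i = (if i = k then s else c' i)" for i
    have expand: "(\<Sum>i\<in>I. c i * M i l) = s * M k l + (\<Sum>i\<in>I - {k}. c' i * M i l)" for l
    proof -
      have "(\<Sum>i\<in>I - {k}. c i * M i l) = (\<Sum>i\<in>I - {k}. c' i * M i l)"
        by (intro sum.cong) (auto simp: c_def)
      then show ?thesis using sum.remove[OF insert.prems(1) k(1), of "\<lambda>i. c i * M i l"] by (simp add: c_def)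
    qed
    have "(\<Sum>i\<in>I. c i * M i l) = (\<Sum>i\<in>I - {k}. c' i * M' i l)" for l
    proof -
      have "(\<Sum>i\<in>I - {k}. c' i * M' i l) =
          (\<Sum>i\<in>I - {k}. c' i * M i l) - (\<Sum>i\<in>I - {k}. c' i * M i j) / M k j * M k l"
        by (simp add: M'_def algebra_simps sum_subtractf sum_distrib_left sum_divide_distrib)
      then show ?thesis by (simp add: expand s_def)
    qed
    moreover have "(\<Sum>i\<in>I. c i * M i j) = 0" using k(2) by (simp add: expand s_def)
    moreover have "\<exists>i\<in>I. c i \<noteq> 0" using c'(1) by (auto simp: c_def)
    ultimately show ?thesis using c'(2) by (intro exI[of _ c]) auto
  qed
qed

text \<open>There are as many basis forms as points, so a nontrivial combination meets the
  conditions at all points but \<open>y\<close>. If it vanished at \<open>y\<close> too, it would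
  lie in the ideal, which meets the span of the basis only in 0.\<close>

lemma separators_exist:
  assumes hf: "hilbert_function N (pt ` S) i = card S" and S: "finite S" "y \<in> S"
  shows "\<exists>E\<in>forms N (int i). poly_eval E y \<noteq> 0 \<and> (\<forall>z\<in>S - {y}. poly_eval E z = 0)"
proof -
  let ?W = "forms N (int i) \<inter> vanishing_ideal N (pt ` S)"
  obtain B where B: "quotient_basis (forms N (int i)) ?W B" and cardB: "card B = card S"
    using hilbert_function_basis[of N i S] hf by metis
  have "0 < card B" using S by (auto simp: cardB card_gt_0_iff)
  then have finB: "finite B" using card_gt_0_iff by blast
  have "card (S - {y}) < card B" using S cardB by (metis card_Diff1_less)
  then obtain c where c: "\<exists>b\<in>B. c b \<noteq> 0" "\<forall>z\<in>S - {y}. (\<Sum>b\<in>B. c b * poly_eval b z) = 0"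
    using homogeneous_linear_system[of "S - {y}" B "\<lambda>b z. poly_eval b z"] S(1) finB by auto
  define E where "E = (\<Sum>b\<in>B. pm_scale (c b) b)"
  have "E \<in> forms N (int i)"
    unfolding E_def using B by (intro forms_sum forms_scale) (auto simp: quotient_basis_def)
  moreover have van: "\<forall>z\<in>S - {y}. poly_eval E z = 0" using c(2) by (simp add: E_def)
  moreover have "poly_eval E y \<noteq> 0"
  proof
    assume "poly_eval E y = 0"
    then have "\<forall>z\<in>S. poly_eval E z = 0" using van by blast
    then have "E \<in> ?W" using vanishing_ideal_forms \<open>E \<in> forms N (int i)\<close> by blast
    moreover have "E \<in> pm.span B"
      unfolding E_def by (intro pm.span_sum pm.span_scale pm.span_base)
    ultimately have "E = 0" using B by (auto simp: quotient_basis_def)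
    then have "c b = 0" if "b \<in> B" for b
      using pm.independentD[OF _ finB order_refl _ that, of c] B
      by (auto simp: quotient_basis_def E_def)
    then show False using c(1) by blast
  qed
  ultimately show ?thesis by blast
qed

section \<open>Adapted coordinates\<close>

text \<open>A chart is specified by its action on points; this recovers its image on vectors, with
  separate treatment of 0, which represents no point.\<close>

lemma image_chart:
  assumes U: "pm.subspace U" "U \<subseteq> coord_vecs n"
    and H: "H = {P \<in> proj_space n. P \<subseteq> U}"
    and lin: "Vector_Spaces.linear pm_scale pm_scale \<psi>"
    and img: "(\<lambda>Q. \<psi> ` Q) ` proj_space m = H"
  shows "\<psi> ` coord_vecs m = U"
proof (rule equalityI; rule subsetI)
  fix x assume "x \<in> \<psi> ` coord_vecs m"
  then obtain y where y: "y \<in> coord_vecs m" "x = \<psi> y" by blast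
  show "x \<in> U"
  proof (cases "y = 0")
    case True
    have "module_hom pm_scale pm_scale \<psi>" using lin by (simp add: module_hom_iff_linear)
    then have "x = 0" using True y(2) module_hom.zero by blast
    then show ?thesis using pm.subspace_0[OF U(1)] by simp
  next
    case False
    then have "\<psi> ` pt y \<in> H" using img y(1) by (auto simp: proj_space_eq)
    then show ?thesis using H y(2) pt_self[of y] by blast
  qed
next
  fix x assume x: "x \<in> U"
  show "x \<in> \<psi> ` coord_vecs m"
  proof (cases "x = 0")
    case True
    have "module_hom pm_scale pm_scale \<psi>" using lin by (simp add: module_hom_iff_linear)
    then have "\<psi> 0 = x" using True module_hom.zero by blast
    moreover have "0 \<in> coord_vecs m" by (simp add: coord_vecs_iff)
    ultimately show ?thesis by blast
  next
    case False
    have "pt x \<in> proj_space n" using False x U(2) by (auto simp: proj_space_eq)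
    moreover have "pt x \<subseteq> U" using x pm.subspace_scale[OF U(1)] by (auto simp: pt_def)
    ultimately have "pt x \<in> (\<lambda>Q. \<psi> ` Q) ` proj_space m" using H img by blast
    then obtain Q where Q: "Q \<in> proj_space m" "pt x = \<psi> ` Q" by blast
    then obtain y where "y \<in> Q" "x = \<psi> y" using pt_self[of x] by blast
    moreover have "Q \<subseteq> coord_vecs m" using Q(1) by (auto simp: proj_space_eq pt_def coord_vecs_scale)
    ultimately show ?thesis by blast
  qed
qed

lemma coord_vecs_expand:
  assumes "x \<in> coord_vecs n"
  shows "x = (\<Sum>i\<le>n. pm_scale (lookup x i) (single i 1))"
proof (rule poly_mapping_eqI)
  fix k
  show "lookup x k = lookup (\<Sum>i\<le>n. pm_scale (lookup x i) (single i 1)) k"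
    using assms by (simp add: lookup_sum lookup_single when_def coord_vecs_iff if_distrib cong: if_cong)
qed

text \<open>A basis of \<open>U\<close> together with \<open>u\<close> gives n + 1 independent
  vectors in the span of n + 1 unit vectors, so every coordinate vector lies in their span.\<close>

lemma coord_vecs_complement:
  assumes U: "pm.subspace U" "U \<subseteq> coord_vecs n" "pm.dim U = n" and n: "0 < n"
    and u: "u \<in> coord_vecs n" "u \<notin> U" and x: "x \<in> coord_vecs n"
  shows "\<exists>k. x - pm_scale k u \<in> U"
proof -
  obtain B where B: "B \<subseteq> U" "pm.independent B" "U \<subseteq> pm.span B" "card B = n"
    using pm.basis_exists[of U] U(3) by metis
  have span: "pm.span B \<subseteq> U" by (rule pm.span_minimal[OF B(1) U(1)])
  have finB: "finite B" using B(4) n card_gt_0_iff by blast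
  have uB: "u \<notin> pm.span B" using u(2) span by blast
  have ind: "pm.independent (insert u B)" by (rule pm.independent_insertI[OF uB B(2)])
  define M where "M = (\<lambda>i. single i (1 :: 'a)) ` {..n}"
  have M: "finite M" "card M \<le> Suc n"
    unfolding M_def using card_image_le[of "{..n}" "\<lambda>i. single i (1 :: 'a)"] by auto
  have coord: "v \<in> pm.span M" if "v \<in> coord_vecs n" for v
  proof -
    have "(\<Sum>i\<le>n. pm_scale (lookup v i) (single i 1)) \<in> pm.span M"
      by (intro pm.span_sum pm.span_scale pm.span_base) (simp add: M_def)
    then show ?thesis by (simp only: coord_vecs_expand[OF that, symmetric])
  qed
  have "x \<in> pm.span (insert u B)"
  proof (rule ccontr)
    assume nx: "x \<notin> pm.span (insert u B)"
    have "pm.independent (insert x (insert u B))" by (rule pm.independent_insertI[OF nx ind])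
    moreover have "insert x (insert u B) \<subseteq> pm.span M"
      using coord x u(1) B(1) U(2) by blast
    ultimately have "card (insert x (insert u B)) \<le> card M"
      using pm.independent_span_bound[OF M(1)] by blast
    moreover have "x \<notin> insert u B" "u \<notin> B" using nx uB pm.span_base by blast+
    ultimately show False using M(2) B(4) finB by simp
  qed
  then show ?thesis using span by (auto simp: pm.span_breakdown_eq)
qed

text \<open>Coordinate vectors decompose into the image of the chart and the multiples of
  \<open>u\<close>, which represents a point of \<open>L\<close> off \<open>H\<close>. The
  components of the unit vectors are the coefficients of \<open>\<pi>\<close> and \<open>h\<close>.
  The chart is replaced by its matrix because its values outside \<open>coord_vecs N\<close> are not
  controlled.\<close>

lemma adapted_coordinates:
  fixes H L :: "(nat \<Rightarrow>\<^sub>0 'a::field_char_0) set set"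
  assumes N: "1 \<le> N" and H: "hyperplane (Suc N) H" and chart: "hyperplane_chart (Suc N) H \<psi>"
    and L: "line (Suc N) L" and LH: "\<not> L \<subseteq> H"
  obtains \<phi> \<pi> h c p k u q
  where "\<And>Y A. Y \<subseteq> coord_vecs N \<Longrightarrow> 0 \<notin> Y \<Longrightarrow> finite A \<Longrightarrow> A \<noteq> {} \<Longrightarrow>
      points_in_hyperplane_and_line N \<phi> \<pi> h c p k u q Y A"
    and "\<And>y. y \<in> coord_vecs N \<Longrightarrow> \<phi> y = \<psi> y"
    and "\<And>P. P \<in> L \<Longrightarrow> P \<notin> H \<Longrightarrow> \<exists>a. P = pt (pm_scale a (\<phi> q) + u)"
proof -
  let ?n = "Suc N"
  obtain U where U: "pm.subspace U" "U \<subseteq> coord_vecs ?n" "pm.dim U = ?n"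
    and HU: "H = {P \<in> proj_space ?n. P \<subseteq> U}"
    using H N by (auto simp: hyperplane_def proj_subspace_def)
  obtain V where V: "pm.subspace V" "V \<subseteq> coord_vecs ?n" "pm.dim V = 2"
    and LV: "L = {P \<in> proj_space ?n. P \<subseteq> V}"
    using L by (auto simp: line_def proj_subspace_def)
  have lin: "Vector_Spaces.linear pm_scale pm_scale \<psi>"
    and inj: "inj_on \<psi> (coord_vecs N)"
    and img: "(\<lambda>Q. \<psi> ` Q) ` proj_space N = H"
    using chart by (auto simp: hyperplane_chart_def)
  have hom: "module_hom pm_scale pm_scale \<psi>" using lin by (simp add: module_hom_iff_linear)
  have \<psi>U: "\<psi> ` coord_vecs N = U" by (rule image_chart[OF U(1,2) HU lin img])
  obtain P where "P \<in> L" "P \<notin> H" using LH by blast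
  then have P: "P \<in> proj_space ?n" "P \<subseteq> V" "\<not> P \<subseteq> U" by (auto simp: LV HU)
  then obtain u where u: "u \<in> V" "u \<notin> U" by blast
  have uc: "u \<in> coord_vecs ?n" using u V by blast
  have "\<exists>y k. y \<in> coord_vecs N \<and> x = \<psi> y + pm_scale k u" if x: "x \<in> coord_vecs ?n" for x
  proof -
    obtain k where "x - pm_scale k u \<in> U"
      using coord_vecs_complement[OF U _ uc u(2) x] by auto
    then obtain y where "y \<in> coord_vecs N" "x - pm_scale k u = \<psi> y" using \<psi>U by blast
    then show ?thesis by (metis diff_add_cancel)
  qed
  moreover have "single i 1 \<in> coord_vecs ?n" if "i \<le> ?n" for i
    using that by (auto simp: coord_vecs_iff lookup_single when_def)
  ultimately have "\<forall>i. \<exists>y. \<exists>k. i \<le> ?n \<longrightarrow> y \<in> coord_vecs N \<and> single i 1 = \<psi> y + pm_scale k u"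
    by metis
  from choice[OF this] obtain p
    where "\<forall>i. \<exists>k. i \<le> ?n \<longrightarrow> p i \<in> coord_vecs N \<and> single i 1 = \<psi> (p i) + pm_scale k u" by blast
  from choice[OF this] obtain k
    where p: "\<And>i. i \<le> ?n \<Longrightarrow> p i \<in> coord_vecs N"
      and e: "\<And>i. i \<le> ?n \<Longrightarrow> single i 1 = \<psi> (p i) + pm_scale (k i) u" by blast
  define c where "c i = \<psi> (single i 1)" for i
  define \<phi> where "\<phi> y = (\<Sum>i\<le>N. pm_scale (lookup y i) (c i))" for y
  define \<pi> where "\<pi> x = (\<Sum>i\<le>?n. pm_scale (lookup x i) (p i))" for x
  define h where "h x = (\<Sum>i\<le>?n. k i * lookup x i)" for x
  have \<phi>\<psi>: "\<phi> y = \<psi> y" if y: "y \<in> coord_vecs N" for y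
  proof -
    have "\<psi> y = \<psi> (\<Sum>i\<le>N. pm_scale (lookup y i) (single i 1))"
      by (rule arg_cong[OF coord_vecs_expand[OF y]])
    also have "\<dots> = \<phi> y"
      by (simp add: module_hom.sum[OF hom] module_hom.scale[OF hom] \<phi>_def c_def)
    finally show ?thesis by simp
  qed
  have \<pi>c: "\<pi> x \<in> coord_vecs N" for x
    unfolding \<pi>_def by (intro coord_vecs_sum coord_vecs_scale p) simp
  have dec: "x = \<phi> (\<pi> x) + pm_scale (h x) u" if x: "x \<in> coord_vecs ?n" for x
  proof -
    have "x = (\<Sum>i\<le>?n. pm_scale (lookup x i) (\<psi> (p i) + pm_scale (k i) u))"
      by (subst coord_vecs_expand[OF x]) (intro sum.cong refl, simp add: e)
    also have "\<dots> = (\<Sum>i\<le>?n. pm_scale (lookup x i) (\<psi> (p i))) + (\<Sum>i\<le>?n. pm_scale (k i * lookup x i) u)"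
      by (simp add: pm.scale_right_distrib sum.distrib mult.commute del: sum.atMost_Suc)
    also have "(\<Sum>i\<le>?n. pm_scale (lookup x i) (\<psi> (p i))) = \<psi> (\<pi> x)"
      by (simp add: module_hom.sum[OF hom] module_hom.scale[OF hom] \<pi>_def del: sum.atMost_Suc)
    also have "(\<Sum>i\<le>?n. pm_scale (k i * lookup x i) u) = pm_scale (h x) u"
      unfolding h_def pm.scale_sum_left ..
    finally show ?thesis using \<phi>\<psi>[OF \<pi>c] by simp
  qed
  have \<phi>U: "\<phi> y \<in> U" if "y \<in> coord_vecs N" for y using \<phi>\<psi>[OF that] \<psi>U that by blast
  have uU: "b = 0" if "pm_scale b u \<in> U" for b
  proof (rule ccontr)
    assume "b \<noteq> 0"
    then have "u = pm_scale (inverse b) (pm_scale b u)" by simp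
    then show False using pm.subspace_scale[OF U(1) that] u(2) by metis
  qed
  have \<phi>0: "\<phi> 0 = 0" by (simp add: \<phi>_def)
  have \<phi>inj: "x = y" if "\<phi> x = \<phi> y" "x \<in> coord_vecs N" "y \<in> coord_vecs N" for x y
    using that \<phi>\<psi> inj by (metis inj_onD)
  have hphi: "h (\<phi> y) = 0" and piphi: "\<pi> (\<phi> y) = y" if y: "y \<in> coord_vecs N" for y
  proof -
    have "\<phi> y \<in> coord_vecs ?n" using \<phi>U[OF y] U(2) by blast
    then have d: "\<phi> y = \<phi> (\<pi> (\<phi> y)) + pm_scale (h (\<phi> y)) u" by (rule dec)
    then have "pm_scale (h (\<phi> y)) u = \<phi> y - \<phi> (\<pi> (\<phi> y))" by (metis add_diff_cancel_left')
    then have "pm_scale (h (\<phi> y)) u \<in> U"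
      using pm.subspace_diff[OF U(1) \<phi>U[OF y] \<phi>U[OF \<pi>c]] by simp
    then show h0: "h (\<phi> y) = 0" by (rule uU)
    then have "\<phi> y = \<phi> (\<pi> (\<phi> y))" using d by simp
    then show "\<pi> (\<phi> y) = y" using \<phi>inj \<pi>c y by metis
  qed
  have zero: "0 \<in> coord_vecs N" by (simp add: coord_vecs_iff)
  have hu: "h u = 1" and piu: "\<pi> u = 0"
  proof -
    have d: "u = \<phi> (\<pi> u) + pm_scale (h u) u" by (rule dec[OF uc])
    then have "pm_scale (1 - h u) u = \<phi> (\<pi> u)"
      by (metis add_diff_cancel_right' pm.scale_left_diff_distrib pm.scale_one)
    then have "1 - h u = 0" using \<phi>U[OF \<pi>c] uU by metis
    then show "h u = 1" by simp
    then have "\<phi> (\<pi> u) = 0" using d by (metis add_cancel_left_left pm.scale_one)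
    then show "\<pi> u = 0" using \<phi>inj[OF _ \<pi>c zero] \<phi>0 by metis
  qed
  have u0: "u \<noteq> 0" using u(2) pm.subspace_0[OF U(1)] by blast
  have "\<not> V \<subseteq> pm.span {u}"
  proof
    assume "V \<subseteq> pm.span {u}"
    then have "pm.dim V \<le> card {u}" by (rule pm.dim_le_card) simp
    then show False using V(3) by simp
  qed
  \<comment> \<open>Projecting a second vector of the line from \<open>u\<close> gives the point
    where the line meets the hyperplane.\<close>
  then obtain v where v: "v \<in> V" "v \<notin> pm.span {u}" by blast
  define q where "q = \<pi> v"
  have dv: "v = \<phi> q + pm_scale (h v) u" unfolding q_def using dec v(1) V(2) by blast
  have qV: "\<phi> q \<in> V"
  proof -
    have "\<phi> q = v - pm_scale (h v) u" using dv by (metis add_diff_cancel_right')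
    then show ?thesis using pm.subspace_diff[OF V(1) v(1) pm.subspace_scale[OF V(1) u(1)]] by simp
  qed
  have su: "pm_scale b u \<in> pm.span {u}" for b by (intro pm.span_scale pm.span_base) simp
  have qspan: "\<phi> q \<notin> pm.span {u}"
    using dv v(2) pm.span_add[of "\<phi> q" "{u}" "pm_scale (h v) u"] su by metis
  have q0: "q \<noteq> 0" using qspan \<phi>0 pm.span_zero by metis
  have qc: "q \<in> coord_vecs N" unfolding q_def by (rule \<pi>c)
  have ind: "pm.independent {\<phi> q, u}"
    using pm.independent_insertI[OF qspan] u0 by simp
  have Vspan: "x \<in> pm.span {\<phi> q, u}" if x: "x \<in> V" for x
  proof (rule ccontr)
    assume nx: "x \<notin> pm.span {\<phi> q, u}"
    obtain B where B: "B \<subseteq> V" "pm.independent B" "V \<subseteq> pm.span B" "card B = 2"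
      using pm.basis_exists[of V] V(3) by metis
    have "finite B" using B(4) card_gt_0_iff[of B] by simp
    moreover have "pm.independent {x, \<phi> q, u}" by (rule pm.independent_insertI[OF nx ind])
    moreover have "{x, \<phi> q, u} \<subseteq> pm.span B" using x qV u(1) B(3) by blast
    ultimately have "card {x, \<phi> q, u} \<le> 2" using pm.independent_span_bound B(4) by metis
    moreover have "x \<notin> {\<phi> q, u}" "\<phi> q \<noteq> u" using nx qspan pm.span_base by blast+
    ultimately show False by simp
  qed
  show ?thesis
  proof (rule that)
    show "points_in_hyperplane_and_line N \<phi> \<pi> h c p k u q Y A"
      if "Y \<subseteq> coord_vecs N" "0 \<notin> Y" "finite A" "A \<noteq> {}" for Y A
    proof (rule points_in_hyperplane_and_line.intro)
      show "c i \<in> coord_vecs ?n" if "i \<le> N" for i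
      proof -
        have "single i 1 \<in> coord_vecs N" using that by (auto simp: coord_vecs_iff lookup_single when_def)
        then show ?thesis unfolding c_def using \<psi>U U(2) by blast
      qed
    qed (fact N \<phi>_def \<pi>_def h_def p uc qc q0 dec piphi hphi piu hu that)+
    show "\<phi> y = \<psi> y" if "y \<in> coord_vecs N" for y by (rule \<phi>\<psi>[OF that])
    show "\<exists>a. P = pt (pm_scale a (\<phi> q) + u)" if "P \<in> L" "P \<notin> H" for P
    proof -
      have P: "P \<in> proj_space ?n" "P \<subseteq> V" "\<not> P \<subseteq> U" using that by (auto simp: LV HU)
      then obtain w where w: "P = pt w" by (auto simp: proj_space_eq)
      have "w \<in> V" using P(2) w pt_self by blast
      then have "w \<in> pm.span {\<phi> q, u}" by (rule Vspan)
      then obtain a b where "w - pm_scale a (\<phi> q) = pm_scale b u"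
        unfolding pm.span_breakdown_eq[of w "\<phi> q"] pm.span_singleton by blast
      then have wb: "w = pm_scale a (\<phi> q) + pm_scale b u" by (simp add: algebra_simps)
      have "b \<noteq> 0"
      proof
        assume "b = 0"
        then have "w \<in> U" using wb pm.subspace_scale[OF U(1) \<phi>U[OF qc]] by simp
        then have "P \<subseteq> U" unfolding w pt_def using pm.subspace_scale[OF U(1)] by blast
        then show False using P(3) by blast
      qed
      then have "w = pm_scale b (pm_scale (a / b) (\<phi> q) + u)"
        by (simp add: wb pm.scale_right_distrib)
      then have "P = pt (pm_scale (a / b) (\<phi> q) + u)"
        using w pt_scale[OF \<open>b \<noteq> 0\<close>] by metis
      then show ?thesis by blast
    qed
  qed
qed

lemma (in points_in_hyperplane_and_line) socle_tuple_nontrivial_iff: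
  assumes res: "resolution n (vanishing_ideal n (pt ` W)) a D"
  shows "nontrivial_tuple t f \<longleftrightarrow>
    resolution.socle_tuple n (vanishing_ideal n (pt ` W)) t f \<and>
    \<not> (\<exists>g\<in>forms n (t - 1). \<forall>i\<le>n. f i - var i * g \<in> vanishing_ideal n (pt ` W))"
proof -
  have I: "p \<in> vanishing_ideal n (pt ` W) \<longleftrightarrow> vanishes p" if "p \<in> forms n e" for p e
    using vanishing_ideal_forms[OF that] by (simp add: vanishes_def)
  have 1: "var i * f j - var j * f i \<in> vanishing_ideal n (pt ` W) \<longleftrightarrow> vanishes (var i * f j - var j * f i)"
    if "\<forall>i\<le>n. f i \<in> forms n t" "i \<le> n" "j \<le> n" for i j
    using that by (intro I[of _ "t + 1"] forms_diff forms_var_mult) auto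
  have 2: "f i - var i * g \<in> vanishing_ideal n (pt ` W) \<longleftrightarrow> vanishes (f i - var i * g)"
    if "\<forall>i\<le>n. f i \<in> forms n t" "i \<le> n" "g \<in> forms n (t - 1)" for i g
    using that forms_var_mult[OF that(2,3)] by (intro I[of _ t] forms_diff) auto
  show ?thesis
    unfolding nontrivial_tuple_def resolution.socle_tuple_def[OF res]
    using 1 2 by (auto; metis)
qed

section \<open>Generic points and the minimal degree\<close>

text \<open>One representative is chosen for each point of the set pulled back along the chart, so
  that counting points becomes counting vectors.\<close>

lemma generic_hilbert_function:
  assumes chart: "hyperplane_chart n H \<psi>" and X: "finite X" "X \<subseteq> H"
  obtains Y where "Y \<subseteq> coord_vecs (n - 1)" "0 \<notin> Y" "finite Y" "card Y = card X" "inj_on pt Y"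
    "X = pt ` \<psi> ` Y" "{Q \<in> proj_space (n - 1). \<psi> ` Q \<in> X} = pt ` Y"
proof -
  define X' where "X' = {Q \<in> proj_space (n - 1). \<psi> ` Q \<in> X}"
  have lin: "Vector_Spaces.linear pm_scale pm_scale \<psi>"
    and inj: "inj_on \<psi> (coord_vecs (n - 1))"
    and img: "(\<lambda>Q. \<psi> ` Q) ` proj_space (n - 1) = H"
    using chart by (auto simp: hyperplane_chart_def)
  have "X' \<subseteq> pt ` (coord_vecs (n - 1) - {0})" unfolding X'_def proj_space_eq by blast
  then obtain Y where Y: "Y \<subseteq> coord_vecs (n - 1) - {0}" "inj_on pt Y" "X' = pt ` Y"
    unfolding subset_image_inj by blast
  have XX': "X = (\<lambda>Q. \<psi> ` Q) ` X'" using X(2) img unfolding X'_def by blast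
  also have "\<dots> = pt ` \<psi> ` Y" unfolding Y(3) image_image linear_pt[OF lin] ..
  finally have XY: "X = pt ` \<psi> ` Y" .
  have coord: "Q \<subseteq> coord_vecs (n - 1)" if "Q \<in> X'" for Q
    using that unfolding X'_def proj_space_eq pt_def by (auto simp: coord_vecs_scale)
  have "inj_on (\<lambda>Q. \<psi> ` Q) X'"
    by (rule inj_onI) (simp only: inj_on_image_eq_iff[OF inj coord coord])
  from card_image[OF this] finite_imageD[OF _ this] have "card X' = card X" "finite X'"
    using XX' X(1) by simp_all
  then have "card Y = card X" "finite Y"
    using card_image[OF Y(2)] finite_imageD[OF _ Y(2)] Y(3) by simp_all
  show ?thesis
  proof (rule that)
    show "Y \<subseteq> coord_vecs (n - 1)" "0 \<notin> Y" using Y(1) by auto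
    show "{Q \<in> proj_space (n - 1). \<psi> ` Q \<in> X} = pt ` Y" using Y(3) unfolding X'_def .
  qed fact+
qed

lemma binomial_le_shift: "m \<le> k \<Longrightarrow> (m + N) choose N \<le> (k + N) choose N"
  by (rule binomial_right_mono) simp

text \<open>Here N = n - 1, so that the hyperplane has coordinates \<open>x_0\<close>, ...,
  \<open>x_N\<close>, and \<beta> stands for d(\<Gamma>).\<close>

lemma theorem_successor_dimension:
  fixes \<Gamma>\<^sub>1 \<Gamma>\<^sub>2 H L \<Gamma> :: "(nat \<Rightarrow>\<^sub>0 'a::field_char_0) set set"
  assumes N: "1 \<le> N" and H: "hyperplane (Suc N) H"
    and gen: "generic_in_hyperplane (Suc N) H \<Gamma>\<^sub>1" and \<alpha>: "card \<Gamma>\<^sub>1 = \<alpha>"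
    and L: "line (Suc N) L" "\<not> L \<subseteq> H"
    and \<Gamma>\<^sub>2: "finite \<Gamma>\<^sub>2" "\<Gamma>\<^sub>2 \<subseteq> L" "card \<Gamma>\<^sub>2 = \<beta>" "\<beta> \<ge> 1" "\<Gamma>\<^sub>2 \<inter> H = {}"
    and \<alpha>\<beta>: "\<alpha> \<ge> \<beta> + N - 1" and \<Gamma>: "\<Gamma> = \<Gamma>\<^sub>1 \<union> \<Gamma>\<^sub>2"
    and res: "minimal_graded_free_resolution (Suc N) (vanishing_ideal (Suc N) \<Gamma>) a D"
  shows "\<alpha> < (\<beta> + N - 2) choose N \<Longrightarrow> int \<beta> > A_inv (Suc N) a"
    and "\<alpha> \<ge> (\<beta> + N) choose N \<Longrightarrow> int \<beta> = A_inv (Suc N) a"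
proof -
  obtain \<psi> where fin1: "finite \<Gamma>\<^sub>1" and sub1: "\<Gamma>\<^sub>1 \<subseteq> H" and chart: "hyperplane_chart (Suc N) H \<psi>"
    and hf': "\<And>i. hilbert_function (Suc N - 1) {Q \<in> proj_space (Suc N - 1). \<psi> ` Q \<in> \<Gamma>\<^sub>1} i =
        min ((i + Suc N - 1) choose (Suc N - 1)) (card \<Gamma>\<^sub>1)"
    using gen unfolding generic_in_hyperplane_def by blast
  have hf: "hilbert_function N {Q \<in> proj_space N. \<psi> ` Q \<in> \<Gamma>\<^sub>1} i = min ((i + N) choose N) \<alpha>" for i
    using hf'[of i] \<alpha> by simp
  obtain Y where Y': "Y \<subseteq> coord_vecs (Suc N - 1)" "0 \<notin> Y" "finite Y" "card Y = card \<Gamma>\<^sub>1" "inj_on pt Y"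
    and \<Gamma>1: "\<Gamma>\<^sub>1 = pt ` \<psi> ` Y"
    and XY': "{Q \<in> proj_space (Suc N - 1). \<psi> ` Q \<in> \<Gamma>\<^sub>1} = pt ` Y"
    by (rule generic_hilbert_function[OF chart fin1 sub1])
  have Y: "Y \<subseteq> coord_vecs N" "0 \<notin> Y" "finite Y" "card Y = \<alpha>" "inj_on pt Y"
    using Y' \<alpha> by simp_all
  have XY: "{Q \<in> proj_space N. \<psi> ` Q \<in> \<Gamma>\<^sub>1} = pt ` Y" using XY' unfolding diff_Suc_1 .
  obtain \<phi> \<pi> h c p k u q
    where loc: "\<And>Y A. Y \<subseteq> coord_vecs N \<Longrightarrow> 0 \<notin> Y \<Longrightarrow> finite A \<Longrightarrow> A \<noteq> {} \<Longrightarrow>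
        points_in_hyperplane_and_line N \<phi> \<pi> h c p k u q Y A"
      and \<phi>\<psi>: "\<And>y. y \<in> coord_vecs N \<Longrightarrow> \<phi> y = \<psi> y"
      and linepts: "\<And>P. P \<in> L \<Longrightarrow> P \<notin> H \<Longrightarrow> \<exists>a. P = pt (pm_scale a (\<phi> q) + u)"
  proof (rule adapted_coordinates[OF N H chart L], goal_cases)
    case (1 \<phi> \<pi> h c p k u q)
    show thesis by (rule 1(1)[OF 1(2-4)])
  qed
  have "\<Gamma>\<^sub>2 \<subseteq> range (\<lambda>a. pt (pm_scale a (\<phi> q) + u))"
    using linepts \<Gamma>\<^sub>2(2,5) by blast
  then obtain A where inj: "inj_on (\<lambda>a. pt (pm_scale a (\<phi> q) + u)) A"
    and \<Gamma>2A: "\<Gamma>\<^sub>2 = (\<lambda>a. pt (pm_scale a (\<phi> q) + u)) ` A"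
    unfolding subset_image_inj by blast
  have cardA: "card A = \<beta>" and finA: "finite A"
    using card_image[OF inj] finite_imageD[OF _ inj] \<Gamma>\<^sub>2(1,3) \<Gamma>2A by auto
  then have "A \<noteq> {}" using \<Gamma>\<^sub>2(4) by auto
  interpret points_in_hyperplane_and_line N \<phi> \<pi> h c p k u q Y A
    by (rule loc[OF Y(1,2) finA \<open>A \<noteq> {}\<close>])
  have "\<phi> ` Y = \<psi> ` Y" using \<phi>\<psi> Y(1) by (intro image_cong) auto
  then have "\<Gamma>\<^sub>1 = pt ` \<phi> ` Y" using \<Gamma>1 by simp
  then have \<Gamma>W: "\<Gamma> = pt ` W"
    unfolding \<Gamma> \<Gamma>2A W_def line_point_def image_Un by (simp add: image_image)
  have R: "resolution n (vanishing_ideal n (pt ` W)) a D"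
    using res N by (auto simp: resolution_def \<Gamma>W)
  interpret R: resolution n "vanishing_ideal n (pt ` W)" a D by (rule R)
  have upper: "\<exists>x\<in>set (a n). x \<le> t + int n" if "nontrivial_tuple t f" for t f
    using R.degree_le_of_socle_tuple that unfolding socle_tuple_nontrivial_iff[OF R] by blast
  have lower: "\<exists>f. nontrivial_tuple (x - int n) f" if "x \<in> set (a n)" for x
    using R.socle_tuple_of_degree[OF that] unfolding socle_tuple_nontrivial_iff[OF R] by blast
  {
    assume small: "\<alpha> < (\<beta> + N - 2) choose N"
    \<comment> \<open>For \<beta> = 1 the binomial coefficient is that of N - 1 over N, which is
      0.\<close>
    have \<beta>2: "2 \<le> \<beta>"
    proof (rule ccontr)
      assume "\<not> 2 \<le> \<beta>"
      then have "\<beta> + N - 2 < N" using N by simp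
      then show False using small by (simp add: binomial_eq_0)
    qed
    then have \<alpha>2: "2 \<le> card Y" using \<alpha>\<beta> N Y(4) by simp
    \<comment> \<open>In degree \<beta> - 2 there are more monomials than points, so genericity
      makes the points impose independent conditions.\<close>
    have "hilbert_function N (pt ` Y) (\<beta> - 2) = card Y"
      using hf[of "\<beta> - 2"] small \<beta>2 by (simp add: XY Y(4))
    from separators_exist[OF this Y(3)] have sep: "\<exists>E\<in>forms N (int (card A) - 2). poly_eval E y \<noteq> 0 \<and>
        (\<forall>z\<in>Y - {y}. poly_eval E z = 0)" if "y \<in> Y" for y
      using that \<beta>2 by (simp add: cardA of_nat_diff)
    \<comment> \<open>The line meets the hyperplane in one point, and there are at least two points
      to choose from.\<close>
    have "\<exists>y\<in>Y. \<nexists>b. y = pm_scale b q"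
    proof (rule ccontr)
      assume "\<not> (\<exists>y\<in>Y. \<nexists>b. y = pm_scale b q)"
      then have "pt y = pt q" if "y \<in> Y" for y
        using that Y(2) pt_scale by (metis pm.scale_zero_left)
      then have "pt ` Y \<subseteq> {pt q}" by blast
      then have "card (pt ` Y) \<le> 1" using card_mono[of "{pt q}" "pt ` Y"] by simp
      then show False using \<alpha>2 card_image[OF Y(5)] by simp
    qed
    then obtain t f where t: "t < int \<beta>" "nontrivial_tuple t f"
      using small_separators_nontrivial_tuple[OF sep] cardA by blast
    then obtain x where "x \<in> set (a n)" "x \<le> t + int n" using upper by blast
    then have "A_inv n a \<le> t"
      unfolding A_inv_def by (intro order.trans[OF Min_le, of _ "x - int n"]) auto
    then show "int \<beta> > A_inv n a" using t(1) by linarith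
  }
  {
    assume large: "\<alpha> \<ge> (\<beta> + N) choose N"
    \<comment> \<open>No degree up to \<beta> has more than \<alpha> monomials, so the Hilbert
      function is maximal in all of them.\<close>
    have van: "E = 0" if e: "e \<le> int (card A)" "E \<in> forms N e" "\<forall>y\<in>Y. poly_eval E y = 0" for E e
    proof (cases "e < 0")
      case True
      then show ?thesis using forms_neg e(2) by blast
    next
      case False
      then obtain i where i: "e = int i" by (metis nonneg_int_cases not_le)
      then have "(i + N) choose N \<le> \<alpha>"
        using large binomial_le_shift[of i \<beta> N] e(1) cardA by simp
      then have "hilbert_function N (pt ` Y) i = (i + N) choose N"
        using hf[of i] by (simp add: XY)
      then show ?thesis using no_form_vanishes e(2,3) i by blast
    qed
    have ge: "int \<beta> \<le> x - int n" if x: "x \<in> set (a n)" for x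
    proof (rule ccontr)
      assume "\<not> int \<beta> \<le> x - int n"
      then have lt: "x - int n < int (card A)" using cardA by simp
      obtain f where f: "nontrivial_tuple (x - int n) f" using lower[OF x] by blast
      have "\<not> nontrivial_tuple (x - int n) f"
        by (rule no_nontrivial_tuple[OF _ lt]) (erule (2) van)
      then show False using f by blast
    qed
    obtain f where "nontrivial_tuple (int (card A)) f"
      using line_nontrivial_tuple van[of "int (card A) - 1"] by auto
    then obtain x where x: "x \<in> set (a n)" "x \<le> int \<beta> + int n"
      using upper cardA by blast
    have "A_inv n a = int \<beta>"
      unfolding A_inv_def
    proof (rule Min_eqI)
      have "x - int n = int \<beta>" using x ge[OF x(1)] by simp
      then show "int \<beta> \<in> (\<lambda>x. x - int n) ` set (a n)" using x(1) by force
    qed (use ge in auto)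
    then show "int \<beta> = A_inv n a" by simp
  }
qed

theorem theorem3p6:
  fixes \<Gamma>\<^sub>1 \<Gamma>\<^sub>2 H L \<Gamma> :: "(nat \<Rightarrow>\<^sub>0 'a::field_char_0) set set"
    and n \<alpha> \<beta> :: nat
    and a :: "nat \<Rightarrow> int list"
    and D :: "nat \<Rightarrow> 'a mpoly mat"
  assumes "n \<ge> 2"
    and "hyperplane n H"
    and "generic_in_hyperplane n H \<Gamma>\<^sub>1"
    and "card \<Gamma>\<^sub>1 = \<alpha>"
    and "proj_span n \<Gamma>\<^sub>1 = H"
    and "line n L"
    and "\<not> L \<subseteq> H"
    and "finite \<Gamma>\<^sub>2"
    and "\<Gamma>\<^sub>2 \<subseteq> L"
    and "card \<Gamma>\<^sub>2 = \<beta>"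
    and "\<beta> \<ge> 1"
    and "\<Gamma>\<^sub>2 \<inter> H = {}"
    and "\<alpha> \<ge> \<beta> + n - 2"
    and "\<Gamma> = \<Gamma>\<^sub>1 \<union> \<Gamma>\<^sub>2"
    and "hyp n \<Gamma> = \<alpha>"
    and "minimal_graded_free_resolution n (vanishing_ideal n \<Gamma>) a D"
  shows "(\<alpha> < (\<beta> + n - 3) choose (n - 1) \<longrightarrow> int (d_inv n \<Gamma>) > A_inv n a) \<and>
         (\<alpha> \<ge> (\<beta> + n) choose (n - 1) \<longrightarrow> int (d_inv n \<Gamma>) = A_inv n a)"
proof -
  define N where "N = n - 1"
  have n: "n = Suc N" and N: "1 \<le> N" using assms(1) by (auto simp: N_def)
  have fin1: "finite \<Gamma>\<^sub>1" and sub1: "\<Gamma>\<^sub>1 \<subseteq> H"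
    using assms(3) by (auto simp: generic_in_hyperplane_def)
  then have "\<Gamma>\<^sub>1 \<inter> \<Gamma>\<^sub>2 = {}" using assms(12) by blast
  then have "card \<Gamma> = \<alpha> + \<beta>"
    using card_Un_disjoint[OF fin1 assms(8)] assms(4,10,14) by simp
  then have d: "d_inv n \<Gamma> = \<beta>" by (simp add: d_inv_def assms(15))
  have \<alpha>\<beta>: "\<alpha> \<ge> \<beta> + N - 1" using assms(13) by (simp add: n)
  note main = theorem_successor_dimension[OF N assms(2)[unfolded n] assms(3)[unfolded n] assms(4)
      assms(6)[unfolded n] assms(7-12) \<alpha>\<beta> assms(14) assms(16)[unfolded n]]
  show ?thesis
  proof (intro conjI impI)
    assume "\<alpha> < (\<beta> + n - 3) choose (n - 1)"
    then show "A_inv n a < int (d_inv n \<Gamma>)" unfolding d using main(1) by (simp add: n)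
  next
    assume "(\<beta> + n) choose (n - 1) \<le> \<alpha>"
    \<comment> \<open>The left side is the number of monomials of degree \<beta> in the coordinates
      of the hyperplane.\<close>
    moreover have "(\<beta> + N) choose N \<le> (\<beta> + n) choose (n - 1)"
      unfolding n by (simp add: binomial_right_mono)
    ultimately show "int (d_inv n \<Gamma>) = A_inv n a" unfolding d using main(2) by (simp add: n)
  qed
qed

end
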